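(* Let $R$ be a commutative ring, let $p$ be a prime integer, let $s$ be a positive integer, and let $F\in\mathcal{P}_{s,R}$ be a nonzero $p$-primary strict polynomial functor. Then: (1) The degree $\deg(F)$ is an element of $\mathcal{I}(p,s)$. (2) If $\deg(F)<s$, the integral torsion of $F$ is bounded by $p^r$, with $r=\left\lceil\frac{\deg(F)+1-\Sigma_p(s)}{p-1}\right\rceil$.
   Context: Let $\mathrm{P}_R$ be the category of finitely generated projective $R$-modules. For an integer $s\ge 0$, the Schur category $\Gamma^s\mathrm{P}_R$ is the $R$-linear category with the same objects as $\mathrm{P}_R$, with morphisms $\mathrm{Hom}_{\Gamma^s\mathrm{P}_R}(M,N)=\mathrm{Hom}_{\mathfrak{S}_s}(M^{\otimes s},N^{\otimes s})\simeq\Gamma^s(\mathrm{Hom}_R(M,N))$ (the $\mathfrak{S}_s$-equivariant $R$-linear maps, $\mathfrak{S}_s$ permuting tensor factors; $M^{\otimes 0}=R$), and composition of equivariant maps. The category $\mathcal{P}_{s,R}$ of homogeneous strict polynomial functors of weight $s$ is the abelian category of $R$-linear functors $\Gamma^s\mathrm{P}_R\to R\text{-Mod}$. Each $F\in\mathcal{P}_{s,R}$ has an underlying ordinary functor $\mathrm{P}_R\to R\text{-Mod}$, obtained by precomposing with the functor $\mathrm{P}_R\to\Gamma^s\mathrm{P}_R$ which is the identity on objects and $f\mapsto f^{\otimes s}$ on morphisms. Degree (Eilenberg–Mac Lane). For a functor $F:\mathcal{A}\to\mathcal{B}$ from an additive to an abelian category, the cross effects are the natural direct summands defined inductively by $\mathrm{cr}_1F(X)\oplus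 F(0)=F(X)$ and $\mathrm{cr}_dF(X_1,\dots,X_d)\oplus \mathrm{cr}_{d-1}F(X_1,X_3,\dots,X_d)\oplus \mathrm{cr}_{d-1}F(X_2,X_3,\dots,X_d)=\mathrm{cr}_{d-1}F(X_1\oplus X_2,X_3,\dots,X_d)$. $F$ has degree $\le d$ if $\mathrm{cr}_{d+1}F=0$, and degree $d$ if moreover $\mathrm{cr}_dF\neq 0$ (nonzero constant functors have degree $0$); the zero functor has degree $-\infty$. The degree $\deg(F)$ of a strict polynomial functor is the degree of its underlying ordinary functor. $F$ is $p$-primary if for all $M\in\mathrm{P}_R$ every element of the abelian group $F(M)$ is killed by some power of $p$. The (integral) torsion of $F$ is bounded by an integer $n$ if $nx=0$ for all $M\in\mathrm{P}_R$ and all $x\in F(M)$. $\Sigma_p(s)$ denotes the sum of the digits of the $p$-adic expansion of $s$, and $\mathcal{I}(p,s)=\{n\in\mathbb{N}\mid n\equiv s \bmod (p-1),\ \Sigma_p(s)\le n\le s\}$. $\lceil x\rceil$ is the smallest integer $\ge x$. *)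

theory Defs
  imports Complex_Main "HOL-Algebra.Module" "HOL-Algebra.AbelCoset" "HOL-Combinatorics.Permutations"
    "HOL-Number_Theory.Cong" "HOL-Library.FuncSet"
begin

section \<open>Linear maps, free modules, quotients\<close>

definition linear_map ::
    "('a, 'q) ring_scheme \<Rightarrow> ('a, 'b, 'm) module_scheme \<Rightarrow> ('a, 'c, 'n) module_scheme \<Rightarrow> ('b \<Rightarrow> 'c) \<Rightarrow> bool" where
  "linear_map R M N f \<longleftrightarrow>
     f \<in> carrier M \<rightarrow> carrier N \<and>
     (\<forall>x\<in>carrier M. \<forall>y\<in>carrier M. f (x \<oplus>\<^bsub>M\<^esub> y) = f x \<oplus>\<^bsub>N\<^esub> f y) \<and>
     (\<forall>a\<in>carrier R. \<forall>x\<in>carrier M. f (a \<odot>\<^bsub>M\<^esub> x) = a \<odot>\<^bsub>N\<^esub> f x)"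

text \<open>
  Morphisms are represented by functions that are \<^const>\<open>undefined\<close> off the carrier of their source,
  so that equality of morphisms is equality in HOL; identities are restrictions and composition is
  \<^const>\<open>compose\<close>. The fields \<^const>\<open>monoid.mult\<close> and \<^const>\<open>monoid.one\<close>, which the record of modules inherits
  from rings, carry no meaning and are left unspecified.
\<close>

definition hom_module ::
    "('a, 'q) ring_scheme \<Rightarrow> ('a, 'b, 'm) module_scheme \<Rightarrow> ('a, 'c, 'n) module_scheme \<Rightarrow> ('a, 'b \<Rightarrow> 'c) module" where
  "hom_module R M N =
     \<lparr>carrier = {f \<in> extensional (carrier M). linear_map R M N f},
      monoid.mult = undefined, one = undefined,
      zero = (\<lambda>x\<in>carrier M. \<zero>\<^bsub>N\<^esub>),
      add = (\<lambda>f g. \<lambda>x\<in>carrier M. f x \<oplus>\<^bsub>N\<^esub> g x),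
      smult = (\<lambda>a f. \<lambda>x\<in>carrier M. a \<odot>\<^bsub>N\<^esub> f x)\<rparr>"

abbreviation id_mor :: "('a, 'b, 'm) module_scheme \<Rightarrow> 'b \<Rightarrow> 'b" where
  "id_mor M \<equiv> (\<lambda>x\<in>carrier M. x)"

definition free_module :: "('a, 'q) ring_scheme \<Rightarrow> 'i set \<Rightarrow> ('a, 'i \<Rightarrow> 'a) module" where
  "free_module R S =
     \<lparr>carrier = {f \<in> S \<rightarrow>\<^sub>E carrier R. finite {i \<in> S. f i \<noteq> \<zero>\<^bsub>R\<^esub>}},
      monoid.mult = undefined, one = undefined,
      zero = (\<lambda>i\<in>S. \<zero>\<^bsub>R\<^esub>),
      add = (\<lambda>f g. \<lambda>i\<in>S. f i \<oplus>\<^bsub>R\<^esub> g i),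
      smult = (\<lambda>a f. \<lambda>i\<in>S. a \<otimes>\<^bsub>R\<^esub> f i)\<rparr>"

definition basis_vector :: "('a, 'q) ring_scheme \<Rightarrow> 'i set \<Rightarrow> 'i \<Rightarrow> 'i \<Rightarrow> 'a" where
  "basis_vector R S j = (\<lambda>i\<in>S. if i = j then \<one>\<^bsub>R\<^esub> else \<zero>\<^bsub>R\<^esub>)"

definition span_module ::
    "('a, 'q) ring_scheme \<Rightarrow> ('a, 'b, 'm) module_scheme \<Rightarrow> 'b set \<Rightarrow> 'b set" where
  "span_module R M A = \<Inter>{H. submodule H R M \<and> A \<subseteq> H}"

definition quotient_module ::
    "('a, 'b, 'm) module_scheme \<Rightarrow> 'b set \<Rightarrow> ('a, 'b set) module" where
  "quotient_module M H =
     \<lparr>carrier = a_rcosets\<^bsub>M\<^esub> H,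
      monoid.mult = undefined, one = undefined,
      zero = H,
      add = (\<lambda>C D. C <+>\<^bsub>M\<^esub> D),
      smult = (\<lambda>a C. H <+>\<^bsub>M\<^esub> ((\<lambda>x. a \<odot>\<^bsub>M\<^esub> x) ` C))\<rparr>"


section \<open>Finitely generated projective modules\<close>

definition finitely_generated :: "('a, 'q) ring_scheme \<Rightarrow> ('a, 'b, 'm) module_scheme \<Rightarrow> bool" where
  "finitely_generated R M \<longleftrightarrow>
     (\<exists>A. finite A \<and> A \<subseteq> carrier M \<and> span_module R M A = carrier M)"

text \<open>
  Projective means being a direct summand of a free module. Restricting the index set of the free
  module to subsets of the type of elements of \<open>M\<close> is harmless: if \<open>M\<close> is projective, then the
  canonical surjection onto \<open>M\<close> from the free module on \<open>carrier M\<close> splits.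
\<close>

definition projective_module :: "('a, 'q) ring_scheme \<Rightarrow> ('a, 'b, 'm) module_scheme \<Rightarrow> bool" where
  "projective_module R M \<longleftrightarrow>
     (\<exists>(S :: 'b set) i q. linear_map R M (free_module R S) i \<and> linear_map R (free_module R S) M q \<and>
        (\<forall>x\<in>carrier M. q (i x) = x))"

text \<open>
  The category of finitely generated projective modules is essentially small, and functors on it are
  taken on the following small model: all such modules, with arbitrary module structure, whose
  elements are sequences in the type of \<open>R\<close>. Every finitely generated projective module is
  isomorphic to one of these, because it embeds in some power of \<open>R\<close>.
\<close>

type_synonym 'a seq_module = "('a, nat \<Rightarrow> 'a) module"

definition proj_modules :: "'a ring \<Rightarrow> 'a seq_module set" where
  "proj_modules R = {M. module R M \<and> finitely_generated R M \<and> projective_module R M}"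


section \<open>Tensor powers\<close>

abbreviation tuples :: "nat \<Rightarrow> ('a, 'b, 'm) module_scheme \<Rightarrow> (nat \<Rightarrow> 'b) set" where
  "tuples s M \<equiv> {..<s} \<rightarrow>\<^sub>E carrier M"

definition tensor_relations ::
    "('a, 'q) ring_scheme \<Rightarrow> nat \<Rightarrow> ('a, 'b, 'm) module_scheme \<Rightarrow> ((nat \<Rightarrow> 'b) \<Rightarrow> 'a) set" where
  "tensor_relations R s M =
     (let L = free_module R (tuples s M); e = basis_vector R (tuples s M) in
      {e (x(i := u \<oplus>\<^bsub>M\<^esub> v)) \<ominus>\<^bsub>L\<^esub> (e (x(i := u)) \<oplus>\<^bsub>L\<^esub> e (x(i := v))) | x i u v.
         x \<in> tuples s M \<and> i < s \<and> u \<in> carrier M \<and> v \<in> carrier M} \<union>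
      {e (x(i := a \<odot>\<^bsub>M\<^esub> u)) \<ominus>\<^bsub>L\<^esub> a \<odot>\<^bsub>L\<^esub> e (x(i := u)) | x i a u.
         x \<in> tuples s M \<and> i < s \<and> a \<in> carrier R \<and> u \<in> carrier M})"

definition tensor_kernel ::
    "('a, 'q) ring_scheme \<Rightarrow> nat \<Rightarrow> ('a, 'b, 'm) module_scheme \<Rightarrow> ((nat \<Rightarrow> 'b) \<Rightarrow> 'a) set" where
  "tensor_kernel R s M = span_module R (free_module R (tuples s M)) (tensor_relations R s M)"

definition tensor_power ::
    "('a, 'q) ring_scheme \<Rightarrow> nat \<Rightarrow> ('a, 'b, 'm) module_scheme \<Rightarrow> ('a, ((nat \<Rightarrow> 'b) \<Rightarrow> 'a) set) module" where
  "tensor_power R s M = quotient_module (free_module R (tuples s M)) (tensor_kernel R s M)"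

definition pure_tensor ::
    "('a, 'q) ring_scheme \<Rightarrow> nat \<Rightarrow> ('a, 'b, 'm) module_scheme \<Rightarrow> (nat \<Rightarrow> 'b) \<Rightarrow> ((nat \<Rightarrow> 'b) \<Rightarrow> 'a) set" where
  "pure_tensor R s M x =
     tensor_kernel R s M +>\<^bsub>free_module R (tuples s M)\<^esub> basis_vector R (tuples s M) x"

text \<open>The linear map out of a tensor power with prescribed values on pure tensors
  (it exists and is unique whenever the prescription is multilinear).\<close>

definition tensor_lift ::
    "('a, 'q) ring_scheme \<Rightarrow> nat \<Rightarrow> ('a, 'b, 'm) module_scheme \<Rightarrow> ('a, 'c, 'n) module_scheme \<Rightarrow>
     ((nat \<Rightarrow> 'b) \<Rightarrow> 'c) \<Rightarrow> ((nat \<Rightarrow> 'b) \<Rightarrow> 'a) set \<Rightarrow> 'c" where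
  "tensor_lift R s M N \<phi> =
     (THE h. h \<in> carrier (hom_module R (tensor_power R s M) N) \<and>
        (\<forall>x\<in>tuples s M. h (pure_tensor R s M x) = \<phi> x))"

definition tensor_map ::
    "('a, 'q) ring_scheme \<Rightarrow> nat \<Rightarrow> ('a, 'b, 'm) module_scheme \<Rightarrow> ('a, 'c, 'n) module_scheme \<Rightarrow>
     ('b \<Rightarrow> 'c) \<Rightarrow> ((nat \<Rightarrow> 'b) \<Rightarrow> 'a) set \<Rightarrow> ((nat \<Rightarrow> 'c) \<Rightarrow> 'a) set" where
  "tensor_map R s M N f =
     tensor_lift R s M (tensor_power R s N) (\<lambda>x. pure_tensor R s N (\<lambda>i\<in>{..<s}. f (x i)))"

text \<open>Left action: the factor in position \<open>i\<close> moves to position \<open>\<sigma> i\<close>.\<close>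

definition tensor_perm ::
    "('a, 'q) ring_scheme \<Rightarrow> nat \<Rightarrow> ('a, 'b, 'm) module_scheme \<Rightarrow> (nat \<Rightarrow> nat) \<Rightarrow>
     ((nat \<Rightarrow> 'b) \<Rightarrow> 'a) set \<Rightarrow> ((nat \<Rightarrow> 'b) \<Rightarrow> 'a) set" where
  "tensor_perm R s M \<sigma> =
     tensor_lift R s M (tensor_power R s M) (\<lambda>x. pure_tensor R s M (\<lambda>i\<in>{..<s}. x (inv_into UNIV \<sigma> i)))"


section \<open>Strict polynomial functors\<close>

definition schur_hom ::
    "('a, 'q) ring_scheme \<Rightarrow> nat \<Rightarrow> ('a, 'b, 'm) module_scheme \<Rightarrow> ('a, 'c, 'n) module_scheme \<Rightarrow>
     ('a, ((nat \<Rightarrow> 'b) \<Rightarrow> 'a) set \<Rightarrow> ((nat \<Rightarrow> 'c) \<Rightarrow> 'a) set) module" where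
  "schur_hom R s M N =
     (hom_module R (tensor_power R s M) (tensor_power R s N))
       \<lparr>carrier := {h \<in> carrier (hom_module R (tensor_power R s M) (tensor_power R s N)).
          \<forall>\<sigma>. \<sigma> permutes {..<s} \<longrightarrow>
            (\<forall>t\<in>carrier (tensor_power R s M). h (tensor_perm R s M \<sigma> t) = tensor_perm R s N \<sigma> (h t))}\<rparr>"

type_synonym 'a schur_mor = "((nat \<Rightarrow> (nat \<Rightarrow> 'a)) \<Rightarrow> 'a) set \<Rightarrow> ((nat \<Rightarrow> (nat \<Rightarrow> 'a)) \<Rightarrow> 'a) set"

text \<open>A functor is a pair of an object map \<open>Fo\<close> and a morphism map \<open>Fm\<close>, the latter taking the
  source and the target as explicit arguments.\<close>

definition strict_poly_functor ::
    "'a ring \<Rightarrow> nat \<Rightarrow> ('a seq_module \<Rightarrow> ('a, 'v) module) \<Rightarrow>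
     ('a seq_module \<Rightarrow> 'a seq_module \<Rightarrow> 'a schur_mor \<Rightarrow> 'v \<Rightarrow> 'v) \<Rightarrow> bool" where
  "strict_poly_functor R s Fo Fm \<longleftrightarrow>
     (\<forall>M\<in>proj_modules R. module R (Fo M)) \<and>
     (\<forall>M\<in>proj_modules R. \<forall>N\<in>proj_modules R.
        linear_map R (schur_hom R s M N) (hom_module R (Fo M) (Fo N)) (Fm M N)) \<and>
     (\<forall>M\<in>proj_modules R. Fm M M (id_mor (tensor_power R s M)) = id_mor (Fo M)) \<and>
     (\<forall>L\<in>proj_modules R. \<forall>M\<in>proj_modules R. \<forall>N\<in>proj_modules R.
        \<forall>f\<in>carrier (schur_hom R s L M). \<forall>g\<in>carrier (schur_hom R s M N).
          Fm L N (compose (carrier (tensor_power R s L)) g f)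
            = compose (carrier (Fo L)) (Fm M N g) (Fm L M f))"

text \<open>Morphism map of the underlying ordinary functor (its object map is \<open>Fo\<close>).\<close>

definition underlying_mor ::
    "'a ring \<Rightarrow> nat \<Rightarrow> ('a seq_module \<Rightarrow> 'a seq_module \<Rightarrow> 'a schur_mor \<Rightarrow> 'v \<Rightarrow> 'v) \<Rightarrow>
     'a seq_module \<Rightarrow> 'a seq_module \<Rightarrow> ((nat \<Rightarrow> 'a) \<Rightarrow> (nat \<Rightarrow> 'a)) \<Rightarrow> 'v \<Rightarrow> 'v" where
  "underlying_mor R s Fm M N f = Fm M N (tensor_map R s M N f)"

definition nonzero_functor :: "'a ring \<Rightarrow> ('a seq_module \<Rightarrow> ('a, 'v) module) \<Rightarrow> bool" where
  "nonzero_functor R Fo \<longleftrightarrow> (\<exists>M\<in>proj_modules R. carrier (Fo M) \<noteq> {\<zero>\<^bsub>Fo M\<^esub>})"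

definition primary_functor :: "'a ring \<Rightarrow> nat \<Rightarrow> ('a seq_module \<Rightarrow> ('a, 'v) module) \<Rightarrow> bool" where
  "primary_functor R p Fo \<longleftrightarrow>
     (\<forall>M\<in>proj_modules R. \<forall>x\<in>carrier (Fo M). \<exists>k::nat. add_pow (Fo M) (p ^ k) x = \<zero>\<^bsub>Fo M\<^esub>)"

definition torsion_bounded :: "'a ring \<Rightarrow> nat \<Rightarrow> ('a seq_module \<Rightarrow> ('a, 'v) module) \<Rightarrow> bool" where
  "torsion_bounded R n Fo \<longleftrightarrow>
     (\<forall>M\<in>proj_modules R. \<forall>x\<in>carrier (Fo M). add_pow (Fo M) n x = \<zero>\<^bsub>Fo M\<^esub>)"


section \<open>Direct sums, cross effects, degree\<close>

text \<open>Direct sums stay within sequences by interleaving: the two components are the subsequences of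
  even and odd index.\<close>

definition evens :: "(nat \<Rightarrow> 'a) \<Rightarrow> nat \<Rightarrow> 'a" where "evens h = (\<lambda>n. h (2 * n))"

definition odds :: "(nat \<Rightarrow> 'a) \<Rightarrow> nat \<Rightarrow> 'a" where "odds h = (\<lambda>n. h (2 * n + 1))"

definition interleave :: "(nat \<Rightarrow> 'a) \<Rightarrow> (nat \<Rightarrow> 'a) \<Rightarrow> nat \<Rightarrow> 'a" where
  "interleave f g = (\<lambda>n. if even n then f (n div 2) else g (n div 2))"

definition dsum :: "'a seq_module \<Rightarrow> 'a seq_module \<Rightarrow> 'a seq_module" where
  "dsum X Y =
     \<lparr>carrier = {h. evens h \<in> carrier X \<and> odds h \<in> carrier Y},
      monoid.mult = undefined, one = undefined,
      zero = interleave \<zero>\<^bsub>X\<^esub> \<zero>\<^bsub>Y\<^esub>,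
      add = (\<lambda>h k. interleave (evens h \<oplus>\<^bsub>X\<^esub> evens k) (odds h \<oplus>\<^bsub>Y\<^esub> odds k)),
      smult = (\<lambda>a h. interleave (a \<odot>\<^bsub>X\<^esub> evens h) (a \<odot>\<^bsub>Y\<^esub> odds h))\<rparr>"

definition dsum_map ::
    "'a seq_module \<Rightarrow> 'a seq_module \<Rightarrow> ((nat \<Rightarrow> 'a) \<Rightarrow> (nat \<Rightarrow> 'a)) \<Rightarrow> ((nat \<Rightarrow> 'a) \<Rightarrow> (nat \<Rightarrow> 'a)) \<Rightarrow>
     (nat \<Rightarrow> 'a) \<Rightarrow> (nat \<Rightarrow> 'a)" where
  "dsum_map X Y f g = (\<lambda>h\<in>carrier (dsum X Y). interleave (f (evens h)) (g (odds h)))"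

definition proj_fst :: "'a seq_module \<Rightarrow> 'a seq_module \<Rightarrow> (nat \<Rightarrow> 'a) \<Rightarrow> (nat \<Rightarrow> 'a)" where
  "proj_fst X Y = (\<lambda>h\<in>carrier (dsum X Y). evens h)"

definition proj_snd :: "'a seq_module \<Rightarrow> 'a seq_module \<Rightarrow> (nat \<Rightarrow> 'a) \<Rightarrow> (nat \<Rightarrow> 'a)" where
  "proj_snd X Y = (\<lambda>h\<in>carrier (dsum X Y). odds h)"

definition zero_mod :: "'a ring \<Rightarrow> 'a seq_module" where
  "zero_mod R =
     (let z = (\<lambda>_. \<zero>\<^bsub>R\<^esub>) in
      \<lparr>carrier = {z}, monoid.mult = undefined, one = undefined,
       zero = z, add = (\<lambda>_ _. z), smult = (\<lambda>_ _. z)\<rparr>)"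

text \<open>\<open>dsum_list X [Y\<^sub>1, \<dots>, Y\<^sub>k]\<close> is the sum \<open>(\<cdots>(X \<oplus> Y\<^sub>1) \<oplus> \<cdots>) \<oplus> Y\<^sub>k\<close>, and \<open>map_ids X f [Y\<^sub>1, \<dots>, Y\<^sub>k]\<close>
  is \<open>f \<oplus> id \<oplus> \<cdots> \<oplus> id\<close>, where \<open>X\<close> is the source of \<open>f\<close>.\<close>

definition dsum_list :: "'a seq_module \<Rightarrow> 'a seq_module list \<Rightarrow> 'a seq_module" where
  "dsum_list X Ys = foldl dsum X Ys"

fun map_ids ::
    "'a seq_module \<Rightarrow> ((nat \<Rightarrow> 'a) \<Rightarrow> (nat \<Rightarrow> 'a)) \<Rightarrow> 'a seq_module list \<Rightarrow> (nat \<Rightarrow> 'a) \<Rightarrow> (nat \<Rightarrow> 'a)" where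
  "map_ids X f [] = f"
| "map_ids X f (Y # Ys) = map_ids (dsum X Y) (dsum_map X Y f (id_mor Y)) Ys"

text \<open>
  For an ordinary functor \<open>(Go, Gm)\<close>, \<open>cross_effect R Go Gm X [Y\<^sub>1, \<dots>, Y\<^sub>k]\<close> is the value
  of the cross effect of order \<open>k + 1\<close> at \<open>(X, Y\<^sub>1, \<dots>, Y\<^sub>k)\<close>, a submodule of the value of \<open>Go\<close>
  at \<open>dsum_list X [Y\<^sub>1, \<dots>, Y\<^sub>k]\<close>. The complement of \<open>G(0)\<close> in \<open>G(X)\<close> is
  the kernel of \<open>G(X) \<rightarrow> G(0)\<close>; likewise the complement of
  \<open>cr G(X, Ys) \<oplus> cr G(Y, Ys)\<close> in \<open>cr G(X \<oplus> Y, Ys)\<close> is the common kernel of the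
  two maps induced by the projections of \<open>X \<oplus> Y\<close>, which act by restriction of
  \<open>G(proj \<oplus> id \<oplus> \<cdots> \<oplus> id)\<close>.
\<close>

fun cross_effect ::
    "'a ring \<Rightarrow> ('a seq_module \<Rightarrow> ('a, 'v) module) \<Rightarrow>
     ('a seq_module \<Rightarrow> 'a seq_module \<Rightarrow> ((nat \<Rightarrow> 'a) \<Rightarrow> (nat \<Rightarrow> 'a)) \<Rightarrow> 'v \<Rightarrow> 'v) \<Rightarrow>
     'a seq_module \<Rightarrow> 'a seq_module list \<Rightarrow> 'v set" where
  "cross_effect R Go Gm X [] =
     {x \<in> carrier (Go X). Gm X (zero_mod R) (\<lambda>u\<in>carrier X. \<zero>\<^bsub>zero_mod R\<^esub>) x = \<zero>\<^bsub>Go (zero_mod R)\<^esub>}"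
| "cross_effect R Go Gm X (Y # Ys) =
     {x \<in> cross_effect R Go Gm (dsum X Y) Ys.
        Gm (dsum_list (dsum X Y) Ys) (dsum_list X Ys) (map_ids (dsum X Y) (proj_fst X Y) Ys) x
          = \<zero>\<^bsub>Go (dsum_list X Ys)\<^esub> \<and>
        Gm (dsum_list (dsum X Y) Ys) (dsum_list Y Ys) (map_ids (dsum X Y) (proj_snd X Y) Ys) x
          = \<zero>\<^bsub>Go (dsum_list Y Ys)\<^esub>}"

text \<open>Vanishing of the cross effect of order \<open>d\<close>, for \<open>d \<ge> 1\<close>.\<close>

definition cross_effect_vanishes ::
    "'a ring \<Rightarrow> ('a seq_module \<Rightarrow> ('a, 'v) module) \<Rightarrow>
     ('a seq_module \<Rightarrow> 'a seq_module \<Rightarrow> ((nat \<Rightarrow> 'a) \<Rightarrow> (nat \<Rightarrow> 'a)) \<Rightarrow> 'v \<Rightarrow> 'v) \<Rightarrow> nat \<Rightarrow> bool" where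
  "cross_effect_vanishes R Go Gm d \<longleftrightarrow>
     (\<forall>X Ys. set (X # Ys) \<subseteq> proj_modules R \<and> length (X # Ys) = d \<longrightarrow>
        cross_effect R Go Gm X Ys = {\<zero>\<^bsub>Go (dsum_list X Ys)\<^esub>})"

text \<open>Degree \<open>0\<close> means constant and nonzero; the zero functor (of degree \<open>-\<infinity>\<close>) has no degree
  in this sense.\<close>

definition has_degree ::
    "'a ring \<Rightarrow> ('a seq_module \<Rightarrow> ('a, 'v) module) \<Rightarrow>
     ('a seq_module \<Rightarrow> 'a seq_module \<Rightarrow> ((nat \<Rightarrow> 'a) \<Rightarrow> (nat \<Rightarrow> 'a)) \<Rightarrow> 'v \<Rightarrow> 'v) \<Rightarrow> nat \<Rightarrow> bool" where
  "has_degree R Go Gm d \<longleftrightarrow>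
     cross_effect_vanishes R Go Gm (d + 1) \<and>
     (if d = 0 then nonzero_functor R Go else \<not> cross_effect_vanishes R Go Gm d)"

definition strict_poly_degree ::
    "'a ring \<Rightarrow> nat \<Rightarrow> ('a seq_module \<Rightarrow> ('a, 'v) module) \<Rightarrow>
     ('a seq_module \<Rightarrow> 'a seq_module \<Rightarrow> 'a schur_mor \<Rightarrow> 'v \<Rightarrow> 'v) \<Rightarrow> nat \<Rightarrow> bool" where
  "strict_poly_degree R s Fo Fm d \<longleftrightarrow> has_degree R Fo (underlying_mor R s Fm) d"


section \<open>Digits\<close>

text \<open>The digits at positions beyond \<open>s\<close> all vanish, as \<open>s < p ^ s\<close> for \<open>p \<ge> 2\<close>.\<close>

definition digit_sum :: "nat \<Rightarrow> nat \<Rightarrow> nat" where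
  "digit_sum p s = (\<Sum>i\<le>s. s div p ^ i mod p)"

definition degree_set :: "nat \<Rightarrow> nat \<Rightarrow> nat set" where
  "degree_set p s = {n. [n = s] (mod (p - 1)) \<and> digit_sum p s \<le> n \<and> n \<le> s}"

end

theory Submission
  imports Defs "HOL-Combinatorics.Multiset_Permutations"
begin

text \<open>
  For linear maps \<open>\<phi>\<^sub>0, \<dots>, \<phi>\<^sub>k\<^sub>-\<^sub>1\<close> from \<open>M\<close> to \<open>N\<close> and a composition \<open>\<nu>\<close> of \<open>s\<close> into \<open>k\<close> parts, let
  \<open>T\<^sub>\<nu>(\<phi>)\<close> be the equivariant map \<open>\<Sum> \<phi>\<^bsub>f(0)\<^esub> \<otimes> \<dots> \<otimes> \<phi>\<^bsub>f(s-1)\<^esub>\<close>, summed over the functions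
  \<open>f\<close> that take each value \<open>j\<close> exactly \<open>\<nu>\<^sub>j\<close> times. When \<open>\<phi>\<close> runs through the projectors of a
  decomposition \<open>D = X\<^sub>0 \<oplus> \<dots> \<oplus> X\<^sub>k\<^sub>-\<^sub>1\<close>, the \<open>T\<^sub>\<nu>(\<phi>)\<close> are the weight projectors of \<open>D\<close> and sum to
  the identity, so the cross effect of order \<open>k\<close> is the sum of the weight spaces with all
  \<open>\<nu>\<^sub>j > 0\<close>. Hence, if the cross effects of order \<open>k\<close> vanish, then \<open>F\<close> sends \<open>T\<^sub>\<nu>(\<phi>)\<close> to \<open>0\<close> for every \<open>\<phi>\<close>
  and every \<open>\<nu>\<close> with \<open>k\<close> positive parts, because \<open>T\<^sub>\<nu>(\<phi>)\<close> factors through that weight space of \<open>M\<^sup>k\<close>.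

  Let \<open>d\<close> be the degree and \<open>\<nu>\<close> a weight with \<open>d\<close> positive parts which occurs in \<open>F\<close>. Splitting a part
  \<open>a + b\<close> multiplies \<open>T\<^sub>\<nu>(\<phi>)\<close> by a binomial coefficient; for a part that is not a power of \<open>p\<close> this
  coefficient can be made prime to \<open>p\<close>, contradicting the vanishing in order \<open>d + 1\<close>. So \<open>s\<close> is a sum of
  \<open>d\<close> powers of \<open>p\<close>, which gives the first claim. If \<open>d < s\<close>, split one of these powers into \<open>p\<close> equal
  parts and take all \<open>\<phi>\<^sub>j\<close> to be the identity: the resulting multinomial coefficient kills \<open>F\<close>, and
  Legendre's formula computes its \<open>p\<close>-adic valuation.
\<close>

section \<open>Linear maps\<close>

text \<open>The obstacle is that \<open>cross_effect\<close> is a subset cut out by kernels of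
  projections in a left-nested sum, while the argument needs weight projectors. Two facts connect
  them. An operator lands in the cross effect if, for every summand, each of its terms has a factor
  with values in that summand alone. Conversely, dropping a summand kills the cross effect, so
  weights with a zero part contribute nothing to it. A coefficient prime to p gives a contradiction
  because F is p-primary: such an integer acts injectively on F(M). The coefficient exists because a
  positive number that is not a power of p is a sum of two positive numbers added without carry in
  base p. The exponent r comes from counting parts. Breaking p^e into p copies of p^(e-1) leaves d +
  p - 1 powers of p, each of digit sum 1, so the multinomial coefficient has valuation v with (p -
  1) v = d + p - 1 - \<Sigma>_p(s), and this v is the ceiling r. Degree 0 is excluded by s > 0: in
  order 1 the weight (s) is allowed, and its operator for the identity map is the identity.\<close>

lemma linear_mapI:
  assumes "\<And>x. x \<in> carrier M \<Longrightarrow> f x \<in> carrier N"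
    and "\<And>x y. x \<in> carrier M \<Longrightarrow> y \<in> carrier M \<Longrightarrow> f (x \<oplus>\<^bsub>M\<^esub> y) = f x \<oplus>\<^bsub>N\<^esub> f y"
    and "\<And>a x. a \<in> carrier R \<Longrightarrow> x \<in> carrier M \<Longrightarrow> f (a \<odot>\<^bsub>M\<^esub> x) = a \<odot>\<^bsub>N\<^esub> f x"
  shows "linear_map R M N f"
  using assms by (auto simp: linear_map_def)

lemma
  assumes "linear_map R M N f"
  shows linear_map_closed: "x \<in> carrier M \<Longrightarrow> f x \<in> carrier N"
    and linear_map_add: "x \<in> carrier M \<Longrightarrow> y \<in> carrier M \<Longrightarrow> f (x \<oplus>\<^bsub>M\<^esub> y) = f x \<oplus>\<^bsub>N\<^esub> f y"
    and linear_map_smult: "a \<in> carrier R \<Longrightarrow> x \<in> carrier M \<Longrightarrow> f (a \<odot>\<^bsub>M\<^esub> x) = a \<odot>\<^bsub>N\<^esub> f x"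
  using assms by (auto simp: linear_map_def)

lemma linear_map_comp:
  assumes "linear_map R L M f" "linear_map R M N g"
  shows "linear_map R L N (\<lambda>x. g (f x))"
  using assms by (auto simp: linear_map_def Pi_iff)

lemma linear_map_cong:
  assumes "linear_map R M N f" "module R M" "\<And>x. x \<in> carrier M \<Longrightarrow> g x = f x"
  shows "linear_map R M N g"
proof -
  interpret M: module R M by fact
  show ?thesis using assms(1,3) by (auto simp: linear_map_def Pi_iff)
qed

lemma linear_map_id: "linear_map R M M (\<lambda>x. x)"
  by (auto simp: linear_map_def)

lemma linear_map_zero_fun: "module R N \<Longrightarrow> linear_map R M N (\<lambda>x. \<zero>\<^bsub>N\<^esub>)"
proof -
  assume "module R N"
  then interpret N: module R N .
  show ?thesis by (auto simp: linear_map_def)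
qed

lemma linear_map_zero:
  assumes "module R M" "module R N" "linear_map R M N f"
  shows "f \<zero>\<^bsub>M\<^esub> = \<zero>\<^bsub>N\<^esub>"
proof -
  interpret M: module R M by fact
  interpret N: module R N by fact
  have "f \<zero>\<^bsub>M\<^esub> = f (\<zero>\<^bsub>R\<^esub> \<odot>\<^bsub>M\<^esub> \<zero>\<^bsub>M\<^esub>)"
    by (simp only: M.smult_l_null M.M.zero_closed)
  also have "\<dots> = \<zero>\<^bsub>N\<^esub>"
    using linear_map_smult[OF assms(3) M.R.zero_closed M.M.zero_closed]
      linear_map_closed[OF assms(3) M.M.zero_closed] by (metis N.smult_l_null)
  finally show ?thesis .
qed

lemma linear_map_a_inv:
  assumes "module R M" "module R N" "linear_map R M N f" "x \<in> carrier M"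
  shows "f (\<ominus>\<^bsub>M\<^esub> x) = \<ominus>\<^bsub>N\<^esub> f x"
proof -
  interpret M: module R M by fact
  interpret N: module R N by fact
  note f = linear_map_closed[OF assms(3)]
  have "f (\<ominus>\<^bsub>M\<^esub> x) \<oplus>\<^bsub>N\<^esub> f x = \<zero>\<^bsub>N\<^esub>"
    using linear_map_add[OF assms(3), of "\<ominus>\<^bsub>M\<^esub> x" x] linear_map_zero[OF assms(1-3)] assms(4)
    by (simp add: M.M.l_neg)
  then show ?thesis using f assms(4) by (metis M.M.a_inv_closed N.M.minus_equality)
qed

lemma linear_map_minus:
  assumes "module R M" "module R N" "linear_map R M N f" "x \<in> carrier M" "y \<in> carrier M"
  shows "f (x \<ominus>\<^bsub>M\<^esub> y) = f x \<ominus>\<^bsub>N\<^esub> f y"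
proof -
  interpret M: module R M by fact
  show ?thesis using assms(4,5) linear_map_add[OF assms(3)] linear_map_a_inv[OF assms(1-3)]
    by (simp add: a_minus_def)
qed

lemma linear_map_finsum:
  assumes "module R M" "module R N" "linear_map R M N f" "\<And>i. i \<in> A \<Longrightarrow> x i \<in> carrier M"
  shows "f (\<Oplus>\<^bsub>M\<^esub>i\<in>A. x i) = (\<Oplus>\<^bsub>N\<^esub>i\<in>A. f (x i))"
proof -
  interpret M: module R M by fact
  interpret N: module R N by fact
  note f = linear_map_closed[OF assms(3)]
  show ?thesis using assms(4)
  proof (induction A rule: infinite_finite_induct)
    case (infinite A)
    then show ?case using linear_map_zero[OF assms(1-3)] by (simp add: M.M.finsum_infinite N.M.finsum_infinite)
  next
    case empty
    then show ?case using linear_map_zero[OF assms(1-3)] by simp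
  next
    case (insert i A)
    then show ?case using linear_map_add[OF assms(3)] f
      by (simp add: Pi_iff M.M.finsum_insert N.M.finsum_insert)
  qed
qed

lemma linear_map_add_pow:
  assumes "module R M" "module R N" "linear_map R M N f" "x \<in> carrier M"
  shows "f (add_pow M (n::nat) x) = add_pow N n (f x)"
proof -
  interpret M: module R M by fact
  interpret N: module R N by fact
  note f = linear_map_closed[OF assms(3)]
  show ?thesis
    by (induction n) (use assms linear_map_zero[OF assms(1-3)] linear_map_add[OF assms(3)] f in auto)
qed

lemma linear_map_sum_fun:
  assumes "module R N" "\<And>i. i \<in> A \<Longrightarrow> linear_map R M N (f i)"
  shows "linear_map R M N (\<lambda>x. \<Oplus>\<^bsub>N\<^esub>i\<in>A. f i x)"
proof -
  interpret N: module R N by fact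
  note f = linear_map_closed[OF assms(2)]
  show ?thesis
  proof (cases "finite A")
    case True
    show ?thesis
    proof (rule linear_mapI)
      fix x assume x: "x \<in> carrier M"
      show "(\<Oplus>\<^bsub>N\<^esub>i\<in>A. f i x) \<in> carrier N" using f x by (intro N.M.finsum_closed) auto
      fix y assume y: "y \<in> carrier M"
      have "(\<Oplus>\<^bsub>N\<^esub>i\<in>A. f i (x \<oplus>\<^bsub>M\<^esub> y)) = (\<Oplus>\<^bsub>N\<^esub>i\<in>A. f i x \<oplus>\<^bsub>N\<^esub> f i y)"
        by (rule N.M.finsum_cong') (use f x y linear_map_add[OF assms(2)] in auto)
      then show "(\<Oplus>\<^bsub>N\<^esub>i\<in>A. f i (x \<oplus>\<^bsub>M\<^esub> y)) = (\<Oplus>\<^bsub>N\<^esub>i\<in>A. f i x) \<oplus>\<^bsub>N\<^esub> (\<Oplus>\<^bsub>N\<^esub>i\<in>A. f i y)"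
        using f x y by (subst (asm) N.M.finsum_addf) auto
    next
      fix a x assume x: "a \<in> carrier R" "x \<in> carrier M"
      have "(\<Oplus>\<^bsub>N\<^esub>i\<in>A. f i (a \<odot>\<^bsub>M\<^esub> x)) = (\<Oplus>\<^bsub>N\<^esub>i\<in>A. a \<odot>\<^bsub>N\<^esub> f i x)"
        by (rule N.M.finsum_cong') (use f x linear_map_smult[OF assms(2)] in auto)
      then show "(\<Oplus>\<^bsub>N\<^esub>i\<in>A. f i (a \<odot>\<^bsub>M\<^esub> x)) = a \<odot>\<^bsub>N\<^esub> (\<Oplus>\<^bsub>N\<^esub>i\<in>A. f i x)"
        using f x True by (subst N.finsum_smult_ldistr) auto
    qed
  next
    \<comment> \<open>A sum over an infinite set is zero by convention, and the zero map is
      linear.\<close>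
    case False
    then show ?thesis using linear_map_zero_fun[OF assms(1), of M] by (simp add: N.M.finsum_infinite)
  qed
qed

text \<open>Additive inverses come for free: \<open>(\<ominus> \<one>) \<odot> x\<close> is inverse to \<open>x\<close>.\<close>

lemma moduleI_no_inverse:
  fixes R (structure) and M (structure)
  assumes cring: "cring R"
    and add_closed: "\<And>x y. x \<in> carrier M \<Longrightarrow> y \<in> carrier M \<Longrightarrow> x \<oplus>\<^bsub>M\<^esub> y \<in> carrier M"
    and zero_closed: "\<zero>\<^bsub>M\<^esub> \<in> carrier M"
    and add_assoc: "\<And>x y z. x \<in> carrier M \<Longrightarrow> y \<in> carrier M \<Longrightarrow> z \<in> carrier M \<Longrightarrow>
      (x \<oplus>\<^bsub>M\<^esub> y) \<oplus>\<^bsub>M\<^esub> z = x \<oplus>\<^bsub>M\<^esub> (y \<oplus>\<^bsub>M\<^esub> z)"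
    and add_comm: "\<And>x y. x \<in> carrier M \<Longrightarrow> y \<in> carrier M \<Longrightarrow> x \<oplus>\<^bsub>M\<^esub> y = y \<oplus>\<^bsub>M\<^esub> x"
    and add_zero: "\<And>x. x \<in> carrier M \<Longrightarrow> \<zero>\<^bsub>M\<^esub> \<oplus>\<^bsub>M\<^esub> x = x"
    and smult_closed: "\<And>a x. a \<in> carrier R \<Longrightarrow> x \<in> carrier M \<Longrightarrow> a \<odot>\<^bsub>M\<^esub> x \<in> carrier M"
    and smult_zero: "\<And>x. x \<in> carrier M \<Longrightarrow> \<zero> \<odot>\<^bsub>M\<^esub> x = \<zero>\<^bsub>M\<^esub>"
    and smult_l_distr: "\<And>a b x. a \<in> carrier R \<Longrightarrow> b \<in> carrier R \<Longrightarrow> x \<in> carrier M \<Longrightarrow>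
      (a \<oplus> b) \<odot>\<^bsub>M\<^esub> x = (a \<odot>\<^bsub>M\<^esub> x) \<oplus>\<^bsub>M\<^esub> (b \<odot>\<^bsub>M\<^esub> x)"
    and smult_r_distr: "\<And>a x y. a \<in> carrier R \<Longrightarrow> x \<in> carrier M \<Longrightarrow> y \<in> carrier M \<Longrightarrow>
      a \<odot>\<^bsub>M\<^esub> (x \<oplus>\<^bsub>M\<^esub> y) = (a \<odot>\<^bsub>M\<^esub> x) \<oplus>\<^bsub>M\<^esub> (a \<odot>\<^bsub>M\<^esub> y)"
    and smult_assoc1: "\<And>a b x. a \<in> carrier R \<Longrightarrow> b \<in> carrier R \<Longrightarrow> x \<in> carrier M \<Longrightarrow>
      (a \<otimes> b) \<odot>\<^bsub>M\<^esub> x = a \<odot>\<^bsub>M\<^esub> (b \<odot>\<^bsub>M\<^esub> x)"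
    and smult_one: "\<And>x. x \<in> carrier M \<Longrightarrow> \<one> \<odot>\<^bsub>M\<^esub> x = x"
  shows "module R M"
proof (intro moduleI abelian_groupI)
  interpret R: cring R by fact
  fix x assume x: "x \<in> carrier M"
  have "(\<ominus> \<one>) \<odot>\<^bsub>M\<^esub> x \<oplus>\<^bsub>M\<^esub> x = (\<ominus> \<one>) \<odot>\<^bsub>M\<^esub> x \<oplus>\<^bsub>M\<^esub> \<one> \<odot>\<^bsub>M\<^esub> x"
    using x smult_one by simp
  also have "\<dots> = \<zero>\<^bsub>M\<^esub>"
    using x smult_l_distr[of "\<ominus> \<one>" \<one> x] smult_zero by (simp add: R.l_neg)
  finally show "\<exists>y\<in>carrier M. y \<oplus>\<^bsub>M\<^esub> x = \<zero>\<^bsub>M\<^esub>"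
    using smult_closed[of "\<ominus> \<one>" x] x by blast
qed (use assms in auto)

section \<open>Modules of linear maps\<close>

lemma hom_module_carrier_iff:
  "f \<in> carrier (hom_module R M N) \<longleftrightarrow> f \<in> extensional (carrier M) \<and> linear_map R M N f"
  by (simp add: hom_module_def)

lemma module_hom_module:
  assumes "module R M" "module R N"
  shows "module R (hom_module R M N)"
proof -
  interpret M: module R M by fact
  interpret N: module R N by fact
  show ?thesis
  proof (rule moduleI_no_inverse, goal_cases)
    case 1
    show ?case by (rule M.R.is_cring)
  next
    case (7 a f)
    \<comment> \<open>Commutativity of \<open>R\<close> enters here: a multiple of a linear map is
      linear because the two scalars can be exchanged.\<close>
    have "b \<odot>\<^bsub>N\<^esub> (a \<odot>\<^bsub>N\<^esub> y) = a \<odot>\<^bsub>N\<^esub> (b \<odot>\<^bsub>N\<^esub> y)"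
      if "b \<in> carrier R" "y \<in> carrier N" for b y
      using that 7(1) by (metis M.R.m_comm N.smult_assoc1)
    with 7 show ?case
      by (auto simp: hom_module_def linear_map_def Pi_iff N.smult_r_distr)
  qed (auto simp: hom_module_def linear_map_def Pi_iff extensional_def fun_eq_iff
      N.M.a_ac N.smult_l_distr N.smult_r_distr N.smult_assoc1)
qed

lemma restrict_mem_hom_module:
  assumes "module R M" "linear_map R M N f"
  shows "restrict f (carrier M) \<in> carrier (hom_module R M N)"
  using linear_map_cong[OF assms(2,1), of "restrict f (carrier M)"]
  by (auto simp: hom_module_carrier_iff)

lemma hom_module_eqI:
  assumes "f \<in> carrier (hom_module R M N)" "g \<in> carrier (hom_module R M N)"
    and "\<And>x. x \<in> carrier M \<Longrightarrow> f x = g x"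
  shows "f = g"
  using assms unfolding hom_module_carrier_iff by (metis extensionalityI)

section \<open>Free modules\<close>

lemma module_free_module:
  assumes "cring R"
  shows "module R (free_module R S)"
proof -
  interpret R: cring R by fact
  let ?L = "free_module R S"
  have car: "v \<in> carrier ?L \<longleftrightarrow>
      v \<in> extensional S \<and> (\<forall>i\<in>S. v i \<in> carrier R) \<and> finite {i \<in> S. v i \<noteq> \<zero>\<^bsub>R\<^esub>}" for v
    by (auto simp: free_module_def PiE_iff)
  have add: "(v \<oplus>\<^bsub>?L\<^esub> w) = (\<lambda>i\<in>S. v i \<oplus>\<^bsub>R\<^esub> w i)" for v w by (simp add: free_module_def)
  have smult: "(a \<odot>\<^bsub>?L\<^esub> w) = (\<lambda>i\<in>S. a \<otimes>\<^bsub>R\<^esub> w i)" for a w by (simp add: free_module_def)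
  have zero: "\<zero>\<^bsub>?L\<^esub> = (\<lambda>i\<in>S. \<zero>\<^bsub>R\<^esub>)" by (simp add: free_module_def)
  note simps = car add smult zero
  show ?thesis
  proof (rule moduleI_no_inverse)
    fix x y assume x: "x \<in> carrier ?L" and y: "y \<in> carrier ?L"
    have "{i \<in> S. (x \<oplus>\<^bsub>?L\<^esub> y) i \<noteq> \<zero>\<^bsub>R\<^esub>} \<subseteq> {i \<in> S. x i \<noteq> \<zero>\<^bsub>R\<^esub>} \<union> {i \<in> S. y i \<noteq> \<zero>\<^bsub>R\<^esub>}"
      by (auto simp: add)
    then have "finite {i \<in> S. (x \<oplus>\<^bsub>?L\<^esub> y) i \<noteq> \<zero>\<^bsub>R\<^esub>}"
      using x y unfolding car by (meson finite_UnI finite_subset)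
    with x y show "x \<oplus>\<^bsub>?L\<^esub> y \<in> carrier ?L" by (simp add: simps)
    show "x \<oplus>\<^bsub>?L\<^esub> y = y \<oplus>\<^bsub>?L\<^esub> x" unfolding add
      by (rule restrict_ext) (use x y in \<open>simp add: simps R.a_comm\<close>)
    fix z assume z: "z \<in> carrier ?L"
    show "(x \<oplus>\<^bsub>?L\<^esub> y) \<oplus>\<^bsub>?L\<^esub> z = x \<oplus>\<^bsub>?L\<^esub> (y \<oplus>\<^bsub>?L\<^esub> z)" unfolding add
      by (rule restrict_ext) (use x y z in \<open>simp add: simps R.a_assoc\<close>)
  next
    fix a x y assume a: "a \<in> carrier R" and x: "x \<in> carrier ?L" and y: "y \<in> carrier ?L"
    show "a \<odot>\<^bsub>?L\<^esub> (x \<oplus>\<^bsub>?L\<^esub> y) = a \<odot>\<^bsub>?L\<^esub> x \<oplus>\<^bsub>?L\<^esub> a \<odot>\<^bsub>?L\<^esub> y" unfolding add smult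
      by (rule restrict_ext) (use a x y in \<open>simp add: simps R.r_distr\<close>)
  next
    fix a x assume a: "a \<in> carrier R" and x: "x \<in> carrier ?L"
    have "{i \<in> S. (a \<odot>\<^bsub>?L\<^esub> x) i \<noteq> \<zero>\<^bsub>R\<^esub>} \<subseteq> {i \<in> S. x i \<noteq> \<zero>\<^bsub>R\<^esub>}"
      using a by (auto simp: smult)
    then have "finite {i \<in> S. (a \<odot>\<^bsub>?L\<^esub> x) i \<noteq> \<zero>\<^bsub>R\<^esub>}"
      using x unfolding car by (meson finite_subset)
    with a x show "a \<odot>\<^bsub>?L\<^esub> x \<in> carrier ?L" by (simp add: simps)
    fix b assume b: "b \<in> carrier R"
    show "(a \<oplus>\<^bsub>R\<^esub> b) \<odot>\<^bsub>?L\<^esub> x = a \<odot>\<^bsub>?L\<^esub> x \<oplus>\<^bsub>?L\<^esub> b \<odot>\<^bsub>?L\<^esub> x" unfolding add smult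
      by (rule restrict_ext) (use a b x in \<open>simp add: simps R.l_distr\<close>)
    show "(a \<otimes>\<^bsub>R\<^esub> b) \<odot>\<^bsub>?L\<^esub> x = a \<odot>\<^bsub>?L\<^esub> (b \<odot>\<^bsub>?L\<^esub> x)" unfolding smult
      by (rule restrict_ext) (use a b x in \<open>simp add: simps R.m_assoc\<close>)
  next
    fix x assume x: "x \<in> carrier ?L"
    show "\<zero>\<^bsub>?L\<^esub> \<oplus>\<^bsub>?L\<^esub> x = x" "\<zero>\<^bsub>R\<^esub> \<odot>\<^bsub>?L\<^esub> x = \<zero>\<^bsub>?L\<^esub>" "\<one>\<^bsub>R\<^esub> \<odot>\<^bsub>?L\<^esub> x = x"
      using x by (auto simp: simps fun_eq_iff extensional_def)
  qed (use assms in \<open>auto simp: simps\<close>)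
qed

lemma basis_vector_closed:
  assumes "cring R"
  shows "basis_vector R S j \<in> carrier (free_module R S)"
proof -
  interpret R: cring R by fact
  have "finite {i \<in> S. basis_vector R S j i \<noteq> \<zero>\<^bsub>R\<^esub>}"
    by (rule finite_subset[of _ "{j}"]) (auto simp: basis_vector_def split: if_splits)
  then show ?thesis by (auto simp: free_module_def basis_vector_def)
qed

text \<open>Summing over the support keeps the sum finite; over an infinite index set
  \<open>finsum\<close> would return zero.\<close>

definition free_lift ::
    "('a, 'q) ring_scheme \<Rightarrow> 'i set \<Rightarrow> ('a, 'c, 'n) module_scheme \<Rightarrow> ('i \<Rightarrow> 'c) \<Rightarrow> ('i \<Rightarrow> 'a) \<Rightarrow> 'c" where
  "free_lift R S N \<phi> v = (\<Oplus>\<^bsub>N\<^esub>i\<in>{i \<in> S. v i \<noteq> \<zero>\<^bsub>R\<^esub>}. v i \<odot>\<^bsub>N\<^esub> \<phi> i)"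

text \<open>Indices outside the support contribute zero. Additivity needs this freedom, since two
  vectors and their sum have different supports and must be compared on a common finite set.\<close>

lemma free_lift_superset:
  assumes "module R N" "\<phi> \<in> S \<rightarrow> carrier N" "v \<in> carrier (free_module R S)"
    and "finite A" "A \<subseteq> S" "{i \<in> S. v i \<noteq> \<zero>\<^bsub>R\<^esub>} \<subseteq> A"
  shows "free_lift R S N \<phi> v = (\<Oplus>\<^bsub>N\<^esub>i\<in>A. v i \<odot>\<^bsub>N\<^esub> \<phi> i)"
proof -
  interpret N: module R N by fact
  show ?thesis unfolding free_lift_def
  proof (rule N.M.add.finprod_mono_neutral_cong_left)
    show "(\<lambda>i. v i \<odot>\<^bsub>N\<^esub> \<phi> i) \<in> A \<rightarrow> carrier N"
      using assms by (auto simp: free_module_def PiE_iff Pi_iff)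
    show "v i \<odot>\<^bsub>N\<^esub> \<phi> i = \<zero>\<^bsub>N\<^esub>" if "i \<in> A - {i \<in> S. v i \<noteq> \<zero>\<^bsub>R\<^esub>}" for i
      using that assms N.smult_l_null[of "\<phi> i"] by (auto simp: Pi_iff)
  qed (use assms in auto)
qed

lemma linear_map_free_lift:
  assumes "module R N" "\<phi> \<in> S \<rightarrow> carrier N"
  shows "linear_map R (free_module R S) N (free_lift R S N \<phi>)"
proof -
  interpret N: module R N by fact
  have *: "v i \<in> carrier R" if "v \<in> carrier (free_module R S)" "i \<in> S" for v i
    using that by (auto simp: free_module_def PiE_iff)
  interpret L: module R "free_module R S" by (rule module_free_module[OF N.R.is_cring])
  show ?thesis
  proof (rule linear_mapI)
    fix v assume v: "v \<in> carrier (free_module R S)"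
    show "free_lift R S N \<phi> v \<in> carrier N"
      unfolding free_lift_def using assms *[OF v] by (intro N.M.finsum_closed) auto
    fix w assume w: "w \<in> carrier (free_module R S)"
    define A where "A = {i \<in> S. v i \<noteq> \<zero>\<^bsub>R\<^esub>} \<union> {i \<in> S. w i \<noteq> \<zero>\<^bsub>R\<^esub>}"
    have A: "finite A" "A \<subseteq> S" using v w by (auto simp: A_def free_module_def)
    have vw: "v \<oplus>\<^bsub>free_module R S\<^esub> w = (\<lambda>i\<in>S. v i \<oplus>\<^bsub>R\<^esub> w i)" by (simp add: free_module_def)
    have sup: "{i \<in> S. (v \<oplus>\<^bsub>free_module R S\<^esub> w) i \<noteq> \<zero>\<^bsub>R\<^esub>} \<subseteq> A"
      unfolding vw A_def by auto
    have "free_lift R S N \<phi> (v \<oplus>\<^bsub>free_module R S\<^esub> w)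
        = (\<Oplus>\<^bsub>N\<^esub>i\<in>A. (v \<oplus>\<^bsub>free_module R S\<^esub> w) i \<odot>\<^bsub>N\<^esub> \<phi> i)"
      by (rule free_lift_superset) (use assms A v w sup in auto)
    also have "\<dots> = (\<Oplus>\<^bsub>N\<^esub>i\<in>A. v i \<odot>\<^bsub>N\<^esub> \<phi> i \<oplus>\<^bsub>N\<^esub> w i \<odot>\<^bsub>N\<^esub> \<phi> i)"
      by (rule N.M.finsum_cong')
        (use A assms *[OF v] *[OF w] in \<open>auto simp: vw N.smult_l_distr Pi_iff subset_iff\<close>)
    also have "\<dots> = (\<Oplus>\<^bsub>N\<^esub>i\<in>A. v i \<odot>\<^bsub>N\<^esub> \<phi> i) \<oplus>\<^bsub>N\<^esub> (\<Oplus>\<^bsub>N\<^esub>i\<in>A. w i \<odot>\<^bsub>N\<^esub> \<phi> i)"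
      by (rule N.M.finsum_addf) (use A assms *[OF v] *[OF w] in \<open>auto simp: Pi_iff subset_iff\<close>)
    also have "(\<Oplus>\<^bsub>N\<^esub>i\<in>A. v i \<odot>\<^bsub>N\<^esub> \<phi> i) = free_lift R S N \<phi> v"
      by (rule free_lift_superset[symmetric]) (use assms A v in \<open>auto simp: A_def\<close>)
    also have "(\<Oplus>\<^bsub>N\<^esub>i\<in>A. w i \<odot>\<^bsub>N\<^esub> \<phi> i) = free_lift R S N \<phi> w"
      by (rule free_lift_superset[symmetric]) (use assms A w in \<open>auto simp: A_def\<close>)
    finally show "free_lift R S N \<phi> (v \<oplus>\<^bsub>free_module R S\<^esub> w) =
        free_lift R S N \<phi> v \<oplus>\<^bsub>N\<^esub> free_lift R S N \<phi> w" .
  next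
    fix a v assume a: "a \<in> carrier R" and v: "v \<in> carrier (free_module R S)"
    define A where "A = {i \<in> S. v i \<noteq> \<zero>\<^bsub>R\<^esub>}"
    have A: "finite A" "A \<subseteq> S" using v by (auto simp: A_def free_module_def)
    have av: "a \<odot>\<^bsub>free_module R S\<^esub> v = (\<lambda>i\<in>S. a \<otimes>\<^bsub>R\<^esub> v i)" by (simp add: free_module_def)
    have sup: "{i \<in> S. (a \<odot>\<^bsub>free_module R S\<^esub> v) i \<noteq> \<zero>\<^bsub>R\<^esub>} \<subseteq> A"
      unfolding av A_def using a by auto
    have "free_lift R S N \<phi> (a \<odot>\<^bsub>free_module R S\<^esub> v)
        = (\<Oplus>\<^bsub>N\<^esub>i\<in>A. (a \<odot>\<^bsub>free_module R S\<^esub> v) i \<odot>\<^bsub>N\<^esub> \<phi> i)"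
      by (rule free_lift_superset) (use assms A v a sup in auto)
    also have "\<dots> = (\<Oplus>\<^bsub>N\<^esub>i\<in>A. a \<odot>\<^bsub>N\<^esub> (v i \<odot>\<^bsub>N\<^esub> \<phi> i))"
      by (rule N.M.finsum_cong')
        (use A assms *[OF v] a in \<open>auto simp: av N.smult_assoc1 Pi_iff subset_iff\<close>)
    also have "\<dots> = a \<odot>\<^bsub>N\<^esub> free_lift R S N \<phi> v"
      unfolding free_lift_def A_def[symmetric]
      by (rule N.finsum_smult_ldistr[symmetric]) (use A assms *[OF v] a in \<open>auto simp: Pi_iff subset_iff\<close>)
    finally show "free_lift R S N \<phi> (a \<odot>\<^bsub>free_module R S\<^esub> v) = a \<odot>\<^bsub>N\<^esub> free_lift R S N \<phi> v" .
  qed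
qed

lemma free_lift_basis_vector:
  assumes "module R N" "\<phi> \<in> S \<rightarrow> carrier N" "j \<in> S"
  shows "free_lift R S N \<phi> (basis_vector R S j) = \<phi> j"
proof -
  interpret N: module R N by fact
  have "free_lift R S N \<phi> (basis_vector R S j) = (\<Oplus>\<^bsub>N\<^esub>i\<in>{j}. basis_vector R S j i \<odot>\<^bsub>N\<^esub> \<phi> i)"
    by (rule free_lift_superset) (use assms basis_vector_closed[OF N.R.is_cring] in
        \<open>auto simp: basis_vector_def split: if_splits\<close>)
  then show ?thesis using assms(2,3) by (simp add: basis_vector_def Pi_iff)
qed

text \<open>Induction on the support: setting one coordinate to zero splits off a multiple of a
  basis vector.\<close>

lemma linear_map_free_eqI:
  assumes "cring R" "module R N"
    and f: "linear_map R (free_module R S) N f" and g: "linear_map R (free_module R S) N g"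
    and eq: "\<And>j. j \<in> S \<Longrightarrow> f (basis_vector R S j) = g (basis_vector R S j)"
    and v: "v \<in> carrier (free_module R S)"
  shows "f v = g v"
proof -
  interpret R: cring R by fact
  interpret L: module R "free_module R S" by (rule module_free_module[OF assms(1)])
  define A where "A = {i \<in> S. v i \<noteq> \<zero>\<^bsub>R\<^esub>}"
  have "finite A" using v by (auto simp: A_def free_module_def)
  then show ?thesis using v A_def
  proof (induction A arbitrary: v)
    case empty
    then have "v = \<zero>\<^bsub>free_module R S\<^esub>"
      by (auto simp: free_module_def fun_eq_iff PiE_iff extensional_def)
    then show ?case using linear_map_zero[OF L.module_axioms assms(2) f]
        linear_map_zero[OF L.module_axioms assms(2) g] by simp
  next
    case (insert j A)
    define w where "w = v(j := \<zero>\<^bsub>R\<^esub>)"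
    have j: "j \<in> S" using insert by auto
    have A: "A = {i \<in> S. w i \<noteq> \<zero>\<^bsub>R\<^esub>}" using insert(2,5) by (auto simp: w_def)
    have w: "w \<in> carrier (free_module R S)" using insert(1,4) j A
      by (auto simp: free_module_def w_def PiE_iff extensional_def)
    have vj: "v j \<in> carrier R" using j insert(4) by (auto simp: free_module_def PiE_iff)
    have e: "basis_vector R S j \<in> carrier (free_module R S)" by (rule basis_vector_closed[OF assms(1)])
    have vw: "v = w \<oplus>\<^bsub>free_module R S\<^esub> v j \<odot>\<^bsub>free_module R S\<^esub> basis_vector R S j"
      using insert(4) j by (auto simp: free_module_def w_def fun_eq_iff basis_vector_def PiE_iff extensional_def)
    have "f w = g w" by (rule insert.IH[OF w A])
    then show ?case using eq[OF j] w e vj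
      by (subst (1 2) vw) (simp add: linear_map_add[OF f] linear_map_add[OF g]
          linear_map_smult[OF f] linear_map_smult[OF g])
  qed
qed

section \<open>Quotient modules\<close>

lemma submodule_imp_abelian_subgroup:
  assumes "module R M" "submodule H R M"
  shows "abelian_subgroup H M"
proof -
  interpret M: module R M by fact
  show ?thesis
    by (rule abelian_subgroupI3)
      (use assms(2) M.M.abelian_group_axioms in \<open>auto simp: submodule_def additive_subgroup_def\<close>)
qed

text \<open>Multiplying a coset of \<open>H\<close> elementwise by \<open>a\<close> only gives a
  coset of the possibly smaller \<open>a H\<close>; adding \<open>H\<close> fills it up
  again.\<close>

lemma quotient_smult_coset:
  assumes "module R M" "submodule H R M" "a \<in> carrier R" "x \<in> carrier M"
  shows "H <+>\<^bsub>M\<^esub> ((\<lambda>x. a \<odot>\<^bsub>M\<^esub> x) ` (H +>\<^bsub>M\<^esub> x)) = H +>\<^bsub>M\<^esub> (a \<odot>\<^bsub>M\<^esub> x)"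
proof -
  interpret M: module R M by fact
  interpret H: abelian_subgroup H M by (rule submodule_imp_abelian_subgroup[OF assms(1,2)])
  note E = M.submoduleE[OF assms(2)]
  show ?thesis
  proof (intro Set.set_eqI iffI)
    fix z assume "z \<in> H <+>\<^bsub>M\<^esub> ((\<lambda>x. a \<odot>\<^bsub>M\<^esub> x) ` (H +>\<^bsub>M\<^esub> x))"
    then obtain h h' where hh: "h \<in> H" "h' \<in> H" "z = h \<oplus>\<^bsub>M\<^esub> a \<odot>\<^bsub>M\<^esub> (h' \<oplus>\<^bsub>M\<^esub> x)"
      by (auto simp: set_add_def' a_r_coset_def')
    have "z = (h \<oplus>\<^bsub>M\<^esub> a \<odot>\<^bsub>M\<^esub> h') \<oplus>\<^bsub>M\<^esub> a \<odot>\<^bsub>M\<^esub> x"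
      using hh assms(3,4) E(1) by (simp add: subsetD M.smult_r_distr M.M.a_assoc)
    moreover have "h \<oplus>\<^bsub>M\<^esub> a \<odot>\<^bsub>M\<^esub> h' \<in> H" using hh assms(3) E by auto
    ultimately show "z \<in> H +>\<^bsub>M\<^esub> (a \<odot>\<^bsub>M\<^esub> x)" by (auto simp: a_r_coset_def')
  next
    fix z assume "z \<in> H +>\<^bsub>M\<^esub> (a \<odot>\<^bsub>M\<^esub> x)"
    then show "z \<in> H <+>\<^bsub>M\<^esub> ((\<lambda>x. a \<odot>\<^bsub>M\<^esub> x) ` (H +>\<^bsub>M\<^esub> x))"
      using H.a_rcos_self[OF assms(4)] by (auto simp: set_add_def' a_r_coset_def'[of M H "a \<odot>\<^bsub>M\<^esub> x"])
  qed
qed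

text \<open>The axioms are equations, so they pass to any image on which the operations are the
  induced ones. This spares computations with coset representatives.\<close>

lemma module_surjective_image:
  assumes "module R M" and car: "carrier Q = \<pi> ` carrier M"
    and add: "\<And>x y. x \<in> carrier M \<Longrightarrow> y \<in> carrier M \<Longrightarrow> \<pi> x \<oplus>\<^bsub>Q\<^esub> \<pi> y = \<pi> (x \<oplus>\<^bsub>M\<^esub> y)"
    and smult: "\<And>a x. a \<in> carrier R \<Longrightarrow> x \<in> carrier M \<Longrightarrow> a \<odot>\<^bsub>Q\<^esub> \<pi> x = \<pi> (a \<odot>\<^bsub>M\<^esub> x)"
    and zero: "\<zero>\<^bsub>Q\<^esub> = \<pi> \<zero>\<^bsub>M\<^esub>"
  shows "module R Q"
proof -
  interpret M: module R M by fact
  show ?thesis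
  proof (rule moduleI_no_inverse)
    show "C \<oplus>\<^bsub>Q\<^esub> D = D \<oplus>\<^bsub>Q\<^esub> C" if "C \<in> carrier Q" "D \<in> carrier Q" for C D
      using that by (auto simp: car add M.M.a_comm)
  qed (auto simp: car zero add smult M.R.is_cring M.M.a_assoc M.smult_l_distr M.smult_r_distr
      M.smult_assoc1)
qed

lemma
  assumes "module R M" "submodule H R M"
  shows module_quotient_module: "module R (quotient_module M H)"
    and linear_map_coset: "linear_map R M (quotient_module M H) (\<lambda>x. H +>\<^bsub>M\<^esub> x)"
proof -
  interpret M: module R M by fact
  interpret H: abelian_subgroup H M by (rule submodule_imp_abelian_subgroup[OF assms(1,2)])
  have car: "carrier (quotient_module M H) = (\<lambda>x. H +>\<^bsub>M\<^esub> x) ` carrier M"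
    by (auto simp: quotient_module_def A_RCOSETS_def')
  have add: "(H +>\<^bsub>M\<^esub> x) \<oplus>\<^bsub>quotient_module M H\<^esub> (H +>\<^bsub>M\<^esub> y) = H +>\<^bsub>M\<^esub> (x \<oplus>\<^bsub>M\<^esub> y)"
    if "x \<in> carrier M" "y \<in> carrier M" for x y
    using that by (simp add: quotient_module_def H.a_rcos_sum)
  have smult: "a \<odot>\<^bsub>quotient_module M H\<^esub> (H +>\<^bsub>M\<^esub> x) = H +>\<^bsub>M\<^esub> (a \<odot>\<^bsub>M\<^esub> x)"
    if "a \<in> carrier R" "x \<in> carrier M" for a x
    using that by (simp add: quotient_module_def quotient_smult_coset[OF assms])
  have zero: "\<zero>\<^bsub>quotient_module M H\<^esub> = H +>\<^bsub>M\<^esub> \<zero>\<^bsub>M\<^esub>"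
    using H.a_rcos_const[of "\<zero>\<^bsub>M\<^esub>"] by (simp add: quotient_module_def)
  show "module R (quotient_module M H)"
    by (rule module_surjective_image[OF assms(1) car add smult zero])
  show "linear_map R M (quotient_module M H) (\<lambda>x. H +>\<^bsub>M\<^esub> x)"
    by (rule linear_mapI) (auto simp: car add smult)
qed

lemma quotient_module_carrier:
  "carrier (quotient_module M H) = (\<lambda>x. H +>\<^bsub>M\<^esub> x) ` carrier M"
  by (auto simp: quotient_module_def A_RCOSETS_def')

lemma quotient_lift_exists:
  assumes "module R M" "submodule H R M" "module R N" "linear_map R M N g"
    and ker: "\<And>x. x \<in> H \<Longrightarrow> g x = \<zero>\<^bsub>N\<^esub>"
  shows "\<exists>h \<in> carrier (hom_module R (quotient_module M H) N). \<forall>x\<in>carrier M. h (H +>\<^bsub>M\<^esub> x) = g x"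
proof -
  interpret M: module R M by fact
  interpret N: module R N by fact
  interpret H: abelian_subgroup H M by (rule submodule_imp_abelian_subgroup[OF assms(1,2)])
  \<comment> \<open>Any representative will do: two of them differ by an element of
    \<open>H\<close>, which \<open>g\<close> kills.\<close>
  define h where "h C = g (SOME v. v \<in> C)" for C
  have h: "h (H +>\<^bsub>M\<^esub> x) = g x" if x: "x \<in> carrier M" for x
  proof -
    define v where "v = (SOME v. v \<in> H +>\<^bsub>M\<^esub> x)"
    have "v \<in> H +>\<^bsub>M\<^esub> x" unfolding v_def by (rule someI[of _ x]) (rule H.a_rcos_self[OF x])
    then obtain k where k: "k \<in> H" "v = k \<oplus>\<^bsub>M\<^esub> x" by (auto simp: a_r_coset_def')
    then have "g v = g x" using x ker[of k] linear_map_closed[OF assms(4)]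
      by (simp add: linear_map_add[OF assms(4)])
    then show ?thesis by (simp add: h_def v_def)
  qed
  have Q: "module R (quotient_module M H)" and lin: "linear_map R M (quotient_module M H) (\<lambda>x. H +>\<^bsub>M\<^esub> x)"
    by (rule module_quotient_module[OF assms(1,2)], rule linear_map_coset[OF assms(1,2)])
  let ?Q = "quotient_module M H"
  have "linear_map R ?Q N h"
  proof (rule linear_mapI)
    fix C assume "C \<in> carrier ?Q"
    then obtain x where x: "x \<in> carrier M" and C: "C = H +>\<^bsub>M\<^esub> x"
      by (auto simp: quotient_module_carrier)
    show "h C \<in> carrier N" using x h linear_map_closed[OF assms(4)] C by simp
    {
      fix D assume "D \<in> carrier ?Q"
      then obtain y where y: "y \<in> carrier M" and D: "D = H +>\<^bsub>M\<^esub> y"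
        by (auto simp: quotient_module_carrier)
      have "h (C \<oplus>\<^bsub>?Q\<^esub> D) = h (H +>\<^bsub>M\<^esub> (x \<oplus>\<^bsub>M\<^esub> y))"
        unfolding C D linear_map_add[OF lin x y] ..
      then show "h (C \<oplus>\<^bsub>?Q\<^esub> D) = h C \<oplus>\<^bsub>N\<^esub> h D"
        using x y C D by (simp add: h linear_map_add[OF assms(4)])
    }
    fix a assume a: "a \<in> carrier R"
    have "h (a \<odot>\<^bsub>?Q\<^esub> C) = h (H +>\<^bsub>M\<^esub> (a \<odot>\<^bsub>M\<^esub> x))"
      unfolding C linear_map_smult[OF lin a x] ..
    then show "h (a \<odot>\<^bsub>?Q\<^esub> C) = a \<odot>\<^bsub>N\<^esub> h C"
      using x a C by (simp add: h linear_map_smult[OF assms(4)])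
  qed
  then have "restrict h (carrier (quotient_module M H)) \<in> carrier (hom_module R (quotient_module M H) N)"
    by (rule restrict_mem_hom_module[OF Q])
  then show ?thesis using h by (intro bexI) (auto simp: quotient_module_carrier)
qed

lemma submodule_kernel:
  assumes "module R M" "module R N" "linear_map R M N f"
  shows "submodule {x \<in> carrier M. f x = \<zero>\<^bsub>N\<^esub>} R M"
proof -
  interpret M: module R M by fact
  interpret N: module R N by fact
  show ?thesis
    by (rule M.submoduleI)
      (auto simp: linear_map_zero[OF assms] linear_map_a_inv[OF assms] linear_map_add[OF assms(3)]
        linear_map_smult[OF assms(3)])
qed

lemma submodule_span_module:
  assumes "module R M" "A \<subseteq> carrier M"
  shows "submodule (span_module R M A) R M"
proof -
  interpret M: module R M by fact
  let ?F = "{H. submodule H R M \<and> A \<subseteq> H}"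
  \<comment> \<open>The family is nonempty, so that its intersection lies inside the module.\<close>
  have carrier: "carrier M \<in> ?F" using M.carrier_is_submodule assms(2) by auto
  have zero: "\<zero>\<^bsub>M\<^esub> \<in> H" if "submodule H R M" for H
    using subgroup.one_closed[OF submodule.axioms(1)[OF that]] by simp
  show ?thesis
    unfolding span_module_def
  proof (rule M.submoduleI)
    show "\<Inter>?F \<subseteq> carrier M" using carrier by (rule Inter_lower)
    show "\<zero>\<^bsub>M\<^esub> \<in> \<Inter>?F" using zero by blast
    show "\<ominus>\<^bsub>M\<^esub> x \<in> \<Inter>?F" if "x \<in> \<Inter>?F" for x
      using that M.submoduleE(3) by blast
    show "x \<oplus>\<^bsub>M\<^esub> y \<in> \<Inter>?F" if "x \<in> \<Inter>?F" "y \<in> \<Inter>?F" for x y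
      using that M.submoduleE(5) by blast
    show "a \<odot>\<^bsub>M\<^esub> x \<in> \<Inter>?F" if "a \<in> carrier R" "x \<in> \<Inter>?F" for a x
      using that M.submoduleE(4) by blast
  qed
qed

lemma span_module_minimal:
  "submodule H R M \<Longrightarrow> A \<subseteq> H \<Longrightarrow> span_module R M A \<subseteq> H"
  by (auto simp: span_module_def)

lemma span_module_superset: "A \<subseteq> span_module R M A"
  by (auto simp: span_module_def)

section \<open>Tensor powers\<close>

definition multilinear ::
    "('a, 'q) ring_scheme \<Rightarrow> nat \<Rightarrow> ('a, 'b, 'm) module_scheme \<Rightarrow> ('a, 'c, 'n) module_scheme \<Rightarrow>
     ((nat \<Rightarrow> 'b) \<Rightarrow> 'c) \<Rightarrow> bool" where
  "multilinear R s M N \<phi> \<longleftrightarrow>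
     (\<forall>x\<in>tuples s M. \<phi> x \<in> carrier N) \<and>
     (\<forall>x\<in>tuples s M. \<forall>i<s. linear_map R M N (\<lambda>u. \<phi> (x(i := u))))"

lemma
  assumes "multilinear R s M N \<phi>" "x \<in> tuples s M"
  shows multilinear_closed: "\<phi> x \<in> carrier N"
    and multilinear_slot: "i < s \<Longrightarrow> linear_map R M N (\<lambda>u. \<phi> (x(i := u)))"
  using assms by (auto simp: multilinear_def)

lemma tuples_upd: "x \<in> tuples s M \<Longrightarrow> i < s \<Longrightarrow> u \<in> carrier M \<Longrightarrow> x(i := u) \<in> tuples s M"
  by (auto simp: PiE_iff extensional_def)

lemma multilinear_precomp:
  assumes \<phi>: "multilinear R s N P \<phi>" and f: "\<And>i. i < s \<Longrightarrow> linear_map R M N (f i)"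
  shows "multilinear R s M P (\<lambda>x. \<phi> (\<lambda>i\<in>{..<s}. f i (x i)))"
proof -
  have mem: "(\<lambda>i\<in>{..<s}. f i (x i)) \<in> tuples s N" if "x \<in> tuples s M" for x
    using that linear_map_closed[OF f] by (auto simp: PiE_iff)
  show ?thesis
    unfolding multilinear_def
  proof (intro conjI ballI allI impI)
    fix x i assume x: "x \<in> tuples s M" and i: "i < s"
    have "(\<lambda>j\<in>{..<s}. f j ((x(i := u)) j)) = (\<lambda>j\<in>{..<s}. f j (x j))(i := f i u)" for u
      using i by (auto simp: fun_eq_iff)
    then show "linear_map R M P (\<lambda>u. \<phi> (\<lambda>j\<in>{..<s}. f j ((x(i := u)) j)))"
      using linear_map_comp[OF f[OF i] multilinear_slot[OF \<phi> mem[OF x] i]] by simp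
  qed (use mem \<phi> in \<open>auto simp: multilinear_def\<close>)
qed

lemma multilinear_permute:
  assumes \<phi>: "multilinear R s M P \<phi>" and \<tau>: "\<tau> permutes {..<s}"
  shows "multilinear R s M P (\<lambda>x. \<phi> (\<lambda>i\<in>{..<s}. x (\<tau> i)))"
proof -
  have lt: "\<tau> i < s \<longleftrightarrow> i < s" for i using permutes_in_image[OF \<tau>, of i] by simp
  have mem: "(\<lambda>i\<in>{..<s}. x (\<tau> i)) \<in> tuples s M" if "x \<in> tuples s M" for x
    using that lt by (auto simp: PiE_iff)
  show ?thesis
    unfolding multilinear_def
  proof (intro conjI ballI allI impI)
    fix x i assume x: "x \<in> tuples s M" and i: "i < s"
    \<comment> \<open>Slot \<open>i\<close> before the permutation becomes slot \<open>?j\<close>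
      after it.\<close>
    let ?j = "inv_into UNIV \<tau> i"
    have j: "?j < s" "\<tau> ?j = i" using i lt permutes_inverses(1)[OF \<tau>] by metis+
    have "(\<tau> k = i) = (k = ?j)" for k using permutes_inverses[OF \<tau>] by metis
    then have "(\<lambda>k\<in>{..<s}. (x(i := u)) (\<tau> k)) = (\<lambda>k\<in>{..<s}. x (\<tau> k))(?j := u)" for u
      using j by (auto simp: fun_eq_iff)
    then show "linear_map R M P (\<lambda>u. \<phi> (\<lambda>k\<in>{..<s}. (x(i := u)) (\<tau> k)))"
      using multilinear_slot[OF \<phi> mem[OF x] j(1)] by simp
  qed (use mem \<phi> in \<open>auto simp: multilinear_def\<close>)
qed

lemma multilinear_sum:
  assumes "module R N" "\<And>f. f \<in> S \<Longrightarrow> multilinear R s M N (\<phi> f)"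
  shows "multilinear R s M N (\<lambda>x. \<Oplus>\<^bsub>N\<^esub>f\<in>S. \<phi> f x)"
proof -
  interpret N: module R N by fact
  show ?thesis
    unfolding multilinear_def
  proof (intro conjI ballI allI impI)
    fix x assume x: "x \<in> tuples s M"
    show "(\<Oplus>\<^bsub>N\<^esub>f\<in>S. \<phi> f x) \<in> carrier N"
      using multilinear_closed[OF assms(2) x] by (intro N.M.finsum_closed) auto
    fix i assume i: "i < s"
    show "linear_map R M N (\<lambda>u. \<Oplus>\<^bsub>N\<^esub>f\<in>S. \<phi> f (x(i := u)))"
      by (rule linear_map_sum_fun[OF assms(1)]) (rule multilinear_slot[OF assms(2) x i])
  qed
qed

text \<open>The slots are expanded one at a time. After \<open>m\<close> steps the first
  \<open>m\<close> slots hold chosen summands and the others an arbitrary filler \<open>z\<close>;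
  the induction generalizes over \<open>z\<close> because the next slot must temporarily hold a
  whole sum.\<close>

lemma multilinear_expand:
  fixes k :: nat
  assumes P: "module R P" and N: "module R N" and \<phi>: "multilinear R s N P \<phi>"
    and y: "\<And>i j. i < s \<Longrightarrow> j < k \<Longrightarrow> y i j \<in> carrier N"
  shows "\<phi> (\<lambda>i\<in>{..<s}. \<Oplus>\<^bsub>N\<^esub>j\<in>{..<k}. y i j) =
    (\<Oplus>\<^bsub>P\<^esub>f\<in>{..<s} \<rightarrow>\<^sub>E {..<k}. \<phi> (\<lambda>i\<in>{..<s}. y i (f i)))"
proof -
  interpret P: module R P by fact
  interpret N: module R N by fact
  have sum: "(\<Oplus>\<^bsub>N\<^esub>j\<in>{..<k}. y i j) \<in> carrier N" if "i < s" for i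
    using y[OF that] by (intro N.M.finsum_closed) auto
  have mem: "(\<lambda>i\<in>{..<s}. if i < m then y i (f i) else z i) \<in> tuples s N"
    if "m \<le> s" "f \<in> {..<m} \<rightarrow>\<^sub>E {..<k}" "\<And>i. i < s \<Longrightarrow> z i \<in> carrier N" for m f z
    using that y by (auto simp: PiE_iff)
  have "\<phi> (\<lambda>i\<in>{..<s}. if i < m then \<Oplus>\<^bsub>N\<^esub>j\<in>{..<k}. y i j else z i) =
      (\<Oplus>\<^bsub>P\<^esub>f\<in>{..<m} \<rightarrow>\<^sub>E {..<k}. \<phi> (\<lambda>i\<in>{..<s}. if i < m then y i (f i) else z i))"
    if "m \<le> s" "\<And>i. i < s \<Longrightarrow> z i \<in> carrier N" for m z
    using that
  proof (induction m arbitrary: z)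
    case 0
    have "(\<lambda>i\<in>{..<s}. z i) \<in> tuples s N" using 0 by auto
    from multilinear_closed[OF \<phi> this] show ?case
      unfolding lessThan_0 PiE_empty_domain
      by (subst P.M.finsum_insert) auto
  next
    case (Suc m)
    let ?F = "{..<m} \<rightarrow>\<^sub>E {..<k}"
    let ?w = "\<lambda>f. \<lambda>i\<in>{..<s}. if i < m then y i (f i) else z i"
    \<comment> \<open>Slot \<open>m\<close> still holds its sum and counts as filler for the
      induction hypothesis.\<close>
    define z' where "z' = z(m := \<Oplus>\<^bsub>N\<^esub>j\<in>{..<k}. y m j)"
    have m: "m < s" using Suc.prems by simp
    have z': "z' i \<in> carrier N" if "i < s" for i using that Suc.prems sum by (simp add: z'_def)
    have w: "?w f \<in> tuples s N" if "f \<in> ?F" for f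
      using mem[of m f z] that Suc.prems by simp
    have upd: "?w f \<in> tuples s N \<Longrightarrow> u \<in> carrier N \<Longrightarrow> (?w f)(m := u) \<in> tuples s N" for f u
      using tuples_upd[of "?w f" s N m u] m by simp
    have eq: "(?w f)(m := y m j) =
        (\<lambda>i\<in>{..<s}. if i < Suc m then y i ((f(m := j)) i) else z i)" for f j
      using m by (auto simp: fun_eq_iff less_Suc_eq)
    have cl: "\<phi> (\<lambda>i\<in>{..<s}. if i < Suc m then y i ((f(m := j)) i) else z i) \<in> carrier P"
      if "f \<in> ?F" "j < k" for f j
      unfolding eq[symmetric] using multilinear_closed[OF \<phi> upd[OF w[OF that(1)]]] y[OF m that(2)] by auto
    have inj: "inj_on (\<lambda>j. f(m := j)) A" for f :: "nat \<Rightarrow> nat" and A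
      by (rule inj_onI) (metis fun_upd_same)
    have "(\<lambda>i\<in>{..<s}. if i < Suc m then \<Oplus>\<^bsub>N\<^esub>j\<in>{..<k}. y i j else z i) =
        (\<lambda>i\<in>{..<s}. if i < m then \<Oplus>\<^bsub>N\<^esub>j\<in>{..<k}. y i j else z' i)"
      by (auto simp: fun_eq_iff z'_def less_Suc_eq)
    then have "\<phi> (\<lambda>i\<in>{..<s}. if i < Suc m then \<Oplus>\<^bsub>N\<^esub>j\<in>{..<k}. y i j else z i) =
        (\<Oplus>\<^bsub>P\<^esub>f\<in>?F. \<phi> (\<lambda>i\<in>{..<s}. if i < m then y i (f i) else z' i))"
      by (simp only: Suc.IH[OF Suc_leD[OF Suc.prems(1)] z'])
    also have "\<dots> = (\<Oplus>\<^bsub>P\<^esub>f\<in>?F. \<Oplus>\<^bsub>P\<^esub>g\<in>(\<lambda>j. f(m := j)) ` {..<k}.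
        \<phi> (\<lambda>i\<in>{..<s}. if i < Suc m then y i (g i) else z i))"
    proof (rule P.M.finsum_cong')
      fix f assume f: "f \<in> ?F"
      have "(\<lambda>i\<in>{..<s}. if i < m then y i (f i) else z' i) = (?w f)(m := \<Oplus>\<^bsub>N\<^esub>j\<in>{..<k}. y m j)"
        using m by (auto simp: fun_eq_iff z'_def)
      then have "\<phi> (\<lambda>i\<in>{..<s}. if i < m then y i (f i) else z' i) =
          (\<Oplus>\<^bsub>P\<^esub>j\<in>{..<k}. \<phi> ((?w f)(m := y m j)))"
        using linear_map_finsum[OF N P multilinear_slot[OF \<phi> w[OF f] m], of "{..<k}" "y m"] y m by simp
      also have "\<dots> = (\<Oplus>\<^bsub>P\<^esub>g\<in>(\<lambda>j. f(m := j)) ` {..<k}.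
          \<phi> (\<lambda>i\<in>{..<s}. if i < Suc m then y i (g i) else z i))"
        unfolding eq
        by (rule P.M.finsum_reindex[symmetric])
          (use cl[OF f] inj in \<open>auto simp del: fun_upd_apply\<close>)
      finally show "\<phi> (\<lambda>i\<in>{..<s}. if i < m then y i (f i) else z' i) =
          (\<Oplus>\<^bsub>P\<^esub>g\<in>(\<lambda>j. f(m := j)) ` {..<k}.
            \<phi> (\<lambda>i\<in>{..<s}. if i < Suc m then y i (g i) else z i))" .
    qed (use cl in \<open>auto intro!: P.M.finsum_closed simp del: fun_upd_apply\<close>)
    \<comment> \<open>Functions on \<open>m + 1\<close> slots are grouped by their restriction to
      the first \<open>m\<close>; different restrictions give disjoint groups.\<close>
    also have "\<dots> = (\<Oplus>\<^bsub>P\<^esub>g\<in>(\<Union>f\<in>?F. (\<lambda>j. f(m := j)) ` {..<k}).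
        \<phi> (\<lambda>i\<in>{..<s}. if i < Suc m then y i (g i) else z i))"
    proof (rule P.M.add.finprod_UN_disjoint[symmetric])
      show "pairwise (\<lambda>f g. disjnt ((\<lambda>j. f(m := j)) ` {..<k}) ((\<lambda>j. g(m := j)) ` {..<k})) ?F"
      proof (intro pairwiseI)
        fix f g assume fg: "f \<in> ?F" "g \<in> ?F" "f \<noteq> g"
        then obtain i where i: "i < m" "f i \<noteq> g i" using PiE_ext[of f "{..<m}" _ g] by blast
        have "f(m := a) \<noteq> g(m := b)" for a b
        proof
          assume "f(m := a) = g(m := b)"
          then have "(f(m := a)) i = (g(m := b)) i" by simp
          with i show False by simp
        qed
        then show "disjnt ((\<lambda>j. f(m := j)) ` {..<k}) ((\<lambda>j. g(m := j)) ` {..<k})"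
          by (auto simp: disjnt_def)
      qed
    qed (use cl in \<open>auto simp: finite_PiE simp del: fun_upd_apply\<close>)
    also have "(\<Union>f\<in>?F. (\<lambda>j. f(m := j)) ` {..<k}) = {..<Suc m} \<rightarrow>\<^sub>E {..<k}"
      unfolding lessThan_Suc PiE_insert_eq by auto
    finally show ?case .
  qed
  from this[of s "\<lambda>_. \<zero>\<^bsub>N\<^esub>"] have
    "\<phi> (\<lambda>i\<in>{..<s}. if i < s then \<Oplus>\<^bsub>N\<^esub>j\<in>{..<k}. y i j else \<zero>\<^bsub>N\<^esub>) =
      (\<Oplus>\<^bsub>P\<^esub>f\<in>{..<s} \<rightarrow>\<^sub>E {..<k}. \<phi> (\<lambda>i\<in>{..<s}. if i < s then y i (f i) else \<zero>\<^bsub>N\<^esub>))"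
    by simp
  moreover have "(\<lambda>i\<in>{..<s}. if i < s then g i else \<zero>\<^bsub>N\<^esub>) = (\<lambda>i\<in>{..<s}. g i)" for g
    by auto
  ultimately show ?thesis by simp
qed

section \<open>The universal property of the tensor power\<close>

lemma tensor_relations_subset:
  assumes "module R M"
  shows "tensor_relations R s M \<subseteq> carrier (free_module R (tuples s M))"
proof -
  interpret M: module R M by fact
  interpret L: module R "free_module R (tuples s M)" by (rule module_free_module[OF M.R.is_cring])
  have e: "basis_vector R (tuples s M) x \<in> carrier (free_module R (tuples s M))" for x
    by (rule basis_vector_closed[OF M.R.is_cring])
  show ?thesis unfolding tensor_relations_def Let_def using e by (auto intro!: L.M.minus_closed)
qed

lemma submodule_tensor_kernel:
  assumes "module R M"
  shows "submodule (tensor_kernel R s M) R (free_module R (tuples s M))"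
proof -
  interpret M: module R M by fact
  show ?thesis unfolding tensor_kernel_def
    by (rule submodule_span_module[OF module_free_module[OF M.R.is_cring] tensor_relations_subset[OF assms]])
qed

lemma module_tensor_power:
  assumes "module R M"
  shows "module R (tensor_power R s M)"
proof -
  interpret M: module R M by fact
  show ?thesis unfolding tensor_power_def
    by (rule module_quotient_module[OF module_free_module[OF M.R.is_cring] submodule_tensor_kernel[OF assms]])
qed

lemma multilinear_pure_tensor:
  assumes "module R M"
  shows "multilinear R s M (tensor_power R s M) (pure_tensor R s M)"
proof -
  interpret M: module R M by fact
  let ?L = "free_module R (tuples s M)" and ?T = "tensor_power R s M"
  let ?\<pi> = "\<lambda>v. tensor_kernel R s M +>\<^bsub>?L\<^esub> v"
  let ?e = "basis_vector R (tuples s M)"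
  note K = submodule_tensor_kernel[OF assms, of s]
  have mL: "module R ?L" by (rule module_free_module[OF M.R.is_cring])
  interpret L: module R ?L by (rule mL)
  have mT: "module R ?T" by (rule module_tensor_power[OF assms])
  interpret T: module R ?T by (rule mT)
  have lin: "linear_map R ?L ?T ?\<pi>"
    unfolding tensor_power_def by (rule linear_map_coset[OF mL K])
  interpret H: abelian_subgroup "tensor_kernel R s M" ?L
    by (rule submodule_imp_abelian_subgroup[OF mL K])
  have ker: "?\<pi> v = \<zero>\<^bsub>?T\<^esub>" if "v \<in> tensor_relations R s M" for v
    using that span_module_superset[of "tensor_relations R s M" R ?L] H.a_rcos_const[of v]
    by (auto simp: tensor_kernel_def tensor_power_def quotient_module_def)
  \<comment> \<open>Both kinds of relations are differences, so their vanishing in the quotient is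
    an equality of cosets.\<close>
  have eqI: "?\<pi> v = ?\<pi> w" if "v \<in> carrier ?L" "w \<in> carrier ?L" "v \<ominus>\<^bsub>?L\<^esub> w \<in> tensor_relations R s M" for v w
    using ker[OF that(3)] linear_map_minus[OF mL mT lin that(1,2)] linear_map_closed[OF lin] that(1,2)
    by (metis T.M.minus_equality T.M.minus_minus T.M.a_inv_closed a_minus_def)
  have e: "?e x \<in> carrier ?L" for x by (rule basis_vector_closed[OF M.R.is_cring])
  show ?thesis
    unfolding multilinear_def pure_tensor_def
  proof (intro conjI ballI allI impI)
    fix x i assume x: "x \<in> tuples s M" and i: "i < s"
    show "linear_map R M ?T (\<lambda>u. ?\<pi> (?e (x(i := u))))"
    proof (rule linear_mapI)
      fix u v assume uv: "u \<in> carrier M" "v \<in> carrier M"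
      have "?\<pi> (?e (x(i := u \<oplus>\<^bsub>M\<^esub> v))) = ?\<pi> (?e (x(i := u)) \<oplus>\<^bsub>?L\<^esub> ?e (x(i := v)))"
        by (rule eqI) (use x i uv e in \<open>auto simp: tensor_relations_def Let_def\<close>)
      then show "?\<pi> (?e (x(i := u \<oplus>\<^bsub>M\<^esub> v))) = ?\<pi> (?e (x(i := u))) \<oplus>\<^bsub>?T\<^esub> ?\<pi> (?e (x(i := v)))"
        using linear_map_add[OF lin e e] by simp
    next
      fix a u assume a: "a \<in> carrier R" and u: "u \<in> carrier M"
      have "?\<pi> (?e (x(i := a \<odot>\<^bsub>M\<^esub> u))) = ?\<pi> (a \<odot>\<^bsub>?L\<^esub> ?e (x(i := u)))"
        by (rule eqI) (use x i a u e in \<open>auto simp: tensor_relations_def Let_def\<close>)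
      then show "?\<pi> (?e (x(i := a \<odot>\<^bsub>M\<^esub> u))) = a \<odot>\<^bsub>?T\<^esub> ?\<pi> (?e (x(i := u)))"
        using linear_map_smult[OF lin a e] by simp
    qed (rule linear_map_closed[OF lin e])
  qed (rule linear_map_closed[OF lin e])
qed

lemma pure_tensor_closed:
  "module R M \<Longrightarrow> x \<in> tuples s M \<Longrightarrow> pure_tensor R s M x \<in> carrier (tensor_power R s M)"
  by (rule multilinear_closed[OF multilinear_pure_tensor])

text \<open>Pure tensors are the classes of basis vectors, so the comparison can be made on the free
  module above the tensor power.\<close>

lemma tensor_power_eqI:
  assumes M: "module R M" and N: "module R N"
    and f: "linear_map R (tensor_power R s M) N f" and g: "linear_map R (tensor_power R s M) N g"
    and eq: "\<And>x. x \<in> tuples s M \<Longrightarrow> f (pure_tensor R s M x) = g (pure_tensor R s M x)"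
    and t: "t \<in> carrier (tensor_power R s M)"
  shows "f t = g t"
proof -
  interpret M: module R M by fact
  let ?L = "free_module R (tuples s M)"
  let ?\<pi> = "\<lambda>v. tensor_kernel R s M +>\<^bsub>?L\<^esub> v"
  have mL: "module R ?L" by (rule module_free_module[OF M.R.is_cring])
  have lin: "linear_map R ?L (tensor_power R s M) ?\<pi>"
    unfolding tensor_power_def by (rule linear_map_coset[OF mL submodule_tensor_kernel[OF M]])
  obtain v where v: "v \<in> carrier ?L" "t = ?\<pi> v"
    using t unfolding tensor_power_def quotient_module_carrier by auto
  have "f (?\<pi> v) = g (?\<pi> v)"
    by (rule linear_map_free_eqI[OF M.R.is_cring N linear_map_comp[OF lin f] linear_map_comp[OF lin g] _ v(1)])
      (use eq in \<open>auto simp: pure_tensor_def\<close>)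
  then show ?thesis using v by simp
qed

lemma hom_tensor_power_eqI:
  assumes M: "module R M" and N: "module R N"
    and f: "f \<in> carrier (hom_module R (tensor_power R s M) N)"
    and g: "g \<in> carrier (hom_module R (tensor_power R s M) N)"
    and eq: "\<And>x. x \<in> tuples s M \<Longrightarrow> f (pure_tensor R s M x) = g (pure_tensor R s M x)"
  shows "f = g"
proof (rule hom_module_eqI[OF f g])
  fix t assume t: "t \<in> carrier (tensor_power R s M)"
  show "f t = g t"
    by (rule tensor_power_eqI[OF M N _ _ _ t]) (use f g eq in \<open>auto simp: hom_module_carrier_iff\<close>)
qed

text \<open>Multilinearity says that the linear extension to the free module kills the relations.
  Its kernel is a submodule, hence contains their span, and the extension descends to the
  quotient.\<close>

lemma tensor_lift_exists:
  assumes M: "module R M" and N: "module R N" and \<phi>: "multilinear R s M N \<phi>"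
  shows "\<exists>h \<in> carrier (hom_module R (tensor_power R s M) N). \<forall>x\<in>tuples s M. h (pure_tensor R s M x) = \<phi> x"
proof -
  interpret M: module R M by fact
  interpret N: module R N by fact
  let ?L = "free_module R (tuples s M)"
  let ?e = "basis_vector R (tuples s M)"
  let ?g = "free_lift R (tuples s M) N \<phi>"
  have mL: "module R ?L" by (rule module_free_module[OF M.R.is_cring])
  interpret L: module R ?L by (rule mL)
  have \<phi>': "\<phi> \<in> tuples s M \<rightarrow> carrier N" using multilinear_closed[OF \<phi>] by auto
  have g: "linear_map R ?L N ?g" by (rule linear_map_free_lift[OF N \<phi>'])
  have e: "?e x \<in> carrier ?L" for x by (rule basis_vector_closed[OF M.R.is_cring])
  have ge: "?g (?e x) = \<phi> x" if "x \<in> tuples s M" for x by (rule free_lift_basis_vector[OF N \<phi>' that])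
  note c = multilinear_closed[OF \<phi> tuples_upd]
  have self: "u \<ominus>\<^bsub>N\<^esub> u = \<zero>\<^bsub>N\<^esub>" if "u \<in> carrier N" for u
    using that by (simp add: a_minus_def N.M.r_neg)
  have "?g v = \<zero>\<^bsub>N\<^esub>" if "v \<in> tensor_relations R s M" for v
    using that unfolding tensor_relations_def Let_def
  proof (elim UnE CollectE exE conjE)
    fix x i u w assume v: "v = ?e (x(i := u \<oplus>\<^bsub>M\<^esub> w)) \<ominus>\<^bsub>?L\<^esub> (?e (x(i := u)) \<oplus>\<^bsub>?L\<^esub> ?e (x(i := w)))"
      and *: "x \<in> tuples s M" "i < s" "u \<in> carrier M" "w \<in> carrier M"
    have "\<phi> (x(i := u \<oplus>\<^bsub>M\<^esub> w)) = \<phi> (x(i := u)) \<oplus>\<^bsub>N\<^esub> \<phi> (x(i := w))"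
      using linear_map_add[OF multilinear_slot[OF \<phi> *(1,2)] *(3,4)] .
    then show ?thesis unfolding v using * e c[OF *(1,2)]
      by (simp add: linear_map_minus[OF mL N g] linear_map_add[OF g] ge tuples_upd self)
  next
    fix x i a u assume v: "v = ?e (x(i := a \<odot>\<^bsub>M\<^esub> u)) \<ominus>\<^bsub>?L\<^esub> a \<odot>\<^bsub>?L\<^esub> ?e (x(i := u))"
      and *: "x \<in> tuples s M" "i < s" "a \<in> carrier R" "u \<in> carrier M"
    have "\<phi> (x(i := a \<odot>\<^bsub>M\<^esub> u)) = a \<odot>\<^bsub>N\<^esub> \<phi> (x(i := u))"
      using linear_map_smult[OF multilinear_slot[OF \<phi> *(1,2)] *(3,4)] .
    then show ?thesis unfolding v using * e c[OF *(1,2)]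
      by (simp add: linear_map_minus[OF mL N g] linear_map_smult[OF g] ge tuples_upd self)
  qed
  then have "tensor_relations R s M \<subseteq> {v \<in> carrier ?L. ?g v = \<zero>\<^bsub>N\<^esub>}"
    using tensor_relations_subset[OF M] by auto
  then have "tensor_kernel R s M \<subseteq> {v \<in> carrier ?L. ?g v = \<zero>\<^bsub>N\<^esub>}"
    unfolding tensor_kernel_def by (rule span_module_minimal[OF submodule_kernel[OF mL N g]])
  then obtain h where "h \<in> carrier (hom_module R (tensor_power R s M) N)"
      "\<forall>v\<in>carrier ?L. h (tensor_kernel R s M +>\<^bsub>?L\<^esub> v) = ?g v"
    using quotient_lift_exists[OF mL submodule_tensor_kernel[OF M] N g]
    unfolding tensor_power_def by blast
  then show ?thesis using ge e unfolding pure_tensor_def by metis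
qed

lemma
  assumes M: "module R M" and N: "module R N" and \<phi>: "multilinear R s M N \<phi>"
  shows tensor_lift_mem: "tensor_lift R s M N \<phi> \<in> carrier (hom_module R (tensor_power R s M) N)"
    and tensor_lift_pure: "x \<in> tuples s M \<Longrightarrow> tensor_lift R s M N \<phi> (pure_tensor R s M x) = \<phi> x"
proof -
  have "\<exists>!h. h \<in> carrier (hom_module R (tensor_power R s M) N) \<and>
      (\<forall>x\<in>tuples s M. h (pure_tensor R s M x) = \<phi> x)"
    using tensor_lift_exists[OF assms] hom_tensor_power_eqI[OF M N] by (metis (no_types, lifting))
  from theI'[OF this] show "tensor_lift R s M N \<phi> \<in> carrier (hom_module R (tensor_power R s M) N)"
    "x \<in> tuples s M \<Longrightarrow> tensor_lift R s M N \<phi> (pure_tensor R s M x) = \<phi> x"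
    unfolding tensor_lift_def by auto
qed

section \<open>Equivariant maps between tensor powers\<close>

text \<open>The sum over \<open>f \<in> S\<close> of the maps \<open>\<phi> (f 0) \<otimes> \<dots> \<otimes> \<phi> (f (s - 1))\<close>.\<close>

definition tensor_sum ::
    "('a, 'q) ring_scheme \<Rightarrow> nat \<Rightarrow> ('a, 'b, 'm) module_scheme \<Rightarrow> ('a, 'c, 'n) module_scheme \<Rightarrow>
     (nat \<Rightarrow> nat) set \<Rightarrow> (nat \<Rightarrow> 'b \<Rightarrow> 'c) \<Rightarrow> ((nat \<Rightarrow> 'b) \<Rightarrow> 'a) set \<Rightarrow> ((nat \<Rightarrow> 'c) \<Rightarrow> 'a) set" where
  "tensor_sum R s M N S \<phi> =
     tensor_lift R s M (tensor_power R s N)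
       (\<lambda>x. \<Oplus>\<^bsub>tensor_power R s N\<^esub>f\<in>S. pure_tensor R s N (\<lambda>i\<in>{..<s}. \<phi> (f i) (x i)))"

text \<open>Closure under permutations makes \<open>tensor_sum\<close> over \<open>S\<close>
  equivariant; extensionality makes the reindexing of \<open>S\<close> by a permutation
  invertible.\<close>

definition permutation_invariant :: "nat \<Rightarrow> (nat \<Rightarrow> 'b) set \<Rightarrow> bool" where
  "permutation_invariant s S \<longleftrightarrow>
     S \<subseteq> extensional {..<s} \<and>
     (\<forall>\<sigma>. \<sigma> permutes {..<s} \<longrightarrow> (\<forall>f\<in>S. (\<lambda>i\<in>{..<s}. f (\<sigma> i)) \<in> S))"

lemma bij_betw_permutation_invariant:
  assumes "permutation_invariant s S" and \<sigma>: "\<sigma> permutes {..<s}"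
  shows "bij_betw (\<lambda>f. \<lambda>i\<in>{..<s}. f (\<sigma> i)) S S"
proof (rule bij_betw_byWitness[where f' = "\<lambda>f. \<lambda>i\<in>{..<s}. f (inv_into UNIV \<sigma> i)"])
  let ?\<tau> = "inv_into UNIV \<sigma>"
  have \<tau>: "?\<tau> permutes {..<s}" by (rule permutes_inv[OF \<sigma>])
  have lt: "\<sigma> i < s \<longleftrightarrow> i < s" "?\<tau> i < s \<longleftrightarrow> i < s" for i
    using permutes_in_image[OF \<sigma>, of i] permutes_in_image[OF \<tau>, of i] by auto
  have ext: "f i = undefined" if "f \<in> S" "\<not> i < s" for f i
    using that assms(1) by (auto simp: permutation_invariant_def extensional_def)
  show "\<forall>f\<in>S. (\<lambda>i\<in>{..<s}. (\<lambda>i\<in>{..<s}. f (\<sigma> i)) (?\<tau> i)) = f"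
    by (auto simp: fun_eq_iff lt permutes_inverses[OF \<sigma>] ext)
  show "\<forall>f\<in>S. (\<lambda>i\<in>{..<s}. (\<lambda>i\<in>{..<s}. f (?\<tau> i)) (\<sigma> i)) = f"
    by (auto simp: fun_eq_iff lt permutes_inverses[OF \<sigma>] ext)
qed (use assms \<sigma> permutes_inv[OF \<sigma>] in \<open>auto simp: permutation_invariant_def\<close>)

lemma map_tuple_closed:
  "(\<And>i. i < s \<Longrightarrow> linear_map R M N (f i)) \<Longrightarrow> x \<in> tuples s M \<Longrightarrow> (\<lambda>i\<in>{..<s}. f i (x i)) \<in> tuples s N"
  unfolding restrict_PiE_iff by (meson PiE_mem lessThan_iff linear_map_closed)

lemma multilinear_pure_comp:
  assumes "module R N" "\<And>i. i < s \<Longrightarrow> linear_map R M N (f i)"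
  shows "multilinear R s M (tensor_power R s N) (\<lambda>x. pure_tensor R s N (\<lambda>i\<in>{..<s}. f i (x i)))"
  by (rule multilinear_precomp[OF multilinear_pure_tensor[OF assms(1)] assms(2)])

lemma
  assumes M: "module R M" and N: "module R N" and \<phi>: "\<And>j. linear_map R M N (\<phi> j)"
  shows tensor_sum_mem_hom:
      "tensor_sum R s M N S \<phi> \<in> carrier (hom_module R (tensor_power R s M) (tensor_power R s N))"
    and tensor_sum_pure: "x \<in> tuples s M \<Longrightarrow> tensor_sum R s M N S \<phi> (pure_tensor R s M x) =
      (\<Oplus>\<^bsub>tensor_power R s N\<^esub>f\<in>S. pure_tensor R s N (\<lambda>i\<in>{..<s}. \<phi> (f i) (x i)))"
proof -
  have "multilinear R s M (tensor_power R s N)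
      (\<lambda>x. \<Oplus>\<^bsub>tensor_power R s N\<^esub>f\<in>S. pure_tensor R s N (\<lambda>i\<in>{..<s}. \<phi> (f i) (x i)))"
    by (intro multilinear_sum module_tensor_power N multilinear_pure_comp \<phi>)
  from tensor_lift_mem[OF M module_tensor_power[OF N] this]
    tensor_lift_pure[OF M module_tensor_power[OF N] this]
  show "tensor_sum R s M N S \<phi> \<in> carrier (hom_module R (tensor_power R s M) (tensor_power R s N))"
    "x \<in> tuples s M \<Longrightarrow> tensor_sum R s M N S \<phi> (pure_tensor R s M x) =
      (\<Oplus>\<^bsub>tensor_power R s N\<^esub>f\<in>S. pure_tensor R s N (\<lambda>i\<in>{..<s}. \<phi> (f i) (x i)))"
    unfolding tensor_sum_def by auto
qed

lemma tensor_sum_linear: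
  assumes "module R M" "module R N" "\<And>j. linear_map R M N (\<phi> j)"
  shows "linear_map R (tensor_power R s M) (tensor_power R s N) (tensor_sum R s M N S \<phi>)"
  using tensor_sum_mem_hom[OF assms] by (simp add: hom_module_carrier_iff)

lemma
  assumes M: "module R M" and N: "module R N" and f: "linear_map R M N f"
  shows tensor_map_mem_hom:
      "tensor_map R s M N f \<in> carrier (hom_module R (tensor_power R s M) (tensor_power R s N))"
    and tensor_map_pure: "x \<in> tuples s M \<Longrightarrow> tensor_map R s M N f (pure_tensor R s M x) =
      pure_tensor R s N (\<lambda>i\<in>{..<s}. f (x i))"
  unfolding tensor_map_def
  by (rule tensor_lift_mem[OF M module_tensor_power[OF N] multilinear_pure_comp[OF N f]],
      rule tensor_lift_pure[OF M module_tensor_power[OF N] multilinear_pure_comp[OF N f]])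

lemma
  assumes M: "module R M" and \<sigma>: "\<sigma> permutes {..<s}"
  shows tensor_perm_linear: "linear_map R (tensor_power R s M) (tensor_power R s M) (tensor_perm R s M \<sigma>)"
    and tensor_perm_pure: "x \<in> tuples s M \<Longrightarrow> tensor_perm R s M \<sigma> (pure_tensor R s M x) =
      pure_tensor R s M (\<lambda>i\<in>{..<s}. x (inv_into UNIV \<sigma> i))"
proof -
  have "multilinear R s M (tensor_power R s M)
      (\<lambda>x. pure_tensor R s M (\<lambda>i\<in>{..<s}. x (inv_into UNIV \<sigma> i)))"
    by (rule multilinear_permute[OF multilinear_pure_tensor[OF M] permutes_inv[OF \<sigma>]])
  from tensor_lift_mem[OF M module_tensor_power[OF M] this]
    tensor_lift_pure[OF M module_tensor_power[OF M] this]
  show "linear_map R (tensor_power R s M) (tensor_power R s M) (tensor_perm R s M \<sigma>)"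
    "x \<in> tuples s M \<Longrightarrow> tensor_perm R s M \<sigma> (pure_tensor R s M x) =
      pure_tensor R s M (\<lambda>i\<in>{..<s}. x (inv_into UNIV \<sigma> i))"
    unfolding tensor_perm_def by (auto simp: hom_module_carrier_iff)
qed

text \<open>Permuting the factors of the argument or of the value gives the same terms up to
  composing each index function \<open>f\<close> with the permutation, which only reorders the sum
  over \<open>S\<close>.\<close>

lemma tensor_sum_mem_schur_hom:
  assumes M: "module R M" and N: "module R N" and \<phi>: "\<And>j. linear_map R M N (\<phi> j)"
    and S: "permutation_invariant s S"
  shows "tensor_sum R s M N S \<phi> \<in> carrier (schur_hom R s M N)"
proof -
  interpret TN: module R "tensor_power R s N" by (rule module_tensor_power[OF N])
  let ?h = "tensor_sum R s M N S \<phi>"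
  have "?h (tensor_perm R s M \<sigma> t) = tensor_perm R s N \<sigma> (?h t)"
    if \<sigma>: "\<sigma> permutes {..<s}" and t: "t \<in> carrier (tensor_power R s M)" for \<sigma> t
  proof (rule tensor_power_eqI[OF M module_tensor_power[OF N] _ _ _ t])
    let ?\<tau> = "inv_into UNIV \<sigma>"
    have lt: "?\<tau> i < s \<longleftrightarrow> i < s" for i using permutes_in_image[OF permutes_inv[OF \<sigma>], of i] by simp
    have im: "(\<lambda>f. \<lambda>i\<in>{..<s}. f (?\<tau> i)) ` S = S" and inj: "inj_on (\<lambda>f. \<lambda>i\<in>{..<s}. f (?\<tau> i)) S"
      using bij_betw_permutation_invariant[OF S permutes_inv[OF \<sigma>]] unfolding bij_betw_def by simp_all
    show "linear_map R (tensor_power R s M) (tensor_power R s N) (\<lambda>t. ?h (tensor_perm R s M \<sigma> t))"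
      by (rule linear_map_comp[OF tensor_perm_linear[OF M \<sigma>] tensor_sum_linear[OF M N \<phi>]])
    show "linear_map R (tensor_power R s M) (tensor_power R s N) (\<lambda>t. tensor_perm R s N \<sigma> (?h t))"
      by (rule linear_map_comp[OF tensor_sum_linear[OF M N \<phi>] tensor_perm_linear[OF N \<sigma>]])
    fix x assume x: "x \<in> tuples s M"
    have x\<tau>: "(\<lambda>i\<in>{..<s}. x (?\<tau> i)) \<in> tuples s M" using x lt by (auto simp: PiE_iff)
    have cl: "pure_tensor R s N (\<lambda>i\<in>{..<s}. \<phi> (f i) (y i)) \<in> carrier (tensor_power R s N)"
      if "y \<in> tuples s M" for f y
      by (rule pure_tensor_closed[OF N map_tuple_closed[OF \<phi> that]])
    have "?h (tensor_perm R s M \<sigma> (pure_tensor R s M x)) =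
        (\<Oplus>\<^bsub>tensor_power R s N\<^esub>f\<in>S. pure_tensor R s N (\<lambda>i\<in>{..<s}. \<phi> (f i) ((\<lambda>i\<in>{..<s}. x (?\<tau> i)) i)))"
      by (simp only: tensor_perm_pure[OF M \<sigma> x] tensor_sum_pure[OF M N \<phi> x\<tau>])
    also have "\<dots> = (\<Oplus>\<^bsub>tensor_power R s N\<^esub>f\<in>(\<lambda>f. \<lambda>i\<in>{..<s}. f (?\<tau> i)) ` S.
        pure_tensor R s N (\<lambda>i\<in>{..<s}. \<phi> (f i) ((\<lambda>i\<in>{..<s}. x (?\<tau> i)) i)))"
      by (simp only: im)
    also have "\<dots> = (\<Oplus>\<^bsub>tensor_power R s N\<^esub>f\<in>S.
        pure_tensor R s N (\<lambda>i\<in>{..<s}. \<phi> ((\<lambda>i\<in>{..<s}. f (?\<tau> i)) i) ((\<lambda>i\<in>{..<s}. x (?\<tau> i)) i)))"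
      by (rule TN.M.finsum_reindex[OF funcsetI[OF cl[OF x\<tau>]] inj])
    also have "\<dots> = (\<Oplus>\<^bsub>tensor_power R s N\<^esub>f\<in>S.
        tensor_perm R s N \<sigma> (pure_tensor R s N (\<lambda>i\<in>{..<s}. \<phi> (f i) (x i))))"
    proof (rule TN.M.finsum_cong')
      fix f
      show "pure_tensor R s N (\<lambda>i\<in>{..<s}. \<phi> ((\<lambda>i\<in>{..<s}. f (?\<tau> i)) i) ((\<lambda>i\<in>{..<s}. x (?\<tau> i)) i)) =
          tensor_perm R s N \<sigma> (pure_tensor R s N (\<lambda>i\<in>{..<s}. \<phi> (f i) (x i)))"
        unfolding tensor_perm_pure[OF N \<sigma> map_tuple_closed[OF \<phi> x]]
        by (rule arg_cong[of _ _ "pure_tensor R s N"]) (auto simp: fun_eq_iff lt)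
    qed (auto intro: linear_map_closed[OF tensor_perm_linear[OF N \<sigma>] cl[OF x]])
    also have "\<dots> = tensor_perm R s N \<sigma> (?h (pure_tensor R s M x))"
      unfolding tensor_sum_pure[OF M N \<phi> x]
      by (rule linear_map_finsum[OF TN.module_axioms TN.module_axioms tensor_perm_linear[OF N \<sigma>] cl[OF x], symmetric])
    finally show "?h (tensor_perm R s M \<sigma> (pure_tensor R s M x)) =
        tensor_perm R s N \<sigma> (?h (pure_tensor R s M x))" .
  qed
  then show ?thesis using tensor_sum_mem_hom[OF M N \<phi>] by (simp add: schur_hom_def)
qed

lemma finsum_single:
  assumes "module R N" "h a \<in> carrier N"
  shows "(\<Oplus>\<^bsub>N\<^esub>f\<in>{a}. h f) = h a"
proof -
  interpret N: module R N by fact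
  show ?thesis using assms(2) by (subst N.M.finsum_insert) auto
qed

text \<open>Tensor powers of a single map become the one-term case, so facts about
  \<open>tensor_sum\<close> also cover the underlying ordinary functor.\<close>

lemma tensor_map_eq_tensor_sum:
  assumes M: "module R M" and N: "module R N" and f: "linear_map R M N f"
  shows "tensor_map R s M N f = tensor_sum R s M N {\<lambda>i\<in>{..<s}. 0} (\<lambda>_. f)"
proof (rule hom_tensor_power_eqI[OF M module_tensor_power[OF N] tensor_map_mem_hom[OF M N f]])
  show "tensor_sum R s M N {\<lambda>i\<in>{..<s}. 0} (\<lambda>_. f) \<in>
      carrier (hom_module R (tensor_power R s M) (tensor_power R s N))"
    by (rule tensor_sum_mem_hom[OF M N f])
  fix x assume x: "x \<in> tuples s M"
  show "tensor_map R s M N f (pure_tensor R s M x) =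
      tensor_sum R s M N {\<lambda>i\<in>{..<s}. 0} (\<lambda>_. f) (pure_tensor R s M x)"
    unfolding tensor_map_pure[OF M N f x] tensor_sum_pure[OF M N f x]
    by (subst finsum_single[OF module_tensor_power[OF N]])
      (rule pure_tensor_closed[OF N map_tuple_closed[OF f x]] refl)+
qed

lemma permutation_invariant_const: "permutation_invariant s {\<lambda>i\<in>{..<s}. c}"
proof -
  have "(\<lambda>i\<in>{..<s}. (\<lambda>i\<in>{..<s}. c) (\<sigma> i)) = (\<lambda>i\<in>{..<s}. c)" if "\<sigma> permutes {..<s}" for \<sigma>
    by (rule restrict_ext) (use permutes_in_image[OF that] in auto)
  then show ?thesis by (simp add: permutation_invariant_def)
qed

lemma tensor_map_mem_schur_hom:
  assumes "module R M" "module R N" "linear_map R M N f"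
  shows "tensor_map R s M N f \<in> carrier (schur_hom R s M N)"
  unfolding tensor_map_eq_tensor_sum[OF assms]
  by (rule tensor_sum_mem_schur_hom[OF assms permutation_invariant_const])

lemma compose_mem_hom_module:
  assumes "module R L" "f \<in> carrier (hom_module R L M)" "g \<in> carrier (hom_module R M N)"
  shows "compose (carrier L) g f \<in> carrier (hom_module R L N)"
proof -
  have "restrict (\<lambda>x. g (f x)) (carrier L) \<in> carrier (hom_module R L N)"
    by (rule restrict_mem_hom_module[OF assms(1) linear_map_comp[of R L M f N g]])
      (use assms in \<open>auto simp: hom_module_carrier_iff\<close>)
  then show ?thesis by (simp add: compose_def)
qed

text \<open>Applying \<open>g\<close> in every factor changes the maps but not the index set.
  Projections and codiagonals can thus be absorbed without disturbing the weight.\<close>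

lemma tensor_map_compose_tensor_sum:
  assumes L: "module R L" and M: "module R M" and N: "module R N"
    and \<phi>: "\<And>j. linear_map R L M (\<phi> j)" and g: "linear_map R M N g"
  shows "compose (carrier (tensor_power R s L)) (tensor_map R s M N g) (tensor_sum R s L M S \<phi>) =
    tensor_sum R s L N S (\<lambda>j x. g (\<phi> j x))"
proof -
  note TM = module_tensor_power[OF M] and TN = module_tensor_power[OF N]
  have g\<phi>: "linear_map R L N (\<lambda>x. g (\<phi> j x))" for j by (rule linear_map_comp[OF \<phi> g])
  have glin: "linear_map R (tensor_power R s M) (tensor_power R s N) (tensor_map R s M N g)"
    using tensor_map_mem_hom[OF M N g] by (simp add: hom_module_carrier_iff)
  show ?thesis
  proof (rule hom_tensor_power_eqI[OF L module_tensor_power[OF N]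
        compose_mem_hom_module[OF module_tensor_power[OF L] tensor_sum_mem_hom[OF L M \<phi>] tensor_map_mem_hom[OF M N g]]
        tensor_sum_mem_hom[OF L N g\<phi>]])
    fix x assume x: "x \<in> tuples s L"
    have cl: "pure_tensor R s M (\<lambda>i\<in>{..<s}. \<phi> (f i) (x i)) \<in> carrier (tensor_power R s M)" for f
      by (rule pure_tensor_closed[OF M map_tuple_closed[OF \<phi> x]])
    interpret TN: module R "tensor_power R s N" by (rule TN)
    have "compose (carrier (tensor_power R s L)) (tensor_map R s M N g) (tensor_sum R s L M S \<phi>) (pure_tensor R s L x)
        = (\<Oplus>\<^bsub>tensor_power R s N\<^esub>f\<in>S. tensor_map R s M N g (pure_tensor R s M (\<lambda>i\<in>{..<s}. \<phi> (f i) (x i))))"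
      unfolding compose_eq[OF pure_tensor_closed[OF L x]] tensor_sum_pure[OF L M \<phi> x]
      by (rule linear_map_finsum[OF TM TN glin cl])
    also have "\<dots> = (\<Oplus>\<^bsub>tensor_power R s N\<^esub>f\<in>S. pure_tensor R s N (\<lambda>i\<in>{..<s}. g (\<phi> (f i) (x i))))"
    proof (rule TN.M.finsum_cong')
      fix f
      have "(\<lambda>i\<in>{..<s}. g ((\<lambda>i\<in>{..<s}. \<phi> (f i) (x i)) i)) = (\<lambda>i\<in>{..<s}. g (\<phi> (f i) (x i)))" by auto
      then show "tensor_map R s M N g (pure_tensor R s M (\<lambda>i\<in>{..<s}. \<phi> (f i) (x i))) =
          pure_tensor R s N (\<lambda>i\<in>{..<s}. g (\<phi> (f i) (x i)))"
        by (simp only: tensor_map_pure[OF M N g map_tuple_closed[OF \<phi> x]])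
    qed (use pure_tensor_closed[OF N map_tuple_closed[OF g\<phi> x]] in auto)
    finally show "compose (carrier (tensor_power R s L)) (tensor_map R s M N g) (tensor_sum R s L M S \<phi>) (pure_tensor R s L x)
        = tensor_sum R s L N S (\<lambda>j x. g (\<phi> j x)) (pure_tensor R s L x)"
      by (simp only: tensor_sum_pure[OF L N g\<phi> x])
  qed
qed

text \<open>Only the maps whose index is a value of some member of \<open>S\<close> enter, so a
  family may be altered freely at all other indices.\<close>

lemma tensor_sum_cong:
  assumes M: "module R M" and N: "module R N" and \<phi>: "\<And>j. linear_map R M N (\<phi> j)"
    and \<psi>: "\<And>j. linear_map R M N (\<psi> j)"
    and eq: "\<And>f i x. f \<in> S \<Longrightarrow> i < s \<Longrightarrow> x \<in> carrier M \<Longrightarrow> \<phi> (f i) x = \<psi> (f i) x"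
  shows "tensor_sum R s M N S \<phi> = tensor_sum R s M N S \<psi>"
proof (rule hom_tensor_power_eqI[OF M module_tensor_power[OF N] tensor_sum_mem_hom[OF M N \<phi>]
      tensor_sum_mem_hom[OF M N \<psi>]])
  interpret TN: module R "tensor_power R s N" by (rule module_tensor_power[OF N])
  fix x assume x: "x \<in> tuples s M"
  show "tensor_sum R s M N S \<phi> (pure_tensor R s M x) = tensor_sum R s M N S \<psi> (pure_tensor R s M x)"
    unfolding tensor_sum_pure[OF M N \<phi> x] tensor_sum_pure[OF M N \<psi> x]
  proof (rule TN.M.finsum_cong')
    fix f assume f: "f \<in> S"
    have "(\<lambda>i\<in>{..<s}. \<phi> (f i) (x i)) = (\<lambda>i\<in>{..<s}. \<psi> (f i) (x i))"
      by (rule restrict_ext) (use eq[OF f] x in auto)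
    then show "pure_tensor R s N (\<lambda>i\<in>{..<s}. \<phi> (f i) (x i)) = pure_tensor R s N (\<lambda>i\<in>{..<s}. \<psi> (f i) (x i))"
      by simp
  qed (use pure_tensor_closed[OF N map_tuple_closed[OF \<psi> x]] in auto)
qed

lemma tensor_sum_compose_tensor_map:
  assumes L: "module R L" and M: "module R M" and N: "module R N"
    and \<phi>: "\<And>j. linear_map R M N (\<phi> j)" and g: "linear_map R L M g"
  shows "compose (carrier (tensor_power R s L)) (tensor_sum R s M N S \<phi>) (tensor_map R s L M g) =
    tensor_sum R s L N S (\<lambda>j x. \<phi> j (g x))"
proof -
  have \<phi>g: "linear_map R L N (\<lambda>x. \<phi> j (g x))" for j by (rule linear_map_comp[OF g \<phi>])
  show ?thesis
  proof (rule hom_tensor_power_eqI[OF L module_tensor_power[OF N]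
        compose_mem_hom_module[OF module_tensor_power[OF L] tensor_map_mem_hom[OF L M g] tensor_sum_mem_hom[OF M N \<phi>]]
        tensor_sum_mem_hom[OF L N \<phi>g]])
    fix x assume x: "x \<in> tuples s L"
    have eq: "(\<lambda>i\<in>{..<s}. \<phi> (f i) ((\<lambda>i\<in>{..<s}. g (x i)) i)) = (\<lambda>i\<in>{..<s}. \<phi> (f i) (g (x i)))" for f
      by auto
    show "compose (carrier (tensor_power R s L)) (tensor_sum R s M N S \<phi>) (tensor_map R s L M g) (pure_tensor R s L x)
        = tensor_sum R s L N S (\<lambda>j x. \<phi> j (g x)) (pure_tensor R s L x)"
      by (simp only: compose_eq[OF pure_tensor_closed[OF L x]] tensor_map_pure[OF L M g x]
          tensor_sum_pure[OF L N \<phi>g x] tensor_sum_pure[OF M N \<phi> map_tuple_closed[OF g x]] eq)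
  qed
qed

lemma pure_tensor_eq_zero:
  assumes M: "module R M" and x: "x \<in> tuples s M" and i: "i < s" "x i = \<zero>\<^bsub>M\<^esub>"
  shows "pure_tensor R s M x = \<zero>\<^bsub>tensor_power R s M\<^esub>"
  using linear_map_zero[OF M module_tensor_power[OF M] multilinear_slot[OF multilinear_pure_tensor[OF M] x i(1)]]
  by (simp flip: i(2))

text \<open>A single zero factor kills a pure tensor, so one bad position in each term is
  enough.\<close>

lemma tensor_sum_eq_zero:
  assumes M: "module R M" and N: "module R N" and \<phi>: "\<And>j. linear_map R M N (\<phi> j)"
    and zero: "\<And>f. f \<in> S \<Longrightarrow> \<exists>i<s. \<forall>x\<in>carrier M. \<phi> (f i) x = \<zero>\<^bsub>N\<^esub>"
  shows "tensor_sum R s M N S \<phi> = \<zero>\<^bsub>schur_hom R s M N\<^esub>"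
proof -
  interpret TN: module R "tensor_power R s N" by (rule module_tensor_power[OF N])
  interpret H: module R "hom_module R (tensor_power R s M) (tensor_power R s N)"
    by (rule module_hom_module[OF module_tensor_power[OF M] module_tensor_power[OF N]])
  have "tensor_sum R s M N S \<phi> = \<zero>\<^bsub>hom_module R (tensor_power R s M) (tensor_power R s N)\<^esub>"
  proof (rule hom_tensor_power_eqI[OF M module_tensor_power[OF N] tensor_sum_mem_hom[OF M N \<phi>] H.M.zero_closed])
    fix x assume x: "x \<in> tuples s M"
    have "pure_tensor R s N (\<lambda>i\<in>{..<s}. \<phi> (f i) (x i)) = \<zero>\<^bsub>tensor_power R s N\<^esub>" if f: "f \<in> S" for f
    proof -
      obtain i where i: "i < s" "\<forall>x\<in>carrier M. \<phi> (f i) x = \<zero>\<^bsub>N\<^esub>" using zero[OF f] by blast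
      show ?thesis
        by (rule pure_tensor_eq_zero[OF N map_tuple_closed[OF \<phi> x] i(1)]) (use i x in auto)
    qed
    then show "tensor_sum R s M N S \<phi> (pure_tensor R s M x) =
        \<zero>\<^bsub>hom_module R (tensor_power R s M) (tensor_power R s N)\<^esub> (pure_tensor R s M x)"
      unfolding tensor_sum_pure[OF M N \<phi> x]
      using pure_tensor_closed[OF M x] by (simp add: hom_module_def TN.M.add.finprod_one_eqI)
  qed
  then show ?thesis by (simp add: schur_hom_def)
qed

lemma tensor_sum_Un:
  assumes M: "module R M" and N: "module R N" and \<phi>: "\<And>j. linear_map R M N (\<phi> j)"
    and S: "finite S" "finite T" "S \<inter> T = {}"
  shows "tensor_sum R s M N (S \<union> T) \<phi> =
    tensor_sum R s M N S \<phi> \<oplus>\<^bsub>schur_hom R s M N\<^esub> tensor_sum R s M N T \<phi>"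
proof -
  interpret TN: module R "tensor_power R s N" by (rule module_tensor_power[OF N])
  let ?H = "hom_module R (tensor_power R s M) (tensor_power R s N)"
  interpret H: module R ?H
    by (rule module_hom_module[OF module_tensor_power[OF M] module_tensor_power[OF N]])
  note mem = tensor_sum_mem_hom[OF M N \<phi>]
  have "tensor_sum R s M N (S \<union> T) \<phi> = tensor_sum R s M N S \<phi> \<oplus>\<^bsub>?H\<^esub> tensor_sum R s M N T \<phi>"
  proof (rule hom_tensor_power_eqI[OF M module_tensor_power[OF N] mem H.M.add.m_closed[OF mem mem]])
    fix x assume x: "x \<in> tuples s M"
    have "(tensor_sum R s M N S \<phi> \<oplus>\<^bsub>?H\<^esub> tensor_sum R s M N T \<phi>) (pure_tensor R s M x) =
        tensor_sum R s M N S \<phi> (pure_tensor R s M x) \<oplus>\<^bsub>tensor_power R s N\<^esub> tensor_sum R s M N T \<phi> (pure_tensor R s M x)"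
      using pure_tensor_closed[OF M x] by (simp add: hom_module_def)
    then show "tensor_sum R s M N (S \<union> T) \<phi> (pure_tensor R s M x) =
        (tensor_sum R s M N S \<phi> \<oplus>\<^bsub>?H\<^esub> tensor_sum R s M N T \<phi>) (pure_tensor R s M x)"
      unfolding tensor_sum_pure[OF M N \<phi> x]
      by (simp only:, intro TN.M.finsum_Un_disjoint S)
        (use pure_tensor_closed[OF N map_tuple_closed[OF \<phi> x]] in auto)
  qed
  then show ?thesis by (simp add: schur_hom_def)
qed

text \<open>Multinomial expansion of the tensor power of a sum of maps. For projectors that add up
  to the identity it resolves the identity of the tensor power into weight projectors.\<close>

lemma tensor_sum_all:
  assumes M: "module R M" and N: "module R N" and \<phi>: "\<And>j. linear_map R M N (\<phi> j)"
  shows "tensor_sum R s M N ({..<s} \<rightarrow>\<^sub>E {..<k}) \<phi> = tensor_map R s M N (\<lambda>x. \<Oplus>\<^bsub>N\<^esub>j\<in>{..<k}. \<phi> j x)"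
proof -
  have sum: "linear_map R M N (\<lambda>x. \<Oplus>\<^bsub>N\<^esub>j\<in>{..<k}. \<phi> j x)" by (rule linear_map_sum_fun[OF N \<phi>])
  show ?thesis
  proof (rule hom_tensor_power_eqI[OF M module_tensor_power[OF N] tensor_sum_mem_hom[OF M N \<phi>] tensor_map_mem_hom[OF M N sum]])
    fix x assume x: "x \<in> tuples s M"
    have "\<phi> j (x i) \<in> carrier N" if "i < s" for i j using linear_map_closed[OF \<phi>] x that by auto
    then show "tensor_sum R s M N ({..<s} \<rightarrow>\<^sub>E {..<k}) \<phi> (pure_tensor R s M x) =
        tensor_map R s M N (\<lambda>x. \<Oplus>\<^bsub>N\<^esub>j\<in>{..<k}. \<phi> j x) (pure_tensor R s M x)"
      unfolding tensor_sum_pure[OF M N \<phi> x] tensor_map_pure[OF M N sum x]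
      by (rule multilinear_expand[OF module_tensor_power[OF N] N multilinear_pure_tensor[OF N], symmetric])
  qed
qed

text \<open>The map \<open>g\<close> merges indices that carry the same linear map, so terms over
  one fibre coincide and only their number counts. With two indices merged \<open>n\<close> is a
  binomial coefficient; with all indices merged it is a multinomial coefficient.\<close>

lemma tensor_sum_fibres:
  assumes M: "module R M" and N: "module R N" and \<phi>: "\<And>j. linear_map R M N (\<phi> j)"
    and S: "finite S" "finite T"
    and g: "\<And>f'. f' \<in> T \<Longrightarrow> (\<lambda>i\<in>{..<s}. g (f' i)) \<in> S"
    and card: "\<And>f. f \<in> S \<Longrightarrow> card {f' \<in> T. (\<lambda>i\<in>{..<s}. g (f' i)) = f} = n"
  shows "tensor_sum R s M N T (\<lambda>j. \<phi> (g j)) =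
    add_pow (hom_module R (tensor_power R s M) (tensor_power R s N)) n (tensor_sum R s M N S \<phi>)"
proof -
  let ?TN = "tensor_power R s N"
  have mTN: "module R ?TN" by (rule module_tensor_power[OF N])
  interpret TN: module R ?TN by (rule mTN)
  let ?H = "hom_module R (tensor_power R s M) ?TN"
  have H: "module R ?H" by (rule module_hom_module[OF module_tensor_power[OF M] mTN])
  interpret H: module R ?H by (rule H)
  have mem: "tensor_sum R s M N S \<phi> \<in> carrier ?H" by (rule tensor_sum_mem_hom[OF M N \<phi>])
  have mem': "tensor_sum R s M N T (\<lambda>j. \<phi> (g j)) \<in> carrier ?H" by (rule tensor_sum_mem_hom[OF M N \<phi>])
  let ?F = "\<lambda>f. {f' \<in> T. (\<lambda>i\<in>{..<s}. g (f' i)) = f}"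
  show ?thesis
  proof (rule hom_tensor_power_eqI[OF M mTN mem' H.M.add.nat_pow_closed[OF mem]])
    fix x assume x: "x \<in> tuples s M"
    let ?p = "\<lambda>f. pure_tensor R s N (\<lambda>i\<in>{..<s}. \<phi> (f i) (x i))"
    have cl: "?p f \<in> carrier ?TN" for f by (rule pure_tensor_closed[OF N map_tuple_closed[OF \<phi> x]])
    have cl': "pure_tensor R s N (\<lambda>i\<in>{..<s}. \<phi> (g (f i)) (x i)) \<in> carrier ?TN" for f
      by (rule pure_tensor_closed[OF N map_tuple_closed[OF \<phi> x]])
    have ev: "linear_map R ?H ?TN (\<lambda>h. h (pure_tensor R s M x))"
      by (rule linear_mapI)
        (use pure_tensor_closed[OF M x] in \<open>auto simp: hom_module_def linear_map_def\<close>)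
    have "(\<Union>f\<in>S. ?F f) = T" using g by auto
    then have "tensor_sum R s M N T (\<lambda>j. \<phi> (g j)) (pure_tensor R s M x) =
        (\<Oplus>\<^bsub>?TN\<^esub>f'\<in>(\<Union>f\<in>S. ?F f). pure_tensor R s N (\<lambda>i\<in>{..<s}. \<phi> (g (f' i)) (x i)))"
      by (simp only: tensor_sum_pure[OF M N \<phi> x])
    also have "\<dots> = (\<Oplus>\<^bsub>?TN\<^esub>f\<in>S. \<Oplus>\<^bsub>?TN\<^esub>f'\<in>?F f. pure_tensor R s N (\<lambda>i\<in>{..<s}. \<phi> (g (f' i)) (x i)))"
      by (rule TN.M.add.finprod_UN_disjoint)
        (use S cl' in \<open>auto simp: pairwise_def disjnt_def\<close>)
    also have "\<dots> = (\<Oplus>\<^bsub>?TN\<^esub>f\<in>S. add_pow ?TN n (?p f))"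
    proof (rule TN.M.finsum_cong')
      fix f assume f: "f \<in> S"
      have "(\<Oplus>\<^bsub>?TN\<^esub>f'\<in>?F f. pure_tensor R s N (\<lambda>i\<in>{..<s}. \<phi> (g (f' i)) (x i))) = (\<Oplus>\<^bsub>?TN\<^esub>f'\<in>?F f. ?p f)"
      proof (rule TN.M.finsum_cong')
        fix f' assume "f' \<in> ?F f"
        then have "(\<lambda>i\<in>{..<s}. \<phi> (g (f' i)) (x i)) = (\<lambda>i\<in>{..<s}. \<phi> (f i) (x i))" by auto
        then show "pure_tensor R s N (\<lambda>i\<in>{..<s}. \<phi> (g (f' i)) (x i)) = ?p f" by simp
      qed (use cl in auto)
      also have "\<dots> = add_pow ?TN n (?p f)"
        by (simp add: TN.M.add.finprod_const cl card[OF f])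
      finally show "(\<Oplus>\<^bsub>?TN\<^esub>f'\<in>?F f. pure_tensor R s N (\<lambda>i\<in>{..<s}. \<phi> (g (f' i)) (x i))) = add_pow ?TN n (?p f)" .
    qed (use cl in auto)
    also have "\<dots> = add_pow ?TN n (tensor_sum R s M N S \<phi> (pure_tensor R s M x))"
    proof -
      \<comment> \<open>Multiplication by \<open>n\<close> is linear, being an \<open>n\<close>-fold
        sum of identities, so it can be taken out of the sum.\<close>
      have "linear_map R ?TN ?TN (\<lambda>t. \<Oplus>\<^bsub>?TN\<^esub>i\<in>{..<n}. t)"
        by (rule linear_map_sum_fun[OF mTN linear_map_id])
      then have "linear_map R ?TN ?TN (\<lambda>t. add_pow ?TN n t)"
        by (rule linear_map_cong[OF _ mTN]) (simp add: TN.M.add.finprod_const)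
      then show ?thesis unfolding tensor_sum_pure[OF M N \<phi> x]
        by (rule linear_map_finsum[OF mTN mTN _ cl, symmetric])
    qed
    also have "\<dots> = add_pow ?H n (tensor_sum R s M N S \<phi>) (pure_tensor R s M x)"
      by (rule linear_map_add_pow[OF H mTN ev mem, symmetric])
    finally show "tensor_sum R s M N T (\<lambda>j. \<phi> (g j)) (pure_tensor R s M x) =
        add_pow ?H n (tensor_sum R s M N S \<phi>) (pure_tensor R s M x)" .
  qed
qed

section \<open>Direct sums\<close>

lemma evens_interleave [simp]: "evens (interleave f g) = f"
  and odds_interleave [simp]: "odds (interleave f g) = g"
  by (auto simp: evens_def odds_def interleave_def)

lemma interleave_evens_odds [simp]: "interleave (evens h) (odds h) = h"
  by (auto simp: evens_def odds_def interleave_def fun_eq_iff elim!: oddE)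

lemma dsum_simps:
  "h \<in> carrier (dsum X Y) \<longleftrightarrow> evens h \<in> carrier X \<and> odds h \<in> carrier Y"
  "\<zero>\<^bsub>dsum X Y\<^esub> = interleave \<zero>\<^bsub>X\<^esub> \<zero>\<^bsub>Y\<^esub>"
  "h \<oplus>\<^bsub>dsum X Y\<^esub> k = interleave (evens h \<oplus>\<^bsub>X\<^esub> evens k) (odds h \<oplus>\<^bsub>Y\<^esub> odds k)"
  "a \<odot>\<^bsub>dsum X Y\<^esub> h = interleave (a \<odot>\<^bsub>X\<^esub> evens h) (a \<odot>\<^bsub>Y\<^esub> odds h)"
  by (simp_all add: dsum_def)

lemma module_dsum:
  assumes "module R X" "module R Y"
  shows "module R (dsum X Y)"
proof -
  interpret X: module R X by fact
  interpret Y: module R Y by fact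
  show ?thesis
    by (rule moduleI_no_inverse)
      (simp_all add: dsum_simps X.R.is_cring X.M.a_ac Y.M.a_ac
        X.smult_l_distr Y.smult_l_distr X.smult_r_distr Y.smult_r_distr X.smult_assoc1 Y.smult_assoc1)
qed

lemma linear_map_evens: "linear_map R (dsum X Y) X evens"
  and linear_map_odds: "linear_map R (dsum X Y) Y odds"
  by (rule linear_mapI; simp add: dsum_simps)+

lemma linear_map_interleave:
  assumes "linear_map R A X f" "linear_map R A Y g"
  shows "linear_map R A (dsum X Y) (\<lambda>a. interleave (f a) (g a))"
  by (rule linear_mapI) (use assms in \<open>simp_all add: dsum_simps linear_map_def Pi_iff\<close>)

lemma submodule_preimage:
  assumes M: "module R M" and N: "module R N" and f: "linear_map R M N f" and K: "submodule K R N"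
  shows "submodule {x \<in> carrier M. f x \<in> K} R M"
proof -
  interpret M: module R M by fact
  interpret N: module R N by fact
  have zero: "\<zero>\<^bsub>N\<^esub> \<in> K"
    using subgroup.one_closed[OF submodule.axioms(1)[OF K]] by simp
  note E = N.submoduleE[OF K]
  show ?thesis
    by (rule M.submoduleI)
      (use zero E(3-5) in \<open>auto simp: linear_map_zero[OF M N f] linear_map_a_inv[OF M N f]
        linear_map_add[OF f] linear_map_smult[OF f]\<close>)
qed

text \<open>The elements of \<open>X\<close> whose image lies in the span of the joint generators
  form a submodule containing the generators of \<open>X\<close>, hence are all of \<open>X\<close>;
  likewise for \<open>Y\<close>.\<close>

lemma finitely_generated_dsum:
  assumes X: "module R X" and Y: "module R Y"
    and fg: "finitely_generated R X" "finitely_generated R Y"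
  shows "finitely_generated R (dsum X Y)"
proof -
  interpret X: module R X by fact
  interpret Y: module R Y by fact
  have mXY: "module R (dsum X Y)" by (rule module_dsum[OF X Y])
  interpret XY: module R "dsum X Y" by (rule mXY)
  obtain A B where A: "finite A" "A \<subseteq> carrier X" "span_module R X A = carrier X"
    and B: "finite B" "B \<subseteq> carrier Y" "span_module R Y B = carrier Y"
    using fg unfolding finitely_generated_def by blast
  let ?l = "\<lambda>x. interleave x \<zero>\<^bsub>Y\<^esub>" and ?r = "\<lambda>y. interleave \<zero>\<^bsub>X\<^esub> y"
  have l: "linear_map R X (dsum X Y) ?l"
    by (rule linear_map_interleave[OF linear_map_id linear_map_zero_fun[OF Y]])
  have r: "linear_map R Y (dsum X Y) ?r"
    by (rule linear_map_interleave[OF linear_map_zero_fun[OF X] linear_map_id])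
  let ?C = "?l ` A \<union> ?r ` B"
  have C: "?C \<subseteq> carrier (dsum X Y)"
    using A(2) B(2) by (auto simp: dsum_simps)
  let ?K = "span_module R (dsum X Y) ?C"
  have K: "submodule ?K R (dsum X Y)" by (rule submodule_span_module[OF mXY C])
  have CK: "?C \<subseteq> ?K" by (rule span_module_superset)
  have "A \<subseteq> {x \<in> carrier X. ?l x \<in> ?K}" using A(2) CK by auto
  from span_module_minimal[OF submodule_preimage[OF X mXY l K] this]
  have lK: "?l x \<in> ?K" if "x \<in> carrier X" for x using that A(3) by auto
  have "B \<subseteq> {x \<in> carrier Y. ?r x \<in> ?K}" using B(2) CK by auto
  from span_module_minimal[OF submodule_preimage[OF Y mXY r K] this]
  have rK: "?r y \<in> ?K" if "y \<in> carrier Y" for y using that B(3) by auto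
  have "h \<in> ?K" if h: "h \<in> carrier (dsum X Y)" for h
  proof -
    have "?l (evens h) \<oplus>\<^bsub>dsum X Y\<^esub> ?r (odds h) \<in> ?K"
      by (rule XY.submoduleE(5)[OF K lK rK]) (use h in \<open>simp_all add: dsum_simps\<close>)
    then show ?thesis using h by (simp add: dsum_simps)
  qed
  then have "?K = carrier (dsum X Y)" using XY.submoduleE(1)[OF K] by auto
  moreover have "finite ?C" using A(1) B(1) by simp
  ultimately show ?thesis unfolding finitely_generated_def using C by (intro exI[where x = ?C]) simp
qed

text \<open>The free module must be indexed by elements of the type of sequences, so the disjoint
  union of \<open>S\<close> and \<open>T\<close> has to be realized there: indices from
  \<open>S\<close> get \<open>\<one>\<close> prepended (\<open>c\<close>), those from
  \<open>T\<close> get \<open>\<zero>\<close> (\<open>d\<close>). This is where the ring must be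
  nonzero.\<close>

lemma projective_module_dsum:
  fixes X Y :: "'a seq_module"
  assumes R: "cring R" "\<one>\<^bsub>R\<^esub> \<noteq> \<zero>\<^bsub>R\<^esub>" and X: "module R X" and Y: "module R Y"
    and proj: "projective_module R X" "projective_module R Y"
  shows "projective_module R (dsum X Y)"
proof -
  have mXY: "module R (dsum X Y)" by (rule module_dsum[OF X Y])
  interpret X: module R X by fact
  interpret Y: module R Y by fact
  obtain S i q where 1: "linear_map R X (free_module R S) i" "linear_map R (free_module R S) X q"
      "\<forall>x\<in>carrier X. q (i x) = x" and "S \<subseteq> (UNIV :: (nat \<Rightarrow> 'a) set)"
    using proj(1) unfolding projective_module_def by blast
  obtain T j r where 2: "linear_map R Y (free_module R T) j" "linear_map R (free_module R T) Y r"
      "\<forall>x\<in>carrier Y. r (j x) = x" and "T \<subseteq> (UNIV :: (nat \<Rightarrow> 'a) set)"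
    using proj(2) unfolding projective_module_def by blast
  define c where "c x = case_nat \<one>\<^bsub>R\<^esub> x" for x :: "nat \<Rightarrow> 'a"
  define d where "d x = case_nat \<zero>\<^bsub>R\<^esub> x" for x :: "nat \<Rightarrow> 'a"
  define u where "u x = (\<lambda>n. x (Suc n))" for x :: "nat \<Rightarrow> 'a"
  have uc: "u (c x) = x" "u (d x) = x" for x by (simp_all add: u_def c_def d_def)
  have c0: "c x 0 = \<one>\<^bsub>R\<^esub>" and d0: "d x 0 = \<zero>\<^bsub>R\<^esub>" for x by (simp_all add: c_def d_def)
  let ?U = "c ` S \<union> d ` T"
  let ?F = "free_module R ?U"
  have mF: "module R ?F" and mS: "module R (free_module R S)" and mT: "module R (free_module R T)"
    by (rule module_free_module[OF R(1)])+
  interpret F: module R ?F by (rule mF)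
  define I1 where "I1 = free_lift R S ?F (\<lambda>x. basis_vector R ?U (c x))"
  define I2 where "I2 = free_lift R T ?F (\<lambda>x. basis_vector R ?U (d x))"
  have b: "basis_vector R V x \<in> carrier (free_module R V)" for V :: "(nat \<Rightarrow> 'a) set" and x
    by (rule basis_vector_closed[OF R(1)])
  have I1: "linear_map R (free_module R S) ?F I1" and I2: "linear_map R (free_module R T) ?F I2"
    unfolding I1_def I2_def by (rule linear_map_free_lift[OF mF]; use b in auto)+
  have I1b: "I1 (basis_vector R S x) = basis_vector R ?U (c x)" if "x \<in> S" for x
    unfolding I1_def by (rule free_lift_basis_vector[OF mF _ that]) (use b in auto)
  have I2b: "I2 (basis_vector R T x) = basis_vector R ?U (d x)" if "x \<in> T" for x
    unfolding I2_def by (rule free_lift_basis_vector[OF mF _ that]) (use b in auto)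
  \<comment> \<open>The prepended entry tells from which summand an index comes.\<close>
  define \<phi> where "\<phi> x = (if x 0 = \<one>\<^bsub>R\<^esub> then interleave (q (basis_vector R S (u x))) \<zero>\<^bsub>Y\<^esub>
    else interleave \<zero>\<^bsub>X\<^esub> (r (basis_vector R T (u x))))" for x
  have \<phi>: "\<phi> \<in> ?U \<rightarrow> carrier (dsum X Y)"
    using linear_map_closed[OF 1(2) b] linear_map_closed[OF 2(2) b] by (auto simp: \<phi>_def dsum_simps)
  define Q where "Q = free_lift R ?U (dsum X Y) \<phi>"
  have Q: "linear_map R ?F (dsum X Y) Q" unfolding Q_def by (rule linear_map_free_lift[OF mXY \<phi>])
  have Qb: "Q (basis_vector R ?U x) = \<phi> x" if "x \<in> ?U" for x
    unfolding Q_def by (rule free_lift_basis_vector[OF mXY \<phi> that])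
  have Q1: "Q (I1 v) = interleave (q v) \<zero>\<^bsub>Y\<^esub>" if v: "v \<in> carrier (free_module R S)" for v
    by (rule linear_map_free_eqI[OF R(1) mXY linear_map_comp[OF I1 Q]
          linear_map_interleave[OF 1(2) linear_map_zero_fun[OF Y]] _ v])
      (simp add: I1b Qb \<phi>_def c0 uc)
  have Q2: "Q (I2 v) = interleave \<zero>\<^bsub>X\<^esub> (r v)" if v: "v \<in> carrier (free_module R T)" for v
    by (rule linear_map_free_eqI[OF R(1) mXY linear_map_comp[OF I2 Q]
          linear_map_interleave[OF linear_map_zero_fun[OF X] 2(2)] _ v])
      (simp add: I2b Qb \<phi>_def d0 uc R(2)[symmetric])
  define I where "I h = I1 (i (evens h)) \<oplus>\<^bsub>?F\<^esub> I2 (j (odds h))" for h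
  have J1: "linear_map R (dsum X Y) ?F (\<lambda>h. I1 (i (evens h)))"
    by (intro linear_map_comp[OF linear_map_comp[OF linear_map_evens 1(1)] I1])
  have J2: "linear_map R (dsum X Y) ?F (\<lambda>h. I2 (j (odds h)))"
    by (intro linear_map_comp[OF linear_map_comp[OF linear_map_odds 2(1)] I2])
  have I: "linear_map R (dsum X Y) ?F I"
  proof (rule linear_mapI)
    fix x assume x: "x \<in> carrier (dsum X Y)"
    note x1 = linear_map_closed[OF J1] linear_map_closed[OF J2]
    show "I x \<in> carrier ?F" unfolding I_def using x1 x by simp
    fix y assume y: "y \<in> carrier (dsum X Y)"
    show "I (x \<oplus>\<^bsub>dsum X Y\<^esub> y) = I x \<oplus>\<^bsub>?F\<^esub> I y"
      unfolding I_def linear_map_add[OF J1 x y] linear_map_add[OF J2 x y]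
      using x1[OF x] x1[OF y] by (simp add: F.M.a_ac)
  next
    fix a x assume a: "a \<in> carrier R" and x: "x \<in> carrier (dsum X Y)"
    show "I (a \<odot>\<^bsub>dsum X Y\<^esub> x) = a \<odot>\<^bsub>?F\<^esub> I x"
      unfolding I_def linear_map_smult[OF J1 a x] linear_map_smult[OF J2 a x]
      using a linear_map_closed[OF J1 x] linear_map_closed[OF J2 x] by (simp add: F.smult_r_distr)
  qed
  show ?thesis unfolding projective_module_def
  proof (rule exI[of _ ?U], rule exI[of _ I], rule exI[of _ Q], intro conjI ballI)
    fix h assume h: "h \<in> carrier (dsum X Y)"
    have eo: "evens h \<in> carrier X" "odds h \<in> carrier Y" using h by (simp_all add: dsum_simps)
    have "Q (I h) = Q (I1 (i (evens h))) \<oplus>\<^bsub>dsum X Y\<^esub> Q (I2 (j (odds h)))"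
      unfolding I_def by (rule linear_map_add[OF Q linear_map_closed[OF J1 h] linear_map_closed[OF J2 h]])
    also have "\<dots> = h"
      using 1(3) 2(3) eo
      by (simp add: Q1[OF linear_map_closed[OF 1(1) eo(1)]] Q2[OF linear_map_closed[OF 2(1) eo(2)]] dsum_simps)
    finally show "Q (I h) = h" .
  qed (rule I, rule Q)
qed

section \<open>Closure of the finitely generated projective modules under sums\<close>

lemma proj_modules_module: "M \<in> proj_modules R \<Longrightarrow> module R M"
  by (simp add: proj_modules_def)

lemma dsum_mem_proj_modules:
  assumes one: "\<one>\<^bsub>R\<^esub> \<noteq> \<zero>\<^bsub>R\<^esub>" and XY: "X \<in> proj_modules R" "Y \<in> proj_modules R"
  shows "dsum X Y \<in> proj_modules R"
proof -
  have X: "module R X" "finitely_generated R X" "projective_module R X"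
    and Y: "module R Y" "finitely_generated R Y" "projective_module R Y"
    using XY by (simp_all add: proj_modules_def)
  show ?thesis unfolding proj_modules_def mem_Collect_eq
    by (intro conjI module_dsum[OF X(1) Y(1)] finitely_generated_dsum[OF X(1) Y(1) X(2) Y(2)]
      projective_module_dsum[OF module.axioms(1)[OF X(1)] one X(1) Y(1) X(3) Y(3)])
qed

lemma zero_mod_mem_proj_modules:
  fixes R :: "'a ring"
  assumes "cring R"
  shows "zero_mod R \<in> proj_modules R"
proof -
  interpret R: cring R by fact
  have m: "module R (zero_mod R)"
    by (rule moduleI_no_inverse) (simp_all add: zero_mod_def Let_def R.is_cring)
  interpret Z: module R "zero_mod R" by (rule m)
  have "submodule (span_module R (zero_mod R) {}) R (zero_mod R)"
    by (rule submodule_span_module[OF m]) simp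
  from Z.submoduleE(1,2)[OF this] have "span_module R (zero_mod R) {} = carrier (zero_mod R)"
    by (auto simp: zero_mod_def Let_def)
  then have "finitely_generated R (zero_mod R)" unfolding finitely_generated_def by blast
  moreover have "projective_module R (zero_mod R)"
    unfolding projective_module_def
  proof (rule exI[of _ "{}"], intro exI conjI)
    show "linear_map R (zero_mod R) (free_module R {}) (\<lambda>_. \<zero>\<^bsub>free_module R ({} :: (nat \<Rightarrow> 'a) set)\<^esub>)"
      by (rule linear_map_zero_fun[OF module_free_module[OF assms]])
    show "linear_map R (free_module R {}) (zero_mod R) (\<lambda>_ :: (nat \<Rightarrow> 'a) \<Rightarrow> 'a. \<zero>\<^bsub>zero_mod R\<^esub>)"
      by (rule linear_map_zero_fun[OF m])
    show "\<forall>x\<in>carrier (zero_mod R). \<zero>\<^bsub>zero_mod R\<^esub> = x" by (simp add: zero_mod_def Let_def)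
  qed
  ultimately show ?thesis using m by (simp add: proj_modules_def)
qed

section \<open>Iterated direct sums\<close>

text \<open>The bracketing is that of \<open>dsum_list\<close> with a list of length
  \<open>n\<close>; there are \<open>n + 1\<close> components, the head being number 0.\<close>

primrec tuple :: "nat \<Rightarrow> (nat \<Rightarrow> nat \<Rightarrow> 'a) \<Rightarrow> nat \<Rightarrow> 'a" where
  "tuple 0 y = y 0"
| "tuple (Suc n) y = interleave (tuple n y) (y (Suc n))"

primrec coord :: "nat \<Rightarrow> nat \<Rightarrow> (nat \<Rightarrow> 'a) \<Rightarrow> nat \<Rightarrow> 'a" where
  "coord 0 i d = d"
| "coord (Suc n) i d = (if i \<le> n then coord n i (evens d) else odds d)"

lemma coord_tuple: "i \<le> n \<Longrightarrow> coord n i (tuple n y) = y i"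
  by (induction n) (auto simp: le_Suc_eq)

lemma tuple_cong: "(\<And>i. i \<le> n \<Longrightarrow> y i = z i) \<Longrightarrow> tuple n y = tuple n z"
  by (induction n) auto

lemma tuple_coord: "tuple n (\<lambda>i. coord n i d) = d"
proof (induction n arbitrary: d)
  case (Suc n)
  have "tuple n (\<lambda>i. coord (Suc n) i d) = tuple n (\<lambda>i. coord n i (evens d))"
    by (rule tuple_cong) simp
  then show ?case using Suc[of "evens d"] by simp
qed simp

text \<open>\<open>cross_effect\<close> and \<open>map_ids\<close> absorb the first list entry into
  the head, while \<open>tuple\<close> recurses at the last component. Fusing the components 0 and 1
  reconciles the two recursions.\<close>

lemma tuple_shift: "tuple (Suc n) y = tuple n (\<lambda>i. if i = 0 then interleave (y 0) (y 1) else y (Suc i))"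
  by (induction n) auto

lemma dsum_list_simps [simp]:
  "dsum_list X [] = X"
  "dsum_list X (Ys @ [Y]) = dsum (dsum_list X Ys) Y"
  by (simp_all add: dsum_list_def)

lemma dsum_list_Cons: "dsum_list X (Y # Ys) = dsum_list (dsum X Y) Ys"
  by (simp add: dsum_list_def)

lemma dsum_list_mem_proj_modules:
  assumes "\<one>\<^bsub>R\<^esub> \<noteq> \<zero>\<^bsub>R\<^esub>"
  shows "X \<in> proj_modules R \<Longrightarrow> set Ys \<subseteq> proj_modules R \<Longrightarrow> dsum_list X Ys \<in> proj_modules R"
  by (induction Ys rule: rev_induct) (auto intro: dsum_mem_proj_modules[OF assms])

lemma linear_map_coord:
  "i \<le> length Ys \<Longrightarrow> linear_map R (dsum_list X Ys) ((X # Ys) ! i) (coord (length Ys) i)"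
proof (induction Ys rule: rev_induct)
  case Nil
  then show ?case using linear_map_id[of R X] by (simp add: coord.simps(1)[abs_def])
next
  case (snoc Y Ys)
  show ?case
  proof (cases "i \<le> length Ys")
    case True
    then have nth: "(X # Ys @ [Y]) ! i = (X # Ys) ! i"
      by (metis append_Cons le_imp_less_Suc length_Cons nth_append)
    have coord: "coord (length (Ys @ [Y])) i = (\<lambda>d. coord (length Ys) i (evens d))"
      using True by (auto simp: fun_eq_iff)
    show ?thesis unfolding nth coord dsum_list_simps
      by (rule linear_map_comp[OF linear_map_evens snoc.IH[OF True]])
  next
    case False
    then have i: "i = Suc (length Ys)" using snoc.prems by simp
    then have nth: "(X # Ys @ [Y]) ! i = Y" by simp
    have coord: "coord (length (Ys @ [Y])) i = odds" using i by (auto simp: fun_eq_iff)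
    show ?thesis unfolding nth coord dsum_list_simps by (rule linear_map_odds)
  qed
qed

lemma linear_map_tuple:
  "(\<And>i. i \<le> length Ys \<Longrightarrow> linear_map R A ((X # Ys) ! i) (u i)) \<Longrightarrow>
    linear_map R A (dsum_list X Ys) (\<lambda>a. tuple (length Ys) (\<lambda>i. u i a))"
proof (induction Ys rule: rev_induct)
  case Nil
  then show ?case using Nil[of 0] by simp
next
  case (snoc Y Ys)
  have "linear_map R A ((X # Ys) ! i) (u i)" if "i \<le> length Ys" for i
  proof -
    have "(X # Ys @ [Y]) ! i = (X # Ys) ! i"
      using that by (metis append_Cons le_imp_less_Suc length_Cons nth_append)
    then show ?thesis using snoc.prems[of i] that by simp
  qed
  from snoc.IH[OF this] have "linear_map R A (dsum_list X Ys) (\<lambda>a. tuple (length Ys) (\<lambda>i. u i a))" .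
  moreover have "linear_map R A Y (u (Suc (length Ys)))"
    using snoc.prems[of "Suc (length Ys)"] by simp
  ultimately show ?case using linear_map_interleave by simp blast
qed

lemma linear_map_dsum_map:
  assumes f: "linear_map R X X' f" and g: "linear_map R Y Y' g" and XY: "module R X" "module R Y"
  shows "linear_map R (dsum X Y) (dsum X' Y') (dsum_map X Y f g)"
  by (rule linear_map_cong[OF linear_map_interleave[OF linear_map_comp[OF linear_map_evens f]
          linear_map_comp[OF linear_map_odds g]] module_dsum[OF XY]])
    (simp add: dsum_map_def)

lemma linear_map_id_mor: "module R M \<Longrightarrow> linear_map R M M (id_mor M)"
  by (rule linear_map_cong[OF linear_map_id]) auto

lemma linear_map_map_ids:
  assumes "linear_map R X X' f" "module R X" "\<And>Y. Y \<in> set Ys \<Longrightarrow> module R Y"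
  shows "linear_map R (dsum_list X Ys) (dsum_list X' Ys) (map_ids X f Ys)"
  using assms
proof (induction Ys arbitrary: X X' f)
  case (Cons Y Ys)
  have "linear_map R (dsum X Y) (dsum X' Y) (dsum_map X Y f (id_mor Y))"
    using Cons.prems by (intro linear_map_dsum_map linear_map_id_mor) auto
  then show ?case using Cons.prems by (auto simp: dsum_list_Cons intro!: Cons.IH module_dsum)
qed simp

lemma map_ids_tuple:
  "y 0 \<in> carrier X \<Longrightarrow> (\<And>i. i < length Ys \<Longrightarrow> y (Suc i) \<in> carrier (Ys ! i)) \<Longrightarrow>
    map_ids X f Ys (tuple (length Ys) y) = tuple (length Ys) (y(0 := f (y 0)))"
proof (induction Ys arbitrary: X f y)
  case (Cons Y Ys)
  let ?y = "\<lambda>i. if i = 0 then interleave (y 0) (y 1) else y (Suc i)"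
  have y1: "y 1 \<in> carrier Y" using Cons.prems(2)[of 0] by simp
  have y0: "interleave (y 0) (y 1) \<in> carrier (dsum X Y)" using Cons.prems(1) y1 by (simp add: dsum_simps)
  have y: "?y (Suc i) \<in> carrier (Ys ! i)" if "i < length Ys" for i
    using Cons.prems(2)[of "Suc i"] that by simp
  have "map_ids X f (Y # Ys) (tuple (length (Y # Ys)) y) =
      map_ids (dsum X Y) (dsum_map X Y f (id_mor Y)) Ys (tuple (length Ys) ?y)"
    by (simp only: list.size(4) add_Suc_right add_0_right tuple_shift map_ids.simps)
  also have "\<dots> = tuple (length Ys) (?y(0 := dsum_map X Y f (id_mor Y) (?y 0)))"
    by (rule Cons.IH) (use y0 y in auto)
  also have "dsum_map X Y f (id_mor Y) (?y 0) = interleave (f (y 0)) (y 1)"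
    using y0 y1 by (simp add: dsum_map_def)
  also have "?y(0 := interleave (f (y 0)) (y 1)) =
      (\<lambda>i. if i = 0 then interleave ((y(0 := f (y 0))) 0) ((y(0 := f (y 0))) 1) else (y(0 := f (y 0))) (Suc i))"
    by auto
  also have "tuple (length Ys) \<dots> = tuple (length (Y # Ys)) (y(0 := f (y 0)))"
    by (simp only: list.size(4) add_Suc_right add_0_right tuple_shift)
  finally show ?case .
qed simp

section \<open>Digit sums and multinomial coefficients\<close>

text \<open>The cut-off in \<open>digit_sum\<close> depends on the number itself; a common larger
  bound makes the digits of a number and of its quotient by \<open>p\<close> comparable.\<close>

lemma digit_sum_eq_sum:
  assumes "p \<ge> 2" "n \<le> m"
  shows "digit_sum p n = (\<Sum>i\<le>m. n div p ^ i mod p)"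
  unfolding digit_sum_def
proof (rule sum.mono_neutral_left)
  have "n div p ^ i = 0" if "n < i" for i
  proof -
    have "i < p ^ i" using assms(1) by (intro power_gt_expt) auto
    then show ?thesis using that by simp
  qed
  then show "\<forall>i\<in>{..m} - {..n}. n div p ^ i mod p = 0" by auto
qed (use assms in auto)

lemma digit_sum_rec:
  assumes "p \<ge> 2" "r < p"
  shows "digit_sum p (p * q + r) = r + digit_sum p q"
proof -
  let ?n = "p * q + r"
  have q: "q \<le> ?n" using assms(1) by (simp add: trans_le_add1)
  have "digit_sum p ?n = (\<Sum>i\<le>Suc ?n. ?n div p ^ i mod p)"
    by (rule digit_sum_eq_sum[OF assms(1)]) simp
  also have "\<dots> = ?n mod p + (\<Sum>i\<le>?n. ?n div p ^ Suc i mod p)"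
    by (subst sum.atMost_Suc_shift) simp
  also have "(\<Sum>i\<le>?n. ?n div p ^ Suc i mod p) = (\<Sum>i\<le>?n. q div p ^ i mod p)"
  proof (rule sum.cong[OF refl])
    fix i
    have "?n div p = q" using assms by simp
    then show "?n div p ^ Suc i mod p = q div p ^ i mod p" by (simp add: div_mult2_eq)
  qed
  also have "\<dots> = digit_sum p q" by (rule digit_sum_eq_sum[OF assms(1) q, symmetric])
  finally show ?thesis using assms by simp
qed

lemma digit_sum_0 [simp]: "digit_sum p 0 = 0"
  by (simp add: digit_sum_def)

lemma digit_sum_less: "p \<ge> 2 \<Longrightarrow> r < p \<Longrightarrow> digit_sum p r = r"
  using digit_sum_rec[of p r 0] by simp

lemma digit_sum_mult: "p \<ge> 2 \<Longrightarrow> digit_sum p (p * q) = digit_sum p q"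
  using digit_sum_rec[of p 0 q] by simp

lemma digit_sum_power: "p \<ge> 2 \<Longrightarrow> digit_sum p (p ^ e) = 1"
  by (induction e) (auto simp: digit_sum_mult digit_sum_less)

text \<open>Adding 1 turns each trailing digit \<open>p - 1\<close> into 0 and raises the next digit
  by one, and the number of these carries is the valuation of the result.\<close>

lemma digit_sum_Suc:
  assumes p: "prime p"
  shows "digit_sum p (Suc n) + (p - 1) * multiplicity p (Suc n) = digit_sum p n + 1"
proof (induction n rule: less_induct)
  case (less n)
  have p2: "p \<ge> 2" by (rule prime_ge_2_nat[OF p])
  define q r where "q = n div p" and "r = n mod p"
  have n: "n = p * q + r" and r: "r < p" using p2 by (auto simp: q_def r_def)
  show ?case
  proof (cases "Suc r < p")
    case True
    have Sn: "Suc n = p * q + Suc r" by (simp add: n)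
    have "\<not> p dvd Suc r" using True by (auto dest: dvd_imp_le)
    then have "\<not> p dvd Suc n" unfolding Sn by (metis dvd_add_right_iff dvd_triv_left)
    then have "multiplicity p (Suc n) = 0" by (rule not_dvd_imp_multiplicity_0)
    then show ?thesis using digit_sum_rec[OF p2 True, of q] digit_sum_rec[OF p2 r, of q]
      by (simp add: n)
  next
    case False
    then have r': "r = p - 1" using r by simp
    have Sn: "Suc n = p * Suc q" using r' p2 by (simp add: n)
    have "2 * q \<le> p * q" using p2 by (rule mult_le_mono1)
    then have "q < n" using n r' p2 by linarith
    have "multiplicity p (Suc n) = Suc (multiplicity p (Suc q))"
      unfolding Sn using p by (subst multiplicity_times_same) auto
    moreover have "digit_sum p (Suc n) = digit_sum p (Suc q)" unfolding Sn by (rule digit_sum_mult[OF p2])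
    moreover have "digit_sum p n = p - 1 + digit_sum p q" unfolding n using digit_sum_rec[OF p2 r, of q] r' by simp
    ultimately show ?thesis using less.IH[OF \<open>q < n\<close>] by simp
  qed
qed

text \<open>Legendre's formula, accumulated from \<open>digit_sum_Suc\<close> over the factors of
  the factorial and stated without subtraction or division.\<close>

lemma legendre_digit_sum:
  assumes p: "prime p"
  shows "(p - 1) * multiplicity p (fact n :: nat) + digit_sum p n = n"
proof (induction n)
  case (Suc n)
  have "multiplicity p (fact (Suc n) :: nat) = multiplicity p (Suc n) + multiplicity p (fact n :: nat)"
    unfolding fact_Suc using p by (subst prime_elem_multiplicity_mult_distrib) auto
  then show ?case using Suc digit_sum_Suc[OF p, of n] by (simp add: add_mult_distrib2)
qed simp

text \<open>Legendre's formula is applied to every factorial; the terms linear in the arguments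
  cancel because the parts add up to \<open>s\<close>. The coefficient is given by its product
  equation, which serves binomials and cardinalities alike.\<close>

lemma multiplicity_multinomial:
  assumes p: "prime p" and C: "C * (\<Prod>j\<in>A. fact (\<nu> j)) = (fact s :: nat)"
    and A: "finite A" "sum \<nu> A = s"
  shows "(p - 1) * multiplicity p C + digit_sum p s = (\<Sum>j\<in>A. digit_sum p (\<nu> j))"
proof -
  have C0: "C \<noteq> 0" using C by (metis fact_nonzero mult_zero_left)
  have "multiplicity p (\<Prod>j\<in>A. fact (\<nu> j) :: nat) = (\<Sum>j\<in>A. multiplicity p (fact (\<nu> j) :: nat))"
    using p A(1) by (intro prime_elem_multiplicity_prod_distrib) auto
  moreover have "multiplicity p (C * (\<Prod>j\<in>A. fact (\<nu> j))) = multiplicity p C + multiplicity p (\<Prod>j\<in>A. fact (\<nu> j) :: nat)"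
    using p C0 A(1) by (intro prime_elem_multiplicity_mult_distrib) auto
  ultimately have "multiplicity p (fact s :: nat) = multiplicity p C + (\<Sum>j\<in>A. multiplicity p (fact (\<nu> j) :: nat))"
    using C by simp
  then have "(p - 1) * multiplicity p (fact s :: nat) =
      (p - 1) * multiplicity p C + (\<Sum>j\<in>A. (p - 1) * multiplicity p (fact (\<nu> j) :: nat))"
    by (simp add: sum_distrib_left add_mult_distrib2)
  moreover have "(\<Sum>j\<in>A. (p - 1) * multiplicity p (fact (\<nu> j) :: nat)) + (\<Sum>j\<in>A. digit_sum p (\<nu> j)) = s"
    unfolding sum.distrib[symmetric] using legendre_digit_sum[OF p] A(2) by simp
  ultimately show ?thesis using legendre_digit_sum[OF p, of s] by linarith
qed

text \<open>Not being a power of \<open>p\<close> means that the digit sum is at least 2, so the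
  digits can be shared between two positive numbers without carries. Trailing zeros are removed by
  recursion; then the last digit is split off, or 1 from a single digit.\<close>

lemma digit_sum_split:
  assumes p: "p \<ge> 2"
  shows "n > 0 \<Longrightarrow> (\<And>e. n \<noteq> p ^ e) \<Longrightarrow> \<exists>a b. a > 0 \<and> b > 0 \<and> a + b = n \<and> digit_sum p n = digit_sum p a + digit_sum p b"
proof (induction n rule: less_induct)
  case (less n)
  define q r where "q = n div p" and "r = n mod p"
  have n: "n = p * q + r" and r: "r < p" using p by (auto simp: q_def r_def)
  consider "q = 0" | "q > 0" "r > 0" | "q > 0" "r = 0" by auto
  then show ?case
  proof cases
    case 1
    then have "n > 1" using n less.prems(1) less.prems(2)[of 0] by simp
    then show ?thesis using 1 n r p
      by (intro exI[of _ 1] exI[of _ "n - 1"]) (auto simp: digit_sum_less)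
  next
    case 2
    then show ?thesis using n r p
      by (intro exI[of _ "p * q"] exI[of _ r]) (auto simp: digit_sum_rec digit_sum_mult digit_sum_less)
  next
    case 3
    have "q \<noteq> p ^ e" for e using less.prems(2)[of "Suc e"] n 3 by auto
    moreover have "q < n" using n 3 p by simp
    ultimately obtain a b where ab: "a > 0" "b > 0" "a + b = q" "digit_sum p q = digit_sum p a + digit_sum p b"
      using less.IH[of q] 3 by blast
    then show ?thesis using n 3 p
      by (intro exI[of _ "p * a"] exI[of _ "p * b"]) (auto simp: digit_sum_mult add_mult_distrib2[symmetric])
  qed
qed

text \<open>Kummer's criterion: a sum without carries has a binomial coefficient prime to
  \<open>p\<close>.\<close>

lemma binomial_coprime_split:
  assumes p: "prime p" and n: "n > 0" "\<And>e. n \<noteq> p ^ e"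
  shows "\<exists>a b. a > 0 \<and> b > 0 \<and> a + b = n \<and> \<not> p dvd (n choose b)"
proof -
  have p2: "p \<ge> 2" by (rule prime_ge_2_nat[OF p])
  obtain a b where ab: "a > 0" "b > 0" "a + b = n" "digit_sum p n = digit_sum p a + digit_sum p b"
    using digit_sum_split[OF p2 n] by blast
  \<comment> \<open>A binomial coefficient is a multinomial one with two parts, here indexed by
    truth values so that equal parts stay distinct.\<close>
  have "(n choose b) * (\<Prod>j\<in>{False, True}. fact (if j then a else b)) = (fact n :: nat)"
    using binomial_fact_lemma[of b n] ab(3) by (auto simp: algebra_simps)
  from multiplicity_multinomial[OF p this] have "(p - 1) * multiplicity p (n choose b) = 0"
    using ab by simp
  then have "multiplicity p (n choose b) = 0" using p2 by simp
  moreover have "n choose b \<noteq> 0" using ab by simp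
  ultimately have "\<not> p dvd (n choose b)"
    using p by (metis multiplicity_eq_zero_iff not_prime_unit)
  then show ?thesis using ab by blast
qed

lemma power_cong_1: "p \<ge> 2 \<Longrightarrow> [p ^ e = 1] (mod (p - 1 :: nat))"
proof -
  assume "p \<ge> 2"
  then have "[p = 1] (mod (p - 1))" by (simp add: cong_def mod_if le_mod_geq)
  from cong_pow[OF this, of e] show ?thesis by simp
qed

section \<open>Functions with prescribed fibre sizes\<close>

text \<open>Words of length \<open>s\<close> with content \<open>\<nu>\<close>. When nonempty this
  is one orbit of the symmetric group; values of \<open>\<nu>\<close> from \<open>k\<close> on are
  ignored.\<close>

definition weighted :: "nat \<Rightarrow> nat \<Rightarrow> (nat \<Rightarrow> nat) \<Rightarrow> (nat \<Rightarrow> nat) set" where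
  "weighted s k \<nu> = {f \<in> {..<s} \<rightarrow>\<^sub>E {..<k}. \<forall>j<k. card {i. i < s \<and> f i = j} = \<nu> j}"

lemma finite_weighted: "finite (weighted s k \<nu>)"
  by (rule finite_subset[of _ "{..<s} \<rightarrow>\<^sub>E {..<k}"]) (auto simp: weighted_def finite_PiE)

lemma permutation_invariant_weighted: "permutation_invariant s (weighted s k \<nu>)"
  unfolding permutation_invariant_def
proof (intro conjI allI impI ballI)
  show "weighted s k \<nu> \<subseteq> extensional {..<s}" by (auto simp: weighted_def PiE_iff)
  fix \<sigma> f assume \<sigma>: "\<sigma> permutes {..<s}" and f: "f \<in> weighted s k \<nu>"
  have lt: "\<sigma> i < s \<longleftrightarrow> i < s" for i using permutes_in_image[OF \<sigma>, of i] by simp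
  have "card {i. i < s \<and> (\<lambda>i\<in>{..<s}. f (\<sigma> i)) i = j} = card {i. i < s \<and> f i = j}" for j
  proof (rule bij_betw_same_card[of \<sigma>])
    show "bij_betw \<sigma> {i. i < s \<and> (\<lambda>i\<in>{..<s}. f (\<sigma> i)) i = j} {i. i < s \<and> f i = j}"
      by (rule bij_betw_byWitness[where f' = "inv_into UNIV \<sigma>"])
        (use permutes_inverses[OF \<sigma>] permutes_in_image[OF permutes_inv[OF \<sigma>]] lt in auto)
  qed
  then show "(\<lambda>i\<in>{..<s}. f (\<sigma> i)) \<in> weighted s k \<nu>"
    using f lt by (auto simp: weighted_def PiE_iff)
qed

text \<open>Listing the values of a function in order identifies \<open>weighted s k \<nu>\<close>
  with the arrangements of a multiset that contains \<open>\<nu> j\<close> copies of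
  \<open>j\<close>.\<close>

lemma card_weighted:
  assumes "(\<Sum>j<k. \<nu> j) = s"
  shows "card (weighted s k \<nu>) * (\<Prod>j<k. fact (\<nu> j)) = fact s"
proof -
  define A where "A = (\<Sum>j<k. replicate_mset (\<nu> j) j)"
  have count: "count A j = (if j < k then \<nu> j else 0)" for j
    unfolding A_def by (simp add: count_sum sum.delta)
  have size: "size A = s" unfolding A_def using assms by (simp add: size_multiset_sum)
  have cnt: "count (mset (map f [0..<s])) j = card {i. i < s \<and> f i = j}" for f :: "nat \<Rightarrow> nat" and j
  proof -
    have "count (mset (map f [0..<s])) j = length (filter ((=) j) (map f [0..<s]))"
      unfolding count_mset count_list_eq_length_filter ..
    also have "\<dots> = card {i. i < s \<and> f i = j}"
      unfolding length_filter_conv_card by (rule arg_cong[of _ _ card]) auto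
    finally show ?thesis .
  qed
  have "bij_betw (\<lambda>f. map f [0..<s]) (weighted s k \<nu>) (permutations_of_multiset A)"
  proof (rule bij_betw_byWitness[where f' = "\<lambda>xs. \<lambda>i\<in>{..<s}. xs ! i"])
    show "\<forall>f\<in>weighted s k \<nu>. (\<lambda>i\<in>{..<s}. map f [0..<s] ! i) = f"
      by (auto simp: weighted_def PiE_iff extensional_def fun_eq_iff)
    have len: "length xs = s" if "mset xs = A" for xs using that size by (metis size_mset)
    show "\<forall>xs\<in>permutations_of_multiset A. map (\<lambda>i\<in>{..<s}. xs ! i) [0..<s] = xs"
      using len by (auto simp: permutations_of_multiset_def intro!: nth_equalityI)
    have "mset (map f [0..<s]) = A" if f: "f \<in> weighted s k \<nu>" for f
    proof (rule multiset_eqI)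
      fix j
      have "{i. i < s \<and> f i = j} = {}" if "\<not> j < k"
        using f that by (auto simp: weighted_def PiE_iff)
      then show "count (mset (map f [0..<s])) j = count A j"
        unfolding cnt count using f by (auto simp: weighted_def)
    qed
    then show "(\<lambda>f. map f [0..<s]) ` weighted s k \<nu> \<subseteq> permutations_of_multiset A"
      by (auto simp: permutations_of_multiset_def)
    have "(\<lambda>i\<in>{..<s}. xs ! i) \<in> weighted s k \<nu>" if xs: "mset xs = A" for xs
    proof -
      have c: "card {i. i < s \<and> xs ! i = j} = (if j < k then \<nu> j else 0)" for j
        using cnt[of "\<lambda>i. xs ! i" j] len[OF xs] count[of j] xs by (metis map_nth)
      have "xs ! i < k" if "i < s" for i
      proof (rule ccontr)
        assume "\<not> xs ! i < k"
        then have "card {i'. i' < s \<and> xs ! i' = xs ! i} = 0" using c[of "xs ! i"] by simp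
        then show False using that by auto
      qed
      moreover have "{i. i < s \<and> (\<lambda>i\<in>{..<s}. xs ! i) i = j} = {i. i < s \<and> xs ! i = j}" for j by auto
      ultimately show ?thesis using c by (auto simp: weighted_def)
    qed
    then show "(\<lambda>xs. \<lambda>i\<in>{..<s}. xs ! i) ` permutations_of_multiset A \<subseteq> weighted s k \<nu>"
      by (auto simp: permutations_of_multiset_def)
  qed
  then have "card (weighted s k \<nu>) = card (permutations_of_multiset A)" by (rule bij_betw_same_card)
  moreover have "(\<Prod>j\<in>set_mset A. fact (count A j)) = (\<Prod>j<k. fact (\<nu> j) :: nat)"
  proof -
    have "(\<Prod>j\<in>set_mset A. fact (count A j)) = (\<Prod>j<k. fact (count A j) :: nat)"
      by (rule prod.mono_neutral_left)
        (auto simp: set_mset_def count split: if_splits intro!: gr0I)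
    then show ?thesis by (simp add: count)
  qed
  ultimately show ?thesis using card_permutations_of_multiset_aux[of A] size by simp
qed

text \<open>The part \<open>a + b\<close> at \<open>i0\<close> is divided: \<open>a\<close> stays at
  \<open>i0\<close>, \<open>b\<close> moves to the fresh index \<open>k\<close>, and
  \<open>g\<close> undoes this. A preimage of \<open>f\<close> amounts to choosing the
  \<open>b\<close> positions, among the \<open>a + b\<close> with value \<open>i0\<close>, that
  move.\<close>

lemma weighted_split:
  assumes i0: "i0 < k" and \<mu>: "\<mu> i0 = a + b"
  defines "g \<equiv> \<lambda>j. if j = k then i0 else j"
  shows weighted_split_mem:
      "f' \<in> weighted s (Suc k) (\<mu>(i0 := a, k := b)) \<Longrightarrow> (\<lambda>i\<in>{..<s}. g (f' i)) \<in> weighted s k \<mu>"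
    and card_weighted_split: "f \<in> weighted s k \<mu> \<Longrightarrow>
      card {f' \<in> weighted s (Suc k) (\<mu>(i0 := a, k := b)). (\<lambda>i\<in>{..<s}. g (f' i)) = f} = (a + b) choose b"
proof -
  let ?\<nu> = "\<mu>(i0 := a, k := b)"
  have g: "g j < k" if "j < Suc k" for j using that i0 by (auto simp: g_def)
  have card_g: "card {i. i < s \<and> (\<lambda>i\<in>{..<s}. g (f' i)) i = j} =
      (if j = i0 then card {i. i < s \<and> f' i = i0} + card {i. i < s \<and> f' i = k} else card {i. i < s \<and> f' i = j})"
    if "j < k" for j and f' :: "nat \<Rightarrow> nat"
  proof (cases "j = i0")
    case True
    have "{i. i < s \<and> (\<lambda>i\<in>{..<s}. g (f' i)) i = j} = {i. i < s \<and> f' i = i0} \<union> {i. i < s \<and> f' i = k}"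
      using True i0 by (auto simp: g_def)
    then show ?thesis using True i0 by (simp add: card_Un_disjoint disjoint_iff)
  next
    case False
    have "{i. i < s \<and> (\<lambda>i\<in>{..<s}. g (f' i)) i = j} = {i. i < s \<and> f' i = j}"
      using False that by (auto simp: g_def)
    then show ?thesis using False by simp
  qed
  show "(\<lambda>i\<in>{..<s}. g (f' i)) \<in> weighted s k \<mu>" if "f' \<in> weighted s (Suc k) ?\<nu>"
  proof -
    have f': "f' i < Suc k" if "i < s" for i using \<open>f' \<in> _\<close> that by (auto simp: weighted_def PiE_iff)
    have c: "card {i. i < s \<and> f' i = j} = ?\<nu> j" if "j < Suc k" for j
      using \<open>f' \<in> _\<close> that by (auto simp: weighted_def)
    have "card {i. i < s \<and> (\<lambda>i\<in>{..<s}. g (f' i)) i = j} = \<mu> j" if "j < k" for j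
      unfolding card_g[OF that] using c[of i0] c[of k] c[of j] that i0 \<mu> by auto
    then show ?thesis using f' g by (simp add: weighted_def)
  qed
  show "card {f' \<in> weighted s (Suc k) ?\<nu>. (\<lambda>i\<in>{..<s}. g (f' i)) = f} = (a + b) choose b"
    if f: "f \<in> weighted s k \<mu>"
  proof -
    let ?P = "{i. i < s \<and> f i = i0}"
    have fk: "f i < k" if "i < s" for i using f that by (auto simp: weighted_def PiE_iff)
    have fk': "f i \<noteq> k" if "i < s" for i using fk[OF that] by simp
    have fu: "f i = undefined" if "\<not> i < s" for i using f that by (auto simp: weighted_def PiE_iff extensional_def)
    have cf: "card {i. i < s \<and> f i = j} = \<mu> j" if "j < k" for j using f that by (auto simp: weighted_def)
    \<comment> \<open>\<open>B\<close> is the set of positions relabelled from \<open>i0\<close> to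
      \<open>k\<close>.\<close>
    have "bij_betw (\<lambda>B. \<lambda>i\<in>{..<s}. if i \<in> B then k else f i) {B. B \<subseteq> ?P \<and> card B = b}
        {f' \<in> weighted s (Suc k) ?\<nu>. (\<lambda>i\<in>{..<s}. g (f' i)) = f}"
    proof (rule bij_betw_byWitness[where f' = "\<lambda>f'. {i. i < s \<and> f' i = k}"])
      show "\<forall>B\<in>{B. B \<subseteq> ?P \<and> card B = b}. {i. i < s \<and> (\<lambda>i\<in>{..<s}. if i \<in> B then k else f i) i = k} = B"
        using fk' by auto
      show "\<forall>f'\<in>{f' \<in> weighted s (Suc k) ?\<nu>. (\<lambda>i\<in>{..<s}. g (f' i)) = f}.
          (\<lambda>i\<in>{..<s}. if i \<in> {i. i < s \<and> f' i = k} then k else f i) = f'"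
      proof (intro ballI ext, elim CollectE conjE)
        fix f' i assume f': "f' \<in> weighted s (Suc k) ?\<nu>" and f: "(\<lambda>i\<in>{..<s}. g (f' i)) = f"
        have "f i = g (f' i)" if "i < s" using that by (simp add: f[symmetric])
        moreover have "f' i = undefined" if "\<not> i < s"
          using f' that by (auto simp: weighted_def PiE_iff extensional_def)
        ultimately show "(\<lambda>i\<in>{..<s}. if i \<in> {i. i < s \<and> f' i = k} then k else f i) i = f' i"
          by (auto simp: g_def)
      qed
      show "(\<lambda>f'. {i. i < s \<and> f' i = k}) ` {f' \<in> weighted s (Suc k) ?\<nu>. (\<lambda>i\<in>{..<s}. g (f' i)) = f}
          \<subseteq> {B. B \<subseteq> ?P \<and> card B = b}"
      proof (intro image_subsetI, elim CollectE conjE)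
        fix f' assume f': "f' \<in> weighted s (Suc k) ?\<nu>" and f: "(\<lambda>i\<in>{..<s}. g (f' i)) = f"
        have "f i = g (f' i)" if "i < s" for i using that by (simp add: f[symmetric])
        then have "{i. i < s \<and> f' i = k} \<subseteq> ?P" by (auto simp: g_def)
        moreover have "card {i. i < s \<and> f' i = k} = b" using f' by (simp add: weighted_def)
        ultimately show "{i. i < s \<and> f' i = k} \<in> {B. B \<subseteq> ?P \<and> card B = b}" by simp
      qed
      show "(\<lambda>B. \<lambda>i\<in>{..<s}. if i \<in> B then k else f i) ` {B. B \<subseteq> ?P \<and> card B = b}
          \<subseteq> {f' \<in> weighted s (Suc k) ?\<nu>. (\<lambda>i\<in>{..<s}. g (f' i)) = f}"
      proof (intro image_subsetI, elim CollectE conjE)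
        fix B assume B: "B \<subseteq> ?P" "card B = b"
        let ?f = "\<lambda>i\<in>{..<s}. if i \<in> B then k else f i"
        have finB: "finite B" using B(1) by (rule finite_subset) simp
        have "card {i. i < s \<and> ?f i = j} = ?\<nu> j" if j: "j < Suc k" for j
        proof -
          consider "j = k" | "j = i0" | "j < k" "j \<noteq> i0" using j by linarith
          then show ?thesis
          proof cases
            case 1
            have "{i. i < s \<and> ?f i = j} = B" using 1 B(1) fk' by auto
            then show ?thesis using 1 B(2) i0 by simp
          next
            case 2
            have "{i. i < s \<and> ?f i = j} = ?P - B" using 2 i0 by auto
            then show ?thesis using 2 i0 B finB cf[OF i0] \<mu> by (simp add: card_Diff_subset)
          next
            case 3
            have "{i. i < s \<and> ?f i = j} = {i. i < s \<and> f i = j}" using 3 B(1) by auto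
            then show ?thesis using 3 cf[of j] by simp
          qed
        qed
        moreover have "?f \<in> {..<s} \<rightarrow>\<^sub>E {..<Suc k}" using fk by (auto simp: less_Suc_eq)
        ultimately have "?f \<in> weighted s (Suc k) ?\<nu>" by (simp add: weighted_def)
        moreover have "(\<lambda>i\<in>{..<s}. g (?f i)) = f"
          using B(1) fk' fu by (auto simp: fun_eq_iff g_def)
        ultimately show "?f \<in> {f' \<in> weighted s (Suc k) ?\<nu>. (\<lambda>i\<in>{..<s}. g (f' i)) = f}" by simp
      qed
    qed
    then have "card {f' \<in> weighted s (Suc k) ?\<nu>. (\<lambda>i\<in>{..<s}. g (f' i)) = f} = card {B. B \<subseteq> ?P \<and> card B = b}"
      by (rule bij_betw_same_card[symmetric])
    also have "\<dots> = card ?P choose b" by (rule n_subsets) simp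
    finally show ?thesis using cf[OF i0] \<mu> by simp
  qed
qed

section \<open>Cross effects of strict polynomial functors\<close>

text \<open>Integer multiples become scalar multiples, which F respects by R-linearity.\<close>

lemma (in module) add_pow_eq_smult: "x \<in> carrier M \<Longrightarrow> add_pow M (n::nat) x = add_pow R n \<one> \<odot>\<^bsub>M\<^esub> x"
  by (induction n) (simp_all add: smult_l_distr)

lemma tensor_map_id:
  assumes M: "module R M" and f: "\<And>x. x \<in> carrier M \<Longrightarrow> f x = x"
  shows "tensor_map R s M M f = id_mor (tensor_power R s M)"
proof (rule hom_tensor_power_eqI[OF M module_tensor_power[OF M]])
  have lin: "linear_map R M M f" by (rule linear_map_cong[OF linear_map_id M]) (rule f)
  show "tensor_map R s M M f \<in> carrier (hom_module R (tensor_power R s M) (tensor_power R s M))"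
    by (rule tensor_map_mem_hom[OF M M lin])
  show "id_mor (tensor_power R s M) \<in> carrier (hom_module R (tensor_power R s M) (tensor_power R s M))"
    by (rule restrict_mem_hom_module[OF module_tensor_power[OF M] linear_map_id])
  fix x assume x: "x \<in> tuples s M"
  have "(\<lambda>i\<in>{..<s}. f (x i)) = x" using x f by (auto simp: fun_eq_iff PiE_iff extensional_def)
  then show "tensor_map R s M M f (pure_tensor R s M x) = id_mor (tensor_power R s M) (pure_tensor R s M x)"
    by (simp add: tensor_map_pure[OF M M lin x] pure_tensor_closed[OF M x])
qed

lemma permutation_invariant_UN:
  "(\<And>\<nu>. \<nu> \<in> C \<Longrightarrow> permutation_invariant s (A \<nu>)) \<Longrightarrow> permutation_invariant s (\<Union>\<nu>\<in>C. A \<nu>)"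
  unfolding permutation_invariant_def by blast

lemma tuple_zero: "tuple (length Ys) (\<lambda>i. \<zero>\<^bsub>(X # Ys) ! i\<^esub>) = \<zero>\<^bsub>dsum_list X Ys\<^esub>"
proof (induction Ys rule: rev_induct)
  case (snoc Y Ys)
  have "tuple (length Ys) (\<lambda>i. \<zero>\<^bsub>(X # Ys @ [Y]) ! i\<^esub>) = tuple (length Ys) (\<lambda>i. \<zero>\<^bsub>(X # Ys) ! i\<^esub>)"
  proof (rule tuple_cong)
    fix i assume "i \<le> length Ys"
    then have "(X # Ys @ [Y]) ! i = (X # Ys) ! i"
      by (metis append_Cons le_imp_less_Suc length_Cons nth_append)
    then show "\<zero>\<^bsub>(X # Ys @ [Y]) ! i\<^esub> = \<zero>\<^bsub>(X # Ys) ! i\<^esub>" by simp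
  qed
  then show ?case using snoc by (simp add: dsum_simps)
qed simp

text \<open>Both sides are the components of one and the same tuple, by
  \<open>tuple_shift\<close>.\<close>

lemma coord_shift:
  assumes "j \<le> n"
  shows "coord n j d =
    (if j = 0 then interleave (coord (Suc n) 0 d) (coord (Suc n) 1 d) else coord (Suc n) (Suc j) d)"
proof -
  let ?e = "\<lambda>j. if j = 0 then interleave (coord (Suc n) 0 d) (coord (Suc n) 1 d) else coord (Suc n) (Suc j) d"
  have "tuple n ?e = d"
    using tuple_shift[of n "\<lambda>j. coord (Suc n) j d"] tuple_coord[of "Suc n" d] by metis
  then show ?thesis using coord_tuple[OF assms, of ?e] by metis
qed

locale strict_functor =
  fixes R :: "'a ring" and s :: nat
    and Fo :: "'a seq_module \<Rightarrow> ('a, 'v) module"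
    and Fm :: "'a seq_module \<Rightarrow> 'a seq_module \<Rightarrow> 'a schur_mor \<Rightarrow> 'v \<Rightarrow> 'v"
  assumes cring: "cring R"
    and one_not_zero: "\<one>\<^bsub>R\<^esub> \<noteq> \<zero>\<^bsub>R\<^esub>"
    and s_pos: "s > 0"
    and spf: "strict_poly_functor R s Fo Fm"
begin

abbreviation "T \<equiv> tensor_power R s"
abbreviation "Gm \<equiv> underlying_mor R s Fm"
abbreviation "vanishes \<equiv> cross_effect_vanishes R Fo Gm"

section \<open>Linearity and functoriality on equivariant maps\<close>

lemma module_Fo: "M \<in> proj_modules R \<Longrightarrow> module R (Fo M)"
  using spf unfolding strict_poly_functor_def by blast

lemma linear_Fm: "M \<in> proj_modules R \<Longrightarrow> N \<in> proj_modules R \<Longrightarrow>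
    linear_map R (schur_hom R s M N) (hom_module R (Fo M) (Fo N)) (Fm M N)"
  using spf unfolding strict_poly_functor_def by blast

lemma Fm_linear:
  assumes "M \<in> proj_modules R" "N \<in> proj_modules R" "h \<in> carrier (schur_hom R s M N)"
  shows "linear_map R (Fo M) (Fo N) (Fm M N h)"
  using linear_map_closed[OF linear_Fm[OF assms(1,2)] assms(3)] by (simp add: hom_module_carrier_iff)

lemma Fm_id: "M \<in> proj_modules R \<Longrightarrow> x \<in> carrier (Fo M) \<Longrightarrow> Fm M M (id_mor (T M)) x = x"
  using spf unfolding strict_poly_functor_def by simp

lemma Fm_compose:
  assumes "L \<in> proj_modules R" "M \<in> proj_modules R" "N \<in> proj_modules R"
    and "f \<in> carrier (schur_hom R s L M)" "g \<in> carrier (schur_hom R s M N)" "x \<in> carrier (Fo L)"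
  shows "Fm L N (compose (carrier (T L)) g f) x = Fm M N g (Fm L M f x)"
proof -
  have "Fm L N (compose (carrier (T L)) g f) = compose (carrier (Fo L)) (Fm M N g) (Fm L M f)"
    using spf assms(1-5) unfolding strict_poly_functor_def by blast
  then show ?thesis using assms(6) by (simp add: compose_eq)
qed

lemma Fm_smult:
  assumes "M \<in> proj_modules R" "N \<in> proj_modules R" "h \<in> carrier (schur_hom R s M N)"
    and "a \<in> carrier R" "x \<in> carrier (Fo M)"
  shows "Fm M N (a \<odot>\<^bsub>hom_module R (T M) (T N)\<^esub> h) x = a \<odot>\<^bsub>Fo N\<^esub> Fm M N h x"
proof -
  have "a \<odot>\<^bsub>hom_module R (T M) (T N)\<^esub> h = a \<odot>\<^bsub>schur_hom R s M N\<^esub> h" by (simp add: schur_hom_def)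
  then show ?thesis
    using linear_map_smult[OF linear_Fm[OF assms(1,2)] assms(4,3)] assms(5) by (simp add: hom_module_def)
qed

lemma Fm_add:
  assumes "M \<in> proj_modules R" "N \<in> proj_modules R"
    and "h \<in> carrier (schur_hom R s M N)" "h' \<in> carrier (schur_hom R s M N)" "x \<in> carrier (Fo M)"
  shows "Fm M N (h \<oplus>\<^bsub>schur_hom R s M N\<^esub> h') x = Fm M N h x \<oplus>\<^bsub>Fo N\<^esub> Fm M N h' x"
  using linear_map_add[OF linear_Fm[OF assms(1,2)] assms(3,4)] assms(5) by (simp add: hom_module_def)

lemma schur_hom_sub_hom: "h \<in> carrier (schur_hom R s M N) \<Longrightarrow> h \<in> carrier (hom_module R (T M) (T N))"
  by (simp add: schur_hom_def)

lemma module_hom_tensor: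
  "M \<in> proj_modules R \<Longrightarrow> N \<in> proj_modules R \<Longrightarrow> module R (hom_module R (T M) (T N))"
  by (intro module_hom_module module_tensor_power proj_modules_module)

lemma Fm_add_pow:
  assumes "M \<in> proj_modules R" "N \<in> proj_modules R" "h \<in> carrier (schur_hom R s M N)" "x \<in> carrier (Fo M)"
  shows "Fm M N (add_pow (hom_module R (T M) (T N)) (n::nat) h) x = add_pow (Fo N) n (Fm M N h x)"
proof -
  interpret H: module R "hom_module R (T M) (T N)" by (rule module_hom_tensor[OF assms(1,2)])
  interpret N: module R "Fo N" by (rule module_Fo[OF assms(2)])
  show ?thesis
    unfolding H.add_pow_eq_smult[OF schur_hom_sub_hom[OF assms(3)]]
      N.add_pow_eq_smult[OF linear_map_closed[OF Fm_linear[OF assms(1-3)] assms(4)]]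
    by (rule Fm_smult[OF assms(1-3) _ assms(4)]) simp
qed

text \<open>The zero map is 0 times an equivariant map, so compatibility with scalars suffices; the
  tensor power of the zero map serves as that equivariant map.\<close>

lemma Fm_zero:
  assumes M: "M \<in> proj_modules R" and N: "N \<in> proj_modules R" and x: "x \<in> carrier (Fo M)"
  shows "Fm M N \<zero>\<^bsub>schur_hom R s M N\<^esub> x = \<zero>\<^bsub>Fo N\<^esub>"
proof -
  interpret H: module R "hom_module R (T M) (T N)" by (rule module_hom_tensor[OF M N])
  interpret N: module R "Fo N" by (rule module_Fo[OF N])
  let ?h = "tensor_map R s M N (\<lambda>_. \<zero>\<^bsub>N\<^esub>)"
  have h: "?h \<in> carrier (schur_hom R s M N)"
    by (intro tensor_map_mem_schur_hom linear_map_zero_fun proj_modules_module M N)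
  have "\<zero>\<^bsub>schur_hom R s M N\<^esub> = \<zero>\<^bsub>hom_module R (T M) (T N)\<^esub>" by (simp add: schur_hom_def)
  also have "\<dots> = \<zero>\<^bsub>R\<^esub> \<odot>\<^bsub>hom_module R (T M) (T N)\<^esub> ?h" using schur_hom_sub_hom[OF h] by simp
  finally have "Fm M N \<zero>\<^bsub>schur_hom R s M N\<^esub> x = \<zero>\<^bsub>R\<^esub> \<odot>\<^bsub>Fo N\<^esub> Fm M N ?h x"
    using Fm_smult[OF M N h _ x, of "\<zero>\<^bsub>R\<^esub>"] by simp
  also have "\<dots> = \<zero>\<^bsub>Fo N\<^esub>" using linear_map_closed[OF Fm_linear[OF M N h] x] by simp
  finally show ?thesis .
qed

text \<open>For \<open>S = weighted s k \<nu>\<close> this is the action of F on the operator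
  written T with index \<nu> in the overview.\<close>

definition Fs :: "'a seq_module \<Rightarrow> 'a seq_module \<Rightarrow> (nat \<Rightarrow> nat) set \<Rightarrow>
    (nat \<Rightarrow> (nat \<Rightarrow> 'a) \<Rightarrow> nat \<Rightarrow> 'a) \<Rightarrow> 'v \<Rightarrow> 'v" where
  "Fs M N S \<phi> = Fm M N (tensor_sum R s M N S \<phi>)"

lemma Fs_linear:
  assumes "M \<in> proj_modules R" "N \<in> proj_modules R" "\<And>j. linear_map R M N (\<phi> j)" "permutation_invariant s S"
  shows "linear_map R (Fo M) (Fo N) (Fs M N S \<phi>)"
  unfolding Fs_def
  by (rule Fm_linear[OF assms(1,2) tensor_sum_mem_schur_hom[OF proj_modules_module[OF assms(1)]
          proj_modules_module[OF assms(2)] assms(3,4)]])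

lemma Gm_linear:
  assumes "M \<in> proj_modules R" "N \<in> proj_modules R" "linear_map R M N g"
  shows "linear_map R (Fo M) (Fo N) (Gm M N g)"
  unfolding underlying_mor_def
  by (rule Fm_linear[OF assms(1,2) tensor_map_mem_schur_hom[OF proj_modules_module[OF assms(1)]
          proj_modules_module[OF assms(2)] assms(3)]])

lemma Gm_eq_Fs:
  assumes "M \<in> proj_modules R" "N \<in> proj_modules R" "linear_map R M N g"
  shows "Gm M N g = Fs M N {\<lambda>i\<in>{..<s}. 0} (\<lambda>_. g)"
  unfolding underlying_mor_def Fs_def
    tensor_map_eq_tensor_sum[OF proj_modules_module[OF assms(1)] proj_modules_module[OF assms(2)] assms(3)] ..

lemma Gm_Fs:
  assumes L: "L \<in> proj_modules R" and M: "M \<in> proj_modules R" and N: "N \<in> proj_modules R"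
    and \<phi>: "\<And>j. linear_map R L M (\<phi> j)" and S: "permutation_invariant s S"
    and g: "linear_map R M N g" and x: "x \<in> carrier (Fo L)"
  shows "Gm M N g (Fs L M S \<phi> x) = Fs L N S (\<lambda>j x. g (\<phi> j x)) x"
proof -
  note mL = proj_modules_module[OF L] and mM = proj_modules_module[OF M] and mN = proj_modules_module[OF N]
  show ?thesis
    unfolding underlying_mor_def Fs_def tensor_map_compose_tensor_sum[OF mL mM mN \<phi> g, symmetric]
    by (rule Fm_compose[OF L M N tensor_sum_mem_schur_hom[OF mL mM \<phi> S] tensor_map_mem_schur_hom[OF mM mN g] x, symmetric])
qed

lemma Fs_Gm:
  assumes L: "L \<in> proj_modules R" and M: "M \<in> proj_modules R" and N: "N \<in> proj_modules R"
    and \<phi>: "\<And>j. linear_map R M N (\<phi> j)" and S: "permutation_invariant s S"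
    and g: "linear_map R L M g" and x: "x \<in> carrier (Fo L)"
  shows "Fs M N S \<phi> (Gm L M g x) = Fs L N S (\<lambda>j x. \<phi> j (g x)) x"
proof -
  note mL = proj_modules_module[OF L] and mM = proj_modules_module[OF M] and mN = proj_modules_module[OF N]
  show ?thesis
    unfolding underlying_mor_def Fs_def tensor_sum_compose_tensor_map[OF mL mM mN \<phi> g, symmetric]
    by (rule Fm_compose[OF L M N tensor_map_mem_schur_hom[OF mL mM g] tensor_sum_mem_schur_hom[OF mM mN \<phi> S] x, symmetric])
qed

lemma Fs_cong:
  assumes "M \<in> proj_modules R" "N \<in> proj_modules R"
    and "\<And>j. linear_map R M N (\<phi> j)" "\<And>j. linear_map R M N (\<psi> j)"
    and "\<And>f i x. f \<in> S \<Longrightarrow> i < s \<Longrightarrow> x \<in> carrier M \<Longrightarrow> \<phi> (f i) x = \<psi> (f i) x"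
  shows "Fs M N S \<phi> = Fs M N S \<psi>"
proof -
  have "tensor_sum R s M N S \<phi> = tensor_sum R s M N S \<psi>"
    by (rule tensor_sum_cong) (use assms proj_modules_module in auto)
  then show ?thesis by (simp add: Fs_def)
qed

lemma Fs_eq_zero:
  assumes "M \<in> proj_modules R" "N \<in> proj_modules R" "\<And>j. linear_map R M N (\<phi> j)" "x \<in> carrier (Fo M)"
    and "\<And>f. f \<in> S \<Longrightarrow> \<exists>i<s. \<forall>x\<in>carrier M. \<phi> (f i) x = \<zero>\<^bsub>N\<^esub>"
  shows "Fs M N S \<phi> x = \<zero>\<^bsub>Fo N\<^esub>"
  unfolding Fs_def
  by (simp only: tensor_sum_eq_zero[OF proj_modules_module[OF assms(1)] proj_modules_module[OF assms(2)] assms(3,5)]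
      Fm_zero[OF assms(1,2,4)])

text \<open>Positivity of \<open>s\<close> matters: it provides a factor that vanishes, whereas the
  tensor power of exponent 0 of the zero map would be the identity.\<close>

lemma Gm_zero:
  assumes "M \<in> proj_modules R" "N \<in> proj_modules R" "linear_map R M N g"
    and "\<And>x. x \<in> carrier M \<Longrightarrow> g x = \<zero>\<^bsub>N\<^esub>" "x \<in> carrier (Fo M)"
  shows "Gm M N g x = \<zero>\<^bsub>Fo N\<^esub>"
  unfolding Gm_eq_Fs[OF assms(1-3)]
  by (rule Fs_eq_zero[OF assms(1-3,5)]) (use assms(4) s_pos in auto)

section \<open>Cross effects and the maps that define them\<close>

lemma linear_map_proj_fst: "module R X \<Longrightarrow> module R Y \<Longrightarrow> linear_map R (dsum X Y) X (proj_fst X Y)"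
  and linear_map_proj_snd: "module R X \<Longrightarrow> module R Y \<Longrightarrow> linear_map R (dsum X Y) Y (proj_snd X Y)"
  by (rule linear_map_cong[OF linear_map_evens module_dsum], auto simp: proj_fst_def)
    (rule linear_map_cong[OF linear_map_odds module_dsum], auto simp: proj_snd_def)

lemma linear_map_map_ids_fst:
  assumes "X \<in> proj_modules R" "Y \<in> proj_modules R" "set Ys \<subseteq> proj_modules R"
  shows "linear_map R (dsum_list (dsum X Y) Ys) (dsum_list X Ys) (map_ids (dsum X Y) (proj_fst X Y) Ys)"
  by (rule linear_map_map_ids) (use assms in \<open>auto intro!: linear_map_proj_fst dsum_mem_proj_modules one_not_zero proj_modules_module\<close>)

lemma linear_map_map_ids_snd:
  assumes "X \<in> proj_modules R" "Y \<in> proj_modules R" "set Ys \<subseteq> proj_modules R"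
  shows "linear_map R (dsum_list (dsum X Y) Ys) (dsum_list Y Ys) (map_ids (dsum X Y) (proj_snd X Y) Ys)"
  by (rule linear_map_map_ids) (use assms in \<open>auto intro!: linear_map_proj_snd dsum_mem_proj_modules one_not_zero proj_modules_module\<close>)

lemma linear_map_to_zero_mod:
  assumes "X \<in> proj_modules R"
  shows "linear_map R X (zero_mod R) (\<lambda>u\<in>carrier X. \<zero>\<^bsub>zero_mod R\<^esub>)"
  by (rule linear_map_cong[OF linear_map_zero_fun])
    (use assms zero_mod_mem_proj_modules[OF cring] in \<open>auto intro: proj_modules_module\<close>)

lemma cross_effect_subset:
  "cross_effect R Fo Gm X Ys \<subseteq> carrier (Fo (dsum_list X Ys))"
  by (induction Ys arbitrary: X) (auto simp: dsum_list_Cons)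

lemma zero_mem_cross_effect:
  assumes "X \<in> proj_modules R" "set Ys \<subseteq> proj_modules R"
  shows "\<zero>\<^bsub>Fo (dsum_list X Ys)\<^esub> \<in> cross_effect R Fo Gm X Ys"
  using assms
proof (induction Ys arbitrary: X)
  case Nil
  have Z: "zero_mod R \<in> proj_modules R" by (rule zero_mod_mem_proj_modules[OF cring])
  interpret X: module R "Fo X" by (rule module_Fo) (use Nil in simp)
  show ?case
    using linear_map_zero[OF module_Fo module_Fo Gm_linear[OF _ Z linear_map_to_zero_mod]] Nil Z by simp
next
  case (Cons Y Ys)
  then have Y: "Y \<in> proj_modules R" and Ys: "set Ys \<subseteq> proj_modules R" by auto
  note mem = dsum_list_mem_proj_modules[OF one_not_zero _ Ys] dsum_mem_proj_modules[OF one_not_zero Cons.prems(1) Y]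
  have D: "dsum_list (dsum X Y) Ys \<in> proj_modules R" by (intro mem)
  have "Gm (dsum_list (dsum X Y) Ys) (dsum_list X Ys) (map_ids (dsum X Y) (proj_fst X Y) Ys)
      \<zero>\<^bsub>Fo (dsum_list (dsum X Y) Ys)\<^esub> = \<zero>\<^bsub>Fo (dsum_list X Ys)\<^esub>"
    by (rule linear_map_zero[OF module_Fo module_Fo Gm_linear])
      (intro D mem(1) Cons.prems(1) linear_map_map_ids_fst Y Ys)+
  moreover have "Gm (dsum_list (dsum X Y) Ys) (dsum_list Y Ys) (map_ids (dsum X Y) (proj_snd X Y) Ys)
      \<zero>\<^bsub>Fo (dsum_list (dsum X Y) Ys)\<^esub> = \<zero>\<^bsub>Fo (dsum_list Y Ys)\<^esub>"
    by (rule linear_map_zero[OF module_Fo module_Fo Gm_linear])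
      (intro D mem(1) Cons.prems(1) linear_map_map_ids_snd Y Ys)+
  ultimately show ?case using Cons.IH[OF mem(2) Ys] by (simp add: dsum_list_Cons)
qed

lemma vanishes_iff:
  "vanishes k \<longleftrightarrow> (\<forall>X Ys x. X \<in> proj_modules R \<longrightarrow> set Ys \<subseteq> proj_modules R \<longrightarrow> Suc (length Ys) = k \<longrightarrow>
    x \<in> cross_effect R Fo Gm X Ys \<longrightarrow> x = \<zero>\<^bsub>Fo (dsum_list X Ys)\<^esub>)"
  unfolding cross_effect_vanishes_def using zero_mem_cross_effect by auto

text \<open>By its recursive definition, a cross effect of order \<open>k + 1\<close> is contained
  in one of order \<open>k\<close>, taken with the first two arguments merged.\<close>

lemma vanishes_Suc:
  assumes "vanishes k" "k > 0"
  shows "vanishes (Suc k)"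
  unfolding vanishes_iff
proof (intro allI impI)
  fix X Ys x
  assume X: "X \<in> proj_modules R" and Ys: "set Ys \<subseteq> proj_modules R" "Suc (length Ys) = Suc k"
    and x: "x \<in> cross_effect R Fo Gm X Ys"
  obtain Y Zs where YZ: "Ys = Y # Zs" using Ys(2) assms(2) by (cases Ys) auto
  then have "dsum X Y \<in> proj_modules R" "set Zs \<subseteq> proj_modules R" "Suc (length Zs) = k"
      "x \<in> cross_effect R Fo Gm (dsum X Y) Zs"
    using X Ys x dsum_mem_proj_modules[OF one_not_zero] by auto
  then show "x = \<zero>\<^bsub>Fo (dsum_list X Ys)\<^esub>"
    using assms(1) unfolding vanishes_iff YZ dsum_list_Cons by blast
qed

text \<open>Hypothesis \<open>hit\<close> asks that for every component \<open>i\<close>, each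
  \<open>f\<close> has a position whose map lands in component \<open>i\<close> alone. A projection
  that forgets component \<open>i\<close> kills this factor and with it the whole term, and the
  cross effect is cut out by such projections.\<close>

lemma Fs_mem_cross_effect:
  assumes M: "M \<in> proj_modules R" and S: "permutation_invariant s S" and y: "y \<in> carrier (Fo M)"
    and X: "X \<in> proj_modules R" and Ys: "set Ys \<subseteq> proj_modules R"
    and u: "\<And>j i. i \<le> length Ys \<Longrightarrow> linear_map R M ((X # Ys) ! i) (u j i)"
    and hit: "\<And>i f. i \<le> length Ys \<Longrightarrow> f \<in> S \<Longrightarrow>
      \<exists>t<s. \<forall>i'\<le>length Ys. i' \<noteq> i \<longrightarrow> (\<forall>a\<in>carrier M. u (f t) i' a = \<zero>\<^bsub>(X # Ys) ! i'\<^esub>)"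
  shows "Fs M (dsum_list X Ys) S (\<lambda>j a. tuple (length Ys) (\<lambda>i. u j i a)) y \<in> cross_effect R Fo Gm X Ys"
  using X Ys u hit
proof (induction Ys arbitrary: X u)
  case Nil
  have Z: "zero_mod R \<in> proj_modules R" by (rule zero_mod_mem_proj_modules[OF cring])
  have u: "linear_map R M X (u j 0)" for j using Nil.prems(3)[of 0 j] by simp
  have u': "linear_map R M X (\<lambda>a. tuple (length []) (\<lambda>i. u j i a))" for j using u by simp
  let ?z = "\<lambda>u\<in>carrier X. \<zero>\<^bsub>zero_mod R\<^esub>"
  have "Fs M X S (\<lambda>j a. tuple (length []) (\<lambda>i. u j i a)) y \<in> carrier (Fo X)"
    by (rule linear_map_closed[OF Fs_linear[OF M Nil.prems(1) u' S] y])
  moreover have "Gm X (zero_mod R) ?z (Fs M X S (\<lambda>j a. tuple (length []) (\<lambda>i. u j i a)) y) = \<zero>\<^bsub>Fo (zero_mod R)\<^esub>"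
    unfolding Gm_Fs[OF M Nil.prems(1) Z u' S linear_map_to_zero_mod[OF Nil.prems(1)] y]
  proof (rule Fs_eq_zero[OF M Z linear_map_comp[OF u' linear_map_to_zero_mod[OF Nil.prems(1)]] y])
    show "\<exists>i<s. \<forall>x\<in>carrier M. ?z (tuple (length []) (\<lambda>k. u (f i) k x)) = \<zero>\<^bsub>zero_mod R\<^esub>" for f
      using s_pos linear_map_closed[OF u] by (intro exI[of _ 0]) simp
  qed
  ultimately show ?case by simp
next
  case (Cons Y Ys)
  have X: "X \<in> proj_modules R" and Y: "Y \<in> proj_modules R" and Ys: "set Ys \<subseteq> proj_modules R"
    using Cons.prems by auto
  let ?n = "length Ys"
  let ?D = "dsum_list (dsum X Y) Ys"
  have XY: "dsum X Y \<in> proj_modules R" by (rule dsum_mem_proj_modules[OF one_not_zero X Y])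
  have D: "?D \<in> proj_modules R" by (rule dsum_list_mem_proj_modules[OF one_not_zero XY Ys])
  have DX: "dsum_list X Ys \<in> proj_modules R" by (rule dsum_list_mem_proj_modules[OF one_not_zero X Ys])
  have DY: "dsum_list Y Ys \<in> proj_modules R" by (rule dsum_list_mem_proj_modules[OF one_not_zero Y Ys])
  have u0: "linear_map R M X (u j 0)" and u1: "linear_map R M Y (u j 1)"
    and u2: "i < ?n \<Longrightarrow> linear_map R M (Ys ! i) (u j (Suc (Suc i)))" for j i
    using Cons.prems(3)[of 0 j] Cons.prems(3)[of 1 j] Cons.prems(3)[of "Suc (Suc i)" j] by auto
  \<comment> \<open>The same maps, regarded as going into the sum with the first two components
    merged.\<close>
  define v where "v j i a = (if i = 0 then interleave (u j 0 a) (u j 1 a) else u j (Suc i) a)" for j i a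
  have v: "linear_map R M ((dsum X Y # Ys) ! i) (v j i)" if "i \<le> ?n" for j i
  proof (cases i)
    case 0
    then show ?thesis using linear_map_interleave[OF u0 u1] by (simp add: v_def[abs_def])
  next
    case (Suc k)
    then show ?thesis using u2[of k] that by (simp add: v_def[abs_def])
  qed
  have tuple_u: "tuple (length (Y # Ys)) (\<lambda>i. u j i a) = tuple ?n (\<lambda>i. v j i a)" for j a
    using tuple_shift[of ?n "\<lambda>i. u j i a"] by (simp only: v_def[abs_def] length_Cons)
  let ?\<psi> = "\<lambda>j a. tuple ?n (\<lambda>i. v j i a)"
  have \<psi>: "linear_map R M ?D (?\<psi> j)" for j by (rule linear_map_tuple[OF v])
  let ?x = "Fs M ?D S ?\<psi> y"
  \<comment> \<open>If \<open>u j\<close> lands in component \<open>i\<close> alone, then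
    \<open>v j\<close> lands in component 0 when i \<le> 1, and in component i - 1
    otherwise.\<close>
  have vz: "\<forall>a\<in>carrier M. v j i' a = \<zero>\<^bsub>(dsum X Y # Ys) ! i'\<^esub>"
    if "\<forall>i'\<le>length (Y # Ys). i' \<noteq> i \<longrightarrow> (\<forall>a\<in>carrier M. u j i' a = \<zero>\<^bsub>(X # Y # Ys) ! i'\<^esub>)"
      "i' \<le> ?n" "i' = 0 \<longrightarrow> i > 1" "i' > 0 \<longrightarrow> Suc i' \<noteq> i" for j i i'
  proof (cases i')
    case 0
    then have "i \<noteq> 0" "i \<noteq> 1" using that(3) by auto
    then show ?thesis using that(1)[rule_format, of 0] that(1)[rule_format, of 1] 0
      by (simp add: v_def dsum_simps)
  next
    case (Suc k)
    then show ?thesis using that(1)[rule_format, of "Suc i'"] that(2,4) by (simp add: v_def)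
  qed
  have in1: "?x \<in> cross_effect R Fo Gm (dsum X Y) Ys"
  proof (rule Cons.IH[OF XY Ys v])
    fix i f assume i: "i \<le> ?n" and f: "f \<in> S"
    \<comment> \<open>Either of the old components 0 and 1 would do for the merged component 0; the
      choice is 0.\<close>
    let ?i = "if i = 0 then 0 else Suc i"
    have "?i \<le> length (Y # Ys)" using i by simp
    from Cons.prems(4)[OF this f] obtain t where t: "t < s"
      "\<forall>i'\<le>length (Y # Ys). i' \<noteq> ?i \<longrightarrow> (\<forall>a\<in>carrier M. u (f t) i' a = \<zero>\<^bsub>(X # Y # Ys) ! i'\<^esub>)"
      by blast
    have "\<forall>a\<in>carrier M. v (f t) i' a = \<zero>\<^bsub>(dsum X Y # Ys) ! i'\<^esub>" if "i' \<le> ?n" "i' \<noteq> i" for i'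
      by (rule vz[OF t(2) that(1)]) (use that(2) in auto)
    then show "\<exists>t<s. \<forall>i'\<le>?n. i' \<noteq> i \<longrightarrow> (\<forall>a\<in>carrier M. v (f t) i' a = \<zero>\<^bsub>(dsum X Y # Ys) ! i'\<^esub>)"
      using t(1) by blast
  qed
  have vmem: "v j 0 a \<in> carrier (dsum X Y)" "i < ?n \<Longrightarrow> v j (Suc i) a \<in> carrier (Ys ! i)"
    if "a \<in> carrier M" for j a i
    using linear_map_closed[OF v[of 0 j] that] linear_map_closed[OF v[of "Suc i" j] that] by auto
  have kill: "map_ids (dsum X Y) q Ys (?\<psi> j a) = \<zero>\<^bsub>dsum_list W Ys\<^esub>"
    if "a \<in> carrier M" "q (v j 0 a) = \<zero>\<^bsub>W\<^esub>" "\<And>i. i < ?n \<Longrightarrow> v j (Suc i) a = \<zero>\<^bsub>Ys ! i\<^esub>" for q W j a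
  proof -
    have "map_ids (dsum X Y) q Ys (?\<psi> j a) = tuple ?n ((\<lambda>i. v j i a)(0 := q (v j 0 a)))"
      by (rule map_ids_tuple) (use vmem[OF that(1)] in auto)
    also have "\<dots> = tuple ?n (\<lambda>i. \<zero>\<^bsub>(W # Ys) ! i\<^esub>)"
      by (rule tuple_cong) (use that(2,3) in \<open>auto simp: nth_Cons split: nat.split\<close>)
    finally show ?thesis by (simp only: tuple_zero)
  qed
  \<comment> \<open>Projecting to \<open>X\<close> forgets component 1, so the position provided by
    \<open>hit\<close> for component 1 is the one that dies.\<close>
  have fst: "Gm ?D (dsum_list X Ys) (map_ids (dsum X Y) (proj_fst X Y) Ys) ?x = \<zero>\<^bsub>Fo (dsum_list X Ys)\<^esub>"
    unfolding Gm_Fs[OF M D DX \<psi> S linear_map_map_ids_fst[OF X Y Ys] y]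
  proof (rule Fs_eq_zero[OF M DX linear_map_comp[OF \<psi> linear_map_map_ids_fst[OF X Y Ys]] y])
    fix f assume f: "f \<in> S"
    have "(1::nat) \<le> length (Y # Ys)" by simp
    from Cons.prems(4)[OF this f] obtain t where t: "t < s"
      "\<forall>i'\<le>length (Y # Ys). i' \<noteq> 1 \<longrightarrow> (\<forall>a\<in>carrier M. u (f t) i' a = \<zero>\<^bsub>(X # Y # Ys) ! i'\<^esub>)"
      by blast
    have "map_ids (dsum X Y) (proj_fst X Y) Ys (?\<psi> (f t) a) = \<zero>\<^bsub>dsum_list X Ys\<^esub>" if a: "a \<in> carrier M" for a
    proof (rule kill[OF a])
      show "proj_fst X Y (v (f t) 0 a) = \<zero>\<^bsub>X\<^esub>"
        using t(2)[rule_format, of 0 a] a vmem(1)[OF a, of "f t"] by (simp add: proj_fst_def v_def)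
      show "v (f t) (Suc i) a = \<zero>\<^bsub>Ys ! i\<^esub>" if "i < ?n" for i
        using t(2)[rule_format, of "Suc (Suc i)" a] a that by (simp add: v_def)
    qed
    then show "\<exists>t<s. \<forall>a\<in>carrier M. map_ids (dsum X Y) (proj_fst X Y) Ys (?\<psi> (f t) a) = \<zero>\<^bsub>dsum_list X Ys\<^esub>"
      using t(1) by blast
  qed
  \<comment> \<open>Symmetrically, projecting to \<open>Y\<close> forgets component 0.\<close>
  have snd: "Gm ?D (dsum_list Y Ys) (map_ids (dsum X Y) (proj_snd X Y) Ys) ?x = \<zero>\<^bsub>Fo (dsum_list Y Ys)\<^esub>"
    unfolding Gm_Fs[OF M D DY \<psi> S linear_map_map_ids_snd[OF X Y Ys] y]
  proof (rule Fs_eq_zero[OF M DY linear_map_comp[OF \<psi> linear_map_map_ids_snd[OF X Y Ys]] y])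
    fix f assume f: "f \<in> S"
    have "(0::nat) \<le> length (Y # Ys)" by simp
    from Cons.prems(4)[OF this f] obtain t where t: "t < s"
      "\<forall>i'\<le>length (Y # Ys). i' \<noteq> 0 \<longrightarrow> (\<forall>a\<in>carrier M. u (f t) i' a = \<zero>\<^bsub>(X # Y # Ys) ! i'\<^esub>)"
      by blast
    have "map_ids (dsum X Y) (proj_snd X Y) Ys (?\<psi> (f t) a) = \<zero>\<^bsub>dsum_list Y Ys\<^esub>" if a: "a \<in> carrier M" for a
    proof (rule kill[OF a])
      show "proj_snd X Y (v (f t) 0 a) = \<zero>\<^bsub>Y\<^esub>"
        using t(2)[rule_format, of 1 a] a vmem(1)[OF a, of "f t"] by (simp add: proj_snd_def v_def)
      show "v (f t) (Suc i) a = \<zero>\<^bsub>Ys ! i\<^esub>" if "i < ?n" for i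
        using t(2)[rule_format, of "Suc (Suc i)" a] a that by (simp add: v_def)
    qed
    then show "\<exists>t<s. \<forall>a\<in>carrier M. map_ids (dsum X Y) (proj_snd X Y) Ys (?\<psi> (f t) a) = \<zero>\<^bsub>dsum_list Y Ys\<^esub>"
      using t(1) by blast
  qed
  show ?case unfolding tuple_u dsum_list_Cons using in1 fst snd by simp
qed

text \<open>The factorization: each \<phi> j is diverted into the j-th summand of the k-fold sum of
  \<open>M\<close>, and the codiagonal adds the summands up again. Positive parts mean that every
  index occurs in every \<open>f\<close>, so the diverted operator has values in the cross effect,
  which is zero.\<close>

lemma Fs_weighted_eq_zero:
  assumes van: "vanishes k" and k: "k > 0" and M: "M \<in> proj_modules R"
    and \<phi>: "\<And>j. linear_map R M M (\<phi> j)" and \<nu>: "\<And>j. j < k \<Longrightarrow> \<nu> j > 0" and y: "y \<in> carrier (Fo M)"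
  shows "Fs M M (weighted s k \<nu>) \<phi> y = \<zero>\<^bsub>Fo M\<^esub>"
proof -
  define n where "n = k - 1"
  have k: "k = Suc n" using k by (simp add: n_def)
  let ?Ys = "replicate n M"
  let ?D = "dsum_list M ?Ys"
  let ?S = "weighted s k \<nu>"
  have nth: "(M # ?Ys) ! i = M" if "i \<le> n" for i using that by (cases i) auto
  have Ys: "set ?Ys \<subseteq> proj_modules R" using M by auto
  have D: "?D \<in> proj_modules R" by (rule dsum_list_mem_proj_modules[OF one_not_zero M Ys])
  note mM = proj_modules_module[OF M] and mD = proj_modules_module[OF D]
  interpret M: module R M by (rule mM)
  have S: "permutation_invariant s ?S" by (rule permutation_invariant_weighted)
  \<comment> \<open>For j \<ge> k every component is zero; such indices are never values of a member
    of \<open>?S\<close>.\<close>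
  define u where "u j i = (if i = j then \<phi> j else (\<lambda>_. \<zero>\<^bsub>M\<^esub>))" for j i :: nat
  have u: "linear_map R M M (u j i)" for j i
    using \<phi> linear_map_zero_fun[OF mM, of M] by (simp add: u_def)
  have u': "linear_map R M ((M # ?Ys) ! i) (u j i)" if "i \<le> length ?Ys" for j i
    using u nth[of i] that by simp
  let ?\<psi> = "\<lambda>j a. tuple (length ?Ys) (\<lambda>i. u j i a)"
  have \<psi>: "linear_map R M ?D (?\<psi> j)" for j by (rule linear_map_tuple[OF u'])
  have "Fs M ?D ?S ?\<psi> y \<in> cross_effect R Fo Gm M ?Ys"
  proof (rule Fs_mem_cross_effect[OF M S y M Ys u'])
    fix i f assume i: "i \<le> length ?Ys" and f: "f \<in> ?S"
    have "card {t. t < s \<and> f t = i} = \<nu> i" using f i k by (auto simp: weighted_def)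
    then have "card {t. t < s \<and> f t = i} > 0" using \<nu>[of i] i k by simp
    then obtain t where t: "t < s" "f t = i" by (fastforce simp: card_gt_0_iff)
    have "u (f t) i' a = \<zero>\<^bsub>(M # ?Ys) ! i'\<^esub>" if "i' \<le> length ?Ys" "i' \<noteq> i" for i' a
      using that t nth[of i'] by (simp add: u_def)
    then show "\<exists>t<s. \<forall>i'\<le>length ?Ys. i' \<noteq> i \<longrightarrow> (\<forall>a\<in>carrier M. u (f t) i' a = \<zero>\<^bsub>(M # ?Ys) ! i'\<^esub>)"
      using t by blast
  qed
  then have zero: "Fs M ?D ?S ?\<psi> y = \<zero>\<^bsub>Fo ?D\<^esub>"
    using van M Ys unfolding vanishes_iff k by simp
  let ?codiag = "\<lambda>d. \<Oplus>\<^bsub>M\<^esub>i\<in>{..n}. coord n i d"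
  have codiag: "linear_map R ?D M ?codiag"
  proof (rule linear_map_sum_fun[OF mM])
    show "linear_map R ?D M (coord n i)" if "i \<in> {..n}" for i
      using linear_map_coord[of i ?Ys R M] nth[of i] that by simp
  qed
  have codiag\<psi>: "?codiag (?\<psi> j a) = \<phi> j a" if "j < k" "a \<in> carrier M" for j a
  proof -
    have "?codiag (?\<psi> j a) = (\<Oplus>\<^bsub>M\<^esub>i\<in>{..n}. if j = i then \<phi> i a else \<zero>\<^bsub>M\<^esub>)"
      by (rule M.M.finsum_cong')
        (use linear_map_closed[OF \<phi>] that in \<open>auto simp: coord_tuple u_def\<close>)
    also have "\<dots> = \<phi> j a"
      by (rule M.M.finsum_singleton) (use linear_map_closed[OF \<phi>] that k in auto)
    finally show ?thesis .
  qed
  have "Fs M M ?S \<phi> = Fs M M ?S (\<lambda>j x. ?codiag (?\<psi> j x))"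
  proof (rule Fs_cong[OF M M \<phi> linear_map_comp[OF \<psi> codiag]])
    fix f i x assume "f \<in> ?S" "i < s" "x \<in> carrier M"
    then show "\<phi> (f i) x = ?codiag (?\<psi> (f i) x)"
      using codiag\<psi>[of "f i" x] by (auto simp: weighted_def PiE_iff)
  qed
  then have "Fs M M ?S \<phi> y = Gm ?D M ?codiag (Fs M ?D ?S ?\<psi> y)"
    by (simp only: Gm_Fs[OF M D M \<psi> S codiag y])
  also have "\<dots> = \<zero>\<^bsub>Fo M\<^esub>"
    unfolding zero by (rule linear_map_zero[OF module_Fo[OF D] module_Fo[OF M] Gm_linear[OF D M codiag]])
  finally show ?thesis .
qed

text \<open>This replaces the projections in the definition of cross effects by endomorphisms of the
  whole sum that treat all components alike and can be composed with the weight operators.\<close>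

definition omit :: "'a seq_module \<Rightarrow> 'a seq_module list \<Rightarrow> nat \<Rightarrow> (nat \<Rightarrow> 'a) \<Rightarrow> nat \<Rightarrow> 'a" where
  "omit X Ys i d = tuple (length Ys) (\<lambda>j. if j = i then \<zero>\<^bsub>(X # Ys) ! j\<^esub> else coord (length Ys) j d)"

lemma nth_proj_modules: "X \<in> proj_modules R \<Longrightarrow> set Ys \<subseteq> proj_modules R \<Longrightarrow> i \<le> length Ys \<Longrightarrow> (X # Ys) ! i \<in> proj_modules R"
  by (cases i) auto

lemma omit_linear:
  assumes "X \<in> proj_modules R" "set Ys \<subseteq> proj_modules R"
  shows "linear_map R (dsum_list X Ys) (dsum_list X Ys) (omit X Ys i)"
proof -
  have "linear_map R (dsum_list X Ys) ((X # Ys) ! j) (\<lambda>d. if j = i then \<zero>\<^bsub>(X # Ys) ! j\<^esub> else coord (length Ys) j d)"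
    if "j \<le> length Ys" for j
    using linear_map_coord[OF that, of R X] linear_map_zero_fun[OF proj_modules_module[OF nth_proj_modules[OF assms that]]]
    by (cases "j = i") auto
  from linear_map_tuple[OF this] show ?thesis unfolding omit_def[abs_def] .
qed

lemma Gm_Gm:
  assumes L: "L \<in> proj_modules R" and M: "M \<in> proj_modules R" and N: "N \<in> proj_modules R"
    and f: "linear_map R L M f" and g: "linear_map R M N g" and x: "x \<in> carrier (Fo L)"
  shows "Gm M N g (Gm L M f x) = Gm L N (\<lambda>x. g (f x)) x"
  unfolding Gm_eq_Fs[OF L M f] Gm_eq_Fs[OF L N linear_map_comp[OF f g]]
  by (rule Gm_Fs[OF L M N f permutation_invariant_const g x])

lemma Gm_cong:
  assumes "M \<in> proj_modules R" "N \<in> proj_modules R" "linear_map R M N f" "linear_map R M N g"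
    and "\<And>x. x \<in> carrier M \<Longrightarrow> f x = g x"
  shows "Gm M N f = Gm M N g"
  unfolding Gm_eq_Fs[OF assms(1,2,3)] Gm_eq_Fs[OF assms(1,2,4)]
  by (rule Fs_cong[OF assms(1-4)]) (rule assms(5))

text \<open>For components 0 and 1, dropping the component factors through one of the two
  projections in the last step of the recursion. Any later component is already present, one place
  earlier, in the sum with the first two merged.\<close>

lemma cross_effect_omit:
  assumes "X \<in> proj_modules R" "set Ys \<subseteq> proj_modules R" "x \<in> cross_effect R Fo Gm X Ys" "i \<le> length Ys"
  shows "Gm (dsum_list X Ys) (dsum_list X Ys) (omit X Ys i) x = \<zero>\<^bsub>Fo (dsum_list X Ys)\<^esub>"
  using assms
proof (induction Ys arbitrary: X i)
  case Nil
  then have "Gm X X (omit X [] i) x = \<zero>\<^bsub>Fo X\<^esub>"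
    using omit_linear[of X "[]" i] by (intro Gm_zero) (auto simp: omit_def)
  then show ?case by simp
next
  case (Cons Y Ys)
  have X: "X \<in> proj_modules R" and Y: "Y \<in> proj_modules R" and Ys: "set Ys \<subseteq> proj_modules R"
    using Cons.prems by auto
  let ?n = "length Ys"
  let ?D = "dsum_list (dsum X Y) Ys"
  have XY: "dsum X Y \<in> proj_modules R" by (rule dsum_mem_proj_modules[OF one_not_zero X Y])
  have D: "?D \<in> proj_modules R" by (rule dsum_list_mem_proj_modules[OF one_not_zero XY Ys])
  have o: "linear_map R ?D ?D (omit X (Y # Ys) i)"
    using omit_linear[OF X, of "Y # Ys" i] Cons.prems(2) by (simp only: dsum_list_Cons)
  have x: "x \<in> carrier (Fo ?D)"
    using cross_effect_subset[of "dsum X Y" Ys] Cons.prems(3) by auto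
  have "Gm ?D ?D (omit X (Y # Ys) i) x = \<zero>\<^bsub>Fo ?D\<^esub>"
  proof (cases "i \<le> 1")
    case True
    \<comment> \<open>\<open>W\<close> is the one of the two leading summands that survives, and
      \<open>q\<close> the projection onto it.\<close>
    define W where "W = (if i = 0 then Y else X)"
    define q where "q = (if i = 0 then proj_snd X Y else proj_fst X Y)"
    have W: "W \<in> proj_modules R" using X Y by (simp add: W_def)
    have DW: "dsum_list W Ys \<in> proj_modules R" by (rule dsum_list_mem_proj_modules[OF one_not_zero W Ys])
    let ?h = "map_ids (dsum X Y) q Ys"
    have h: "linear_map R ?D (dsum_list W Ys) ?h"
      using linear_map_map_ids_fst[OF X Y Ys] linear_map_map_ids_snd[OF X Y Ys] by (simp add: W_def q_def)
    have hx: "Gm ?D (dsum_list W Ys) ?h x = \<zero>\<^bsub>Fo (dsum_list W Ys)\<^esub>"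
      using Cons.prems(3) by (simp add: W_def q_def)
    \<comment> \<open>Reinsertion of a zero at place \<open>i\<close>. Truncated subtraction is
      intended: the surviving one of the places 0 and 1 reads coordinate 0 in either case.\<close>
    define r where "r e = tuple (Suc ?n) (\<lambda>j. if j = i then \<zero>\<^bsub>(X # Y # Ys) ! j\<^esub> else coord ?n (j - 1) e)" for e
    have "linear_map R (dsum_list W Ys) ((X # Y # Ys) ! j)
        (\<lambda>e. if j = i then \<zero>\<^bsub>(X # Y # Ys) ! j\<^esub> else coord ?n (j - 1) e)" if j: "j \<le> length (Y # Ys)" for j
    proof (cases "j = i")
      case True
      then show ?thesis
        using linear_map_zero_fun[OF proj_modules_module[OF nth_proj_modules[OF X Cons.prems(2) j]]] by simp
    next
      case False
      have "(W # Ys) ! (j - 1) = (X # Y # Ys) ! j"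
        using False True j by (cases j; cases "j - 1") (auto simp: W_def)
      then show ?thesis using linear_map_coord[of "j - 1" Ys R W] False j by auto
    qed
    from linear_map_tuple[OF this] have r: "linear_map R (dsum_list W Ys) ?D r"
      unfolding r_def[abs_def] dsum_list_Cons by simp
    have rh: "omit X (Y # Ys) i d = r (?h d)" if d: "d \<in> carrier ?D" for d
    proof -
      have cm: "coord ?n j d \<in> carrier ((dsum X Y # Ys) ! j)" if "j \<le> ?n" for j
        by (rule linear_map_closed[OF linear_map_coord[OF that] d])
      have "?h (tuple ?n (\<lambda>j. coord ?n j d)) = tuple ?n ((\<lambda>j. coord ?n j d)(0 := q (coord ?n 0 d)))"
        by (rule map_ids_tuple) (use cm[of 0] cm[of "Suc _"] in auto)
      then have hd: "?h d = tuple ?n ((\<lambda>j. coord ?n j d)(0 := q (coord ?n 0 d)))"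
        by (simp only: tuple_coord)
      have c0: "coord ?n 0 d = interleave (coord (Suc ?n) 0 d) (coord (Suc ?n) 1 d)"
        using coord_shift[of 0 ?n d] by simp
      have "coord ?n 0 d \<in> carrier (dsum X Y)" using cm[of 0] by simp
      then have q0: "q (coord ?n 0 d) = coord (Suc ?n) (if i = 0 then 1 else 0) d"
        unfolding c0 by (simp add: q_def proj_fst_def proj_snd_def del: coord.simps)
      have "tuple (Suc ?n) (\<lambda>j. if j = i then \<zero>\<^bsub>(X # Y # Ys) ! j\<^esub> else coord (Suc ?n) j d) = r (?h d)"
        unfolding r_def hd
      proof (rule tuple_cong)
        fix j assume j: "j \<le> Suc ?n"
        have "coord (Suc ?n) j d = coord ?n (j - 1) (tuple ?n ((\<lambda>j. coord ?n j d)(0 := q (coord ?n 0 d))))"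
          if "j \<noteq> i"
        proof (cases "j - 1 = 0")
          case 1: True
          then show ?thesis using that True q0 by (subst coord_tuple) (auto simp del: coord.simps simp: le_Suc_eq)
        next
          case False
          then show ?thesis using j coord_shift[of "j - 1" ?n d]
            by (subst coord_tuple) (auto simp del: coord.simps)
        qed
        then show "(if j = i then \<zero>\<^bsub>(X # Y # Ys) ! j\<^esub> else coord (Suc ?n) j d) =
            (if j = i then \<zero>\<^bsub>(X # Y # Ys) ! j\<^esub>
              else coord ?n (j - 1) (tuple ?n ((\<lambda>j. coord ?n j d)(0 := q (coord ?n 0 d)))))"
          by simp
      qed
      then show ?thesis by (simp only: omit_def length_Cons)
    qed
    have "Gm ?D ?D (omit X (Y # Ys) i) x = Gm ?D ?D (\<lambda>d. r (?h d)) x"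
      by (simp only: Gm_cong[OF D D o linear_map_comp[OF h r] rh])
    also have "\<dots> = Gm (dsum_list W Ys) ?D r (Gm ?D (dsum_list W Ys) ?h x)"
      by (rule Gm_Gm[OF D DW D h r x, symmetric])
    also have "\<dots> = \<zero>\<^bsub>Fo ?D\<^esub>"
      unfolding hx by (rule linear_map_zero[OF module_Fo[OF DW] module_Fo[OF D] Gm_linear[OF DW D r]])
    finally show ?thesis .
  next
    case False
    have "omit X (Y # Ys) i d = omit (dsum X Y) Ys (i - 1) d" for d
    proof -
      let ?e = "\<lambda>j. if j = i then \<zero>\<^bsub>(X # Y # Ys) ! j\<^esub> else coord (Suc ?n) j d"
      have "omit X (Y # Ys) i d = tuple ?n (\<lambda>j. if j = 0 then interleave (?e 0) (?e 1) else ?e (Suc j))"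
        unfolding omit_def length_Cons by (rule tuple_shift)
      also have "\<dots> = omit (dsum X Y) Ys (i - 1) d"
        unfolding omit_def
      proof (rule tuple_cong)
        fix j assume j: "j \<le> ?n"
        show "(if j = 0 then interleave (?e 0) (?e 1) else ?e (Suc j)) =
            (if j = i - 1 then \<zero>\<^bsub>(dsum X Y # Ys) ! j\<^esub> else coord ?n j d)"
          using False coord_shift[OF j, of d] by (cases j) (auto simp del: coord.simps)
      qed
      finally show ?thesis .
    qed
    then have "omit X (Y # Ys) i = omit (dsum X Y) Ys (i - 1)" by (rule ext)
    then show ?thesis using Cons.IH[OF XY Ys, of "i - 1"] Cons.prems(3,4) by simp
  qed
  then show ?case by (simp only: dsum_list_Cons)
qed

text \<open>The identity is the sum of the weight projectors, so some projector does not kill x. It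
  cannot be one with a zero part at j: its terms never use component j, so it is unchanged by first
  dropping that component, and dropping it kills x.\<close>

lemma exists_weighted_nonzero:
  assumes X: "X \<in> proj_modules R" and Ys: "set Ys \<subseteq> proj_modules R"
    and x: "x \<in> cross_effect R Fo Gm X Ys" "x \<noteq> \<zero>\<^bsub>Fo (dsum_list X Ys)\<^esub>"
    and k: "k = Suc (length Ys)" and D: "D = dsum_list X Ys"
  shows "\<exists>\<phi> \<nu>. (\<forall>j. linear_map R D D (\<phi> j)) \<and> (\<forall>j<k. \<nu> j > 0) \<and> (\<Sum>j<k. \<nu> j) = s \<and>
    Fs D D (weighted s k \<nu>) \<phi> x \<noteq> \<zero>\<^bsub>Fo D\<^esub>"
proof (rule ccontr)
  assume contra: "\<not> ?thesis"
  let ?n = "length Ys"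
  have pD: "D \<in> proj_modules R" unfolding D by (rule dsum_list_mem_proj_modules[OF one_not_zero X Ys])
  note mD = proj_modules_module[OF pD]
  interpret D: module R D by (rule mD)
  interpret FD: module R "Fo D" by (rule module_Fo[OF pD])
  have xc: "x \<in> carrier (Fo D)" using x(1) cross_effect_subset[of X Ys] by (auto simp: D)
  \<comment> \<open>The projectors onto the single components of \<open>D\<close>.\<close>
  define e where "e j d = tuple ?n (\<lambda>i. if i = j then coord ?n i d else \<zero>\<^bsub>(X # Ys) ! i\<^esub>)" for j d
  have "linear_map R D ((X # Ys) ! i) (\<lambda>d. if i = j then coord ?n i d else \<zero>\<^bsub>(X # Ys) ! i\<^esub>)"
    if "i \<le> ?n" for i j
    using linear_map_coord[OF that, of R X] linear_map_zero_fun[OF proj_modules_module[OF nth_proj_modules[OF X Ys that]]]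
    by (cases "i = j") (auto simp: D)
  from linear_map_tuple[OF this] have e: "linear_map R D D (e j)" for j
    unfolding e_def[abs_def] D by simp
  have zero: "Fs D D (weighted s k \<nu>) e x = \<zero>\<^bsub>Fo D\<^esub>" for \<nu>
  proof (cases "\<exists>j<k. \<nu> j = 0")
    case True
    then obtain j where j: "j < k" "\<nu> j = 0" by blast
    have o: "linear_map R D D (omit X Ys j)" unfolding D by (rule omit_linear[OF X Ys])
    have "Fs D D (weighted s k \<nu>) e = Fs D D (weighted s k \<nu>) (\<lambda>i d. e i (omit X Ys j d))"
    proof (rule Fs_cong[OF pD pD e linear_map_comp[OF o e]])
      fix f t d assume f: "f \<in> weighted s k \<nu>" and t: "t < s"
      have "card {i. i < s \<and> f i = j} = 0" using f j by (auto simp: weighted_def)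
      then have "f t \<noteq> j" using t by auto
      then show "e (f t) d = e (f t) (omit X Ys j d)"
        unfolding e_def by (intro tuple_cong) (auto simp: omit_def coord_tuple)
    qed
    then have "Fs D D (weighted s k \<nu>) e x = Fs D D (weighted s k \<nu>) e (Gm D D (omit X Ys j) x)"
      unfolding Fs_Gm[OF pD pD pD e permutation_invariant_weighted o xc] by (rule fun_cong)
    also have "Gm D D (omit X Ys j) x = \<zero>\<^bsub>Fo D\<^esub>"
      unfolding D by (rule cross_effect_omit[OF X Ys x(1)]) (use j k in simp)
    also have "Fs D D (weighted s k \<nu>) e \<zero>\<^bsub>Fo D\<^esub> = \<zero>\<^bsub>Fo D\<^esub>"
      by (rule linear_map_zero[OF FD.module_axioms FD.module_axioms Fs_linear[OF pD pD e permutation_invariant_weighted]])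
    finally show ?thesis .
  next
    case False
    then have pos: "\<forall>j<k. \<nu> j > 0" by auto
    show ?thesis
    proof (cases "(\<Sum>j<k. \<nu> j) = s")
      case True
      then show ?thesis using contra e pos by blast
    next
      case False
      \<comment> \<open>The fibres of a function partition its domain, so their sizes must add up to
        \<open>s\<close>.\<close>
      have "weighted s k \<nu> = {}"
      proof (rule ccontr)
        assume "weighted s k \<nu> \<noteq> {}"
        then obtain f where f: "f \<in> weighted s k \<nu>" by blast
        have "(\<Sum>j<k. \<nu> j) = (\<Sum>j<k. card {i. i < s \<and> f i = j})" using f by (auto simp: weighted_def)
        also have "\<dots> = card (\<Union>j<k. {i. i < s \<and> f i = j})"
          by (rule card_UN_disjoint[symmetric]) auto
        also have "(\<Union>j<k. {i. i < s \<and> f i = j}) = {..<s}" using f by (auto simp: weighted_def PiE_iff)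
        finally show False using False by simp
      qed
      then show ?thesis using Fs_eq_zero[OF pD pD e xc, of "{}"] by simp
    qed
  qed
  let ?A = "{..<s} \<rightarrow>\<^sub>E {..<k}"
  \<comment> \<open>The value 0 from \<open>k\<close> on makes the label unique: different labels
    differ below \<open>k\<close> and therefore describe disjoint sets of functions.\<close>
  let ?type = "\<lambda>f j. if j < k then card {i. i < s \<and> f i = j} else 0"
  have A: "finite ?A" by (simp add: finite_PiE)
  have UN: "(\<Union>\<nu>\<in>?type ` ?A. weighted s k \<nu>) = ?A"
    by (auto simp: weighted_def)
  have "Fs D D (\<Union>\<nu>\<in>C. weighted s k \<nu>) e x = \<zero>\<^bsub>Fo D\<^esub>" if "finite C" "C \<subseteq> ?type ` ?A" for C
    using that
  proof (induction C rule: finite_induct)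
    case empty
    then show ?case using Fs_eq_zero[OF pD pD e xc, of "{}"] by simp
  next
    case (insert \<nu> C)
    have "weighted s k \<nu> \<inter> weighted s k \<nu>' = {}" if "\<nu>' \<in> C" for \<nu>'
    proof -
      have "\<nu> \<noteq> \<nu>'" using insert that by blast
      then obtain j where "\<nu> j \<noteq> \<nu>' j" by blast
      moreover have "\<nu> j = 0 \<and> \<nu>' j = 0" if "\<not> j < k" for j
        using insert.prems \<open>\<nu>' \<in> C\<close> that by auto
      ultimately show ?thesis by (cases "j < k") (auto simp: weighted_def)
    qed
    then have disj: "weighted s k \<nu> \<inter> (\<Union>\<nu>\<in>C. weighted s k \<nu>) = {}" by blast
    have fin: "finite (\<Union>\<nu>\<in>C. weighted s k \<nu>)" using insert(1) finite_weighted by blast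
    have "Fs D D (\<Union>\<nu>\<in>insert \<nu> C. weighted s k \<nu>) e x =
        Fs D D (weighted s k \<nu>) e x \<oplus>\<^bsub>Fo D\<^esub> Fs D D (\<Union>\<nu>\<in>C. weighted s k \<nu>) e x"
      unfolding Fs_def UN_insert tensor_sum_Un[OF mD mD e finite_weighted fin disj]
      by (rule Fm_add[OF pD pD _ _ xc]; intro tensor_sum_mem_schur_hom mD e permutation_invariant_UN
          permutation_invariant_weighted)
    then show ?case using zero insert by simp
  qed
  from this[of "?type ` ?A"] have "Fs D D ?A e x = \<zero>\<^bsub>Fo D\<^esub>" using A unfolding UN by simp
  moreover have "Fs D D ?A e x = x"
  proof -
    \<comment> \<open>The projectors add up to the identity, checked in each coordinate.\<close>
    have sum: "(\<Oplus>\<^bsub>D\<^esub>j\<in>{..<k}. e j d) = d" if d: "d \<in> carrier D" for d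
    proof -
      have ec: "e j d \<in> carrier D" for j by (rule linear_map_closed[OF e d])
      have "coord ?n i (\<Oplus>\<^bsub>D\<^esub>j\<in>{..<k}. e j d) = coord ?n i d" if i: "i \<le> ?n" for i
      proof -
        note c = linear_map_coord[OF i, of R X, folded D]
        have mi: "module R ((X # Ys) ! i)" by (rule proj_modules_module[OF nth_proj_modules[OF X Ys i]])
        interpret I: module R "(X # Ys) ! i" by (rule mi)
        have "coord ?n i (\<Oplus>\<^bsub>D\<^esub>j\<in>{..<k}. e j d) = (\<Oplus>\<^bsub>(X # Ys) ! i\<^esub>j\<in>{..<k}. coord ?n i (e j d))"
          by (rule linear_map_finsum[OF mD mi c ec])
        also have "\<dots> = (\<Oplus>\<^bsub>(X # Ys) ! i\<^esub>j\<in>{..<k}. if i = j then coord ?n i d else \<zero>\<^bsub>(X # Ys) ! i\<^esub>)"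
          by (rule I.M.finsum_cong') (use linear_map_closed[OF c d] i in \<open>auto simp: e_def coord_tuple\<close>)
        also have "\<dots> = coord ?n i d"
          by (rule I.M.finsum_singleton[of i "{..<k}" "\<lambda>_. coord ?n i d"]) (use linear_map_closed[OF c d] i k in auto)
        finally show ?thesis .
      qed
      then have "tuple ?n (\<lambda>i. coord ?n i (\<Oplus>\<^bsub>D\<^esub>j\<in>{..<k}. e j d)) = tuple ?n (\<lambda>i. coord ?n i d)"
        by (rule tuple_cong)
      then show ?thesis by (simp only: tuple_coord)
    qed
    show ?thesis
      unfolding Fs_def tensor_sum_all[OF mD mD e]
      by (subst tensor_map_id[OF mD], erule sum) (rule Fm_id[OF pD xc])
  qed
  ultimately show False using x(2) by (simp add: D)
qed

text \<open>A nonzero cross effect of order \<open>k\<close> would write \<open>s\<close> as a sum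
  of \<open>k\<close> positive parts.\<close>

lemma vanishes_above:
  assumes "k > s"
  shows "vanishes k"
  unfolding vanishes_iff
proof (intro allI impI, rule ccontr)
  fix X Ys x
  assume X: "X \<in> proj_modules R" and Ys: "set Ys \<subseteq> proj_modules R" "Suc (length Ys) = k"
    and x: "x \<in> cross_effect R Fo Gm X Ys" "x \<noteq> \<zero>\<^bsub>Fo (dsum_list X Ys)\<^esub>"
  obtain \<nu> where \<nu>: "\<forall>j<k. \<nu> j > 0" "(\<Sum>j<k. \<nu> j) = s"
    using exists_weighted_nonzero[OF X Ys(1) x Ys(2)[symmetric] refl] by blast
  have "k \<le> (\<Sum>j<k. \<nu> j)" using sum_mono[of "{..<k}" "\<lambda>_. 1" \<nu>] \<nu>(1) by (auto simp: Suc_le_eq)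
  then show False using \<nu>(2) assms by simp
qed

end

section \<open>Degree and torsion\<close>

context strict_functor
begin

lemma vanishes_mono: "vanishes k \<Longrightarrow> k > 0 \<Longrightarrow> k \<le> l \<Longrightarrow> vanishes l"
proof (induction l)
  case (Suc l)
  then show ?case using vanishes_Suc[of l] by (cases "k = Suc l") auto
qed simp

text \<open>An integer prime to p is invertible modulo the power of p that kills x; Bezout's
  identity supplies the inverse.\<close>

lemma primary_coprime_imp_zero:
  assumes p: "prime p" and prim: "primary_functor R p Fo" and M: "M \<in> proj_modules R" and x: "x \<in> carrier (Fo M)"
    and n: "\<not> p dvd n" "add_pow (Fo M) (n::nat) x = \<zero>\<^bsub>Fo M\<^esub>"
  shows "x = \<zero>\<^bsub>Fo M\<^esub>"
proof -
  interpret FM: module R "Fo M" by (rule module_Fo[OF M])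
  obtain k :: nat where k: "add_pow (Fo M) (p ^ k) x = \<zero>\<^bsub>Fo M\<^esub>"
    using prim M x unfolding primary_functor_def by blast
  have "coprime n (p ^ k)" using prime_imp_coprime[OF p n(1)] by (simp add: coprime_commute)
  moreover have "n \<noteq> 0" using n(1) by (metis dvd_0_right)
  ultimately obtain u v where uv: "n * u = p ^ k * v + 1"
    using bezout_nat[of n "p ^ k"] by auto
  have mult: "add_pow (Fo M) (m * l) x = \<zero>\<^bsub>Fo M\<^esub>" if "add_pow (Fo M) m x = \<zero>\<^bsub>Fo M\<^esub>" for m l :: nat
    using FM.M.add.nat_pow_pow[OF x, of l m] that by simp
  have "\<zero>\<^bsub>Fo M\<^esub> = add_pow (Fo M) (p ^ k * v + 1) x" using mult[OF n(2), of u] uv by simp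
  also have "\<dots> = add_pow (Fo M) (p ^ k * v) x \<oplus>\<^bsub>Fo M\<^esub> x" by simp
  also have "\<dots> = x" using mult[OF k, of v] x by simp
  finally show ?thesis by simp
qed

text \<open>The factor of \<open>n\<close> prime to p acts injectively and can be cancelled, which
  leaves the p-part.\<close>

lemma primary_add_pow_multiplicity:
  assumes p: "prime p" and prim: "primary_functor R p Fo" and M: "M \<in> proj_modules R" and x: "x \<in> carrier (Fo M)"
    and n: "n \<noteq> 0" "add_pow (Fo M) (n::nat) x = \<zero>\<^bsub>Fo M\<^esub>"
  shows "add_pow (Fo M) (p ^ multiplicity p n) x = \<zero>\<^bsub>Fo M\<^esub>"
proof -
  interpret FM: module R "Fo M" by (rule module_Fo[OF M])
  have "\<not> is_unit p" using p by auto
  then obtain m where m: "n = p ^ multiplicity p n * m" "\<not> p dvd m"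
    using multiplicity_decompose'[of n p] n(1) by metis
  have "add_pow (Fo M) m (add_pow (Fo M) (p ^ multiplicity p n) x) = add_pow (Fo M) n x"
    unfolding FM.M.add.nat_pow_pow[OF x] by (simp only: m(1)[symmetric])
  then have "add_pow (Fo M) m (add_pow (Fo M) (p ^ multiplicity p n) x) = \<zero>\<^bsub>Fo M\<^esub>"
    by (simp only: n(2))
  then show ?thesis
    by (rule primary_coprime_imp_zero[OF p prim M FM.M.add.nat_pow_closed[OF x] m(2)])
qed

lemma degree_parts:
  assumes p: "prime p" and prim: "primary_functor R p Fo"
    and k: "k > 0" "\<not> vanishes k" "vanishes (Suc k)"
  shows "\<exists>e. (\<Sum>j<k. p ^ e j) = s"
proof -
  obtain X Ys x where X: "X \<in> proj_modules R" and Ys: "set Ys \<subseteq> proj_modules R" "k = Suc (length Ys)"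
    and x: "x \<in> cross_effect R Fo Gm X Ys" "x \<noteq> \<zero>\<^bsub>Fo (dsum_list X Ys)\<^esub>"
    using k(2) unfolding vanishes_iff by blast
  define D where "D = dsum_list X Ys"
  have D: "D \<in> proj_modules R" unfolding D_def by (rule dsum_list_mem_proj_modules[OF one_not_zero X Ys(1)])
  note mD = proj_modules_module[OF D]
  have xc: "x \<in> carrier (Fo D)" using x(1) cross_effect_subset[of X Ys] by (auto simp: D_def)
  obtain \<phi> \<nu> where \<phi>: "\<And>j. linear_map R D D (\<phi> j)" and \<nu>: "\<And>j. j < k \<Longrightarrow> \<nu> j > 0" "(\<Sum>j<k. \<nu> j) = s"
    and nz: "Fs D D (weighted s k \<nu>) \<phi> x \<noteq> \<zero>\<^bsub>Fo D\<^esub>"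
    using exists_weighted_nonzero[OF X Ys(1) x Ys(2) D_def] by blast
  have "\<exists>e. \<nu> j = p ^ e" if j: "j < k" for j
  proof (rule ccontr)
    assume "\<nexists>e. \<nu> j = p ^ e"
    then obtain a b where ab: "a > 0" "b > 0" "a + b = \<nu> j" "\<not> p dvd (\<nu> j choose b)"
      using binomial_coprime_split[OF p \<nu>(1)[OF j]] by blast
    \<comment> \<open>Both halves of part \<open>j\<close> carry the map \<phi> j, since
      \<open>?g\<close> sends the fresh index \<open>k\<close> back to \<open>j\<close>; all
      \<open>k + 1\<close> parts are positive.\<close>
    let ?\<nu> = "\<nu>(j := a, k := b)" and ?g = "\<lambda>i. if i = k then j else i"
    let ?H = "hom_module R (tensor_power R s D) (tensor_power R s D)"
    have "tensor_sum R s D D (weighted s (Suc k) ?\<nu>) (\<lambda>i. \<phi> (?g i)) =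
        add_pow ?H (\<nu> j choose b) (tensor_sum R s D D (weighted s k \<nu>) \<phi>)"
      by (rule tensor_sum_fibres[OF mD mD \<phi> finite_weighted finite_weighted
            weighted_split_mem[where \<mu> = \<nu>, OF j ab(3)[symmetric]] card_weighted_split[where \<mu> = \<nu>, OF j ab(3)[symmetric], unfolded ab(3)]])
    then have "Fs D D (weighted s (Suc k) ?\<nu>) (\<lambda>i. \<phi> (?g i)) x =
        add_pow (Fo D) (\<nu> j choose b) (Fs D D (weighted s k \<nu>) \<phi> x)"
      unfolding Fs_def
      by (simp only: Fm_add_pow[OF D D tensor_sum_mem_schur_hom[OF mD mD \<phi> permutation_invariant_weighted] xc])
    moreover have "Fs D D (weighted s (Suc k) ?\<nu>) (\<lambda>i. \<phi> (?g i)) x = \<zero>\<^bsub>Fo D\<^esub>"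
      by (rule Fs_weighted_eq_zero[OF k(3) _ D \<phi> _ xc]) (use ab \<nu> in auto)
    ultimately have "add_pow (Fo D) (\<nu> j choose b) (Fs D D (weighted s k \<nu>) \<phi> x) = \<zero>\<^bsub>Fo D\<^esub>" by simp
    moreover have "Fs D D (weighted s k \<nu>) \<phi> x \<in> carrier (Fo D)"
      by (rule linear_map_closed[OF Fs_linear[OF D D \<phi> permutation_invariant_weighted] xc])
    ultimately show False using primary_coprime_imp_zero[OF p prim D _ ab(4)] nz by blast
  qed
  then obtain e where "\<And>j. j < k \<Longrightarrow> \<nu> j = p ^ e j" by metis
  then show ?thesis using \<nu>(2) by (intro exI[of _ e]) simp
qed

text \<open>With identities in all factors every term of the weight operator is the identity of the
  tensor power, so the operator is multiplication by the number of terms. Formally, the constant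
  \<open>g\<close> merges all indices into one.\<close>

lemma add_pow_card_weighted:
  assumes k: "vanishes k" "k > 0" and \<nu>: "\<And>j. j < k \<Longrightarrow> \<nu> j > 0"
    and M: "M \<in> proj_modules R" and x: "x \<in> carrier (Fo M)"
  shows "add_pow (Fo M) (card (weighted s k \<nu>)) x = \<zero>\<^bsub>Fo M\<^esub>"
proof -
  note mM = proj_modules_module[OF M]
  let ?c = "\<lambda>i\<in>{..<s}. 0 :: nat"
  let ?H = "hom_module R (tensor_power R s M) (tensor_power R s M)"
  have id: "tensor_sum R s M M {?c} (\<lambda>_ x. x) = id_mor (tensor_power R s M)"
    using tensor_map_eq_tensor_sum[OF mM mM linear_map_id, of s] tensor_map_id[OF mM, of "\<lambda>x. x" s] by simp
  have "tensor_sum R s M M (weighted s k \<nu>) (\<lambda>_ x. x) =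
      add_pow ?H (card (weighted s k \<nu>)) (tensor_sum R s M M {?c} (\<lambda>_ x. x))"
    by (rule tensor_sum_fibres[OF mM mM linear_map_id _ finite_weighted, where g = "\<lambda>_. 0"]) auto
  then have "Fs M M (weighted s k \<nu>) (\<lambda>_ x. x) x = add_pow (Fo M) (card (weighted s k \<nu>)) (Fs M M {?c} (\<lambda>_ x. x) x)"
    unfolding Fs_def
    by (simp only: Fm_add_pow[OF M M tensor_sum_mem_schur_hom[OF mM mM linear_map_id permutation_invariant_const] x])
  moreover have "Fs M M {?c} (\<lambda>_ x. x) x = x" unfolding Fs_def id by (rule Fm_id[OF M x])
  ultimately show ?thesis using Fs_weighted_eq_zero[OF k M linear_map_id \<nu> x] by simp
qed

text \<open>For the weight with the single part \<open>s\<close> the number of terms is 1, so the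
  identity of F(M) vanishes. This rules out degree 0 for nonzero F.\<close>

lemma vanishes_1_imp_zero:
  assumes "vanishes 1" "M \<in> proj_modules R" "x \<in> carrier (Fo M)"
  shows "x = \<zero>\<^bsub>Fo M\<^esub>"
proof -
  interpret FM: module R "Fo M" by (rule module_Fo[OF assms(2)])
  have "card (weighted s 1 (\<lambda>_. s)) * fact s = (fact s :: nat)" using card_weighted[of "\<lambda>_. s" 1 s] by simp
  then have "card (weighted s 1 (\<lambda>_. s)) = 1" by simp
  then show ?thesis using add_pow_card_weighted[OF assms(1) _ _ assms(2,3), of "\<lambda>_. s"] s_pos assms(3) by simp
qed

text \<open>The lower bound is the nonnegativity of the valuation of a multinomial coefficient, each
  power of p having digit sum 1. The congruence holds because p is 1 modulo p - 1.\<close>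

lemma degree_mem_degree_set:
  assumes p: "prime p" and prim: "primary_functor R p Fo"
    and d: "d > 0" "\<not> vanishes d" "vanishes (Suc d)"
  shows "d \<in> degree_set p s"
proof -
  have p2: "p \<ge> 2" by (rule prime_ge_2_nat[OF p])
  obtain e where e: "(\<Sum>j<d. p ^ e j) = s" using degree_parts[OF assms] by blast
  have "(p - 1) * multiplicity p (card (weighted s d (\<lambda>j. p ^ e j))) + digit_sum p s = (\<Sum>j<d. digit_sum p (p ^ e j))"
    by (rule multiplicity_multinomial[OF p card_weighted[OF e] _ e]) simp
  then have "digit_sum p s \<le> d" using digit_sum_power[OF p2] by simp
  moreover have "d \<le> s" using vanishes_above[of d] d(2) by linarith
  moreover have "[(\<Sum>j<d. p ^ e j) = (\<Sum>j<d. 1)] (mod (p - 1))"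
    by (rule cong_sum) (rule power_cong_1[OF p2])
  then have "[d = s] (mod (p - 1))" using e by (simp add: cong_sym)
  ultimately show ?thesis by (simp add: degree_set_def)
qed

lemma degree_torsion_bounded:
  assumes p: "prime p" and prim: "primary_functor R p Fo"
    and d: "d > 0" "\<not> vanishes d" "vanishes (Suc d)" "d < s"
  shows "torsion_bounded R (p ^ nat \<lceil>(real d + 1 - real (digit_sum p s)) / (real p - 1)\<rceil>) Fo"
proof -
  have p2: "p \<ge> 2" by (rule prime_ge_2_nat[OF p])
  obtain e where e: "(\<Sum>j<d. p ^ e j) = s" using degree_parts[OF assms(1-5)] by blast
  \<comment> \<open>If every part were 1, there would be \<open>s\<close> parts, but d < s.\<close>
  have "\<exists>j<d. e j \<noteq> 0"
  proof (rule ccontr)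
    assume "\<not> ?thesis"
    then have "(\<Sum>j<d. p ^ e j) = (\<Sum>j<d. 1)" by (intro sum.cong) auto
    then show False using e d(4) by simp
  qed
  then obtain i where i: "i < d" "e i \<noteq> 0" by blast
  \<comment> \<open>The part at \<open>i\<close> is \<open>p\<close> times \<open>p ^ q\<close>. It
    is broken into \<open>p\<close> copies of \<open>p ^ q\<close>: one stays at \<open>i\<close>,
    the others take the \<open>p - 1\<close> new indices from \<open>d\<close> to
    \<open>k - 1\<close>.\<close>
  define q where "q = e i - 1"
  define k where "k = d + (p - 1)"
  define e' where "e' j = (if j = i \<or> d \<le> j then q else e j)" for j
  have pq: "p ^ e i = p ^ q + (p - 1) * p ^ q"
  proof -
    have "p ^ e i = p * p ^ q" using i(2) by (simp add: q_def flip: power_Suc)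
    also have "\<dots> = (1 + (p - 1)) * p ^ q" using p2 by simp
    finally show ?thesis by (simp only: add_mult_distrib mult_1)
  qed
  have sum: "(\<Sum>j<k. p ^ e' j) = s"
  proof -
    have "{..<k} = {..<d} \<union> {d..<k}" by (auto simp: k_def)
    then have "(\<Sum>j<k. p ^ e' j) = (\<Sum>j<d. p ^ e' j) + (\<Sum>j\<in>{d..<k}. p ^ e' j)"
      by (simp add: sum.union_disjoint ivl_disj_int)
    also have "(\<Sum>j\<in>{d..<k}. p ^ e' j) = (p - 1) * p ^ q"
      by (simp add: e'_def k_def)
    also have "\<dots> = (\<Sum>j<d. if j = i then (p - 1) * p ^ q else 0)" using i(1) by simp
    also have "(\<Sum>j<d. p ^ e' j) + \<dots> = (\<Sum>j<d. p ^ e j)"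
      unfolding sum.distrib[symmetric] by (rule sum.cong) (auto simp: e'_def pq)
    finally show ?thesis using e by simp
  qed
  let ?C = "card (weighted s k (\<lambda>j. p ^ e' j))"
  have C: "?C * (\<Prod>j<k. fact (p ^ e' j)) = fact s" by (rule card_weighted[OF sum])
  define v where "v = multiplicity p ?C"
  have "(p - 1) * v + digit_sum p s = (\<Sum>j<k. digit_sum p (p ^ e' j))"
    unfolding v_def by (rule multiplicity_multinomial[OF p C _ sum]) simp
  \<comment> \<open>All \<open>k\<close> parts are powers of \<open>p\<close>, so their digit sums
    add up to \<open>k\<close>.\<close>
  then have v: "(p - 1) * v + digit_sum p s = d + (p - 1)"
    using digit_sum_power[OF p2] by (simp add: k_def)
  have C0: "?C \<noteq> 0" using C by (metis fact_nonzero mult_zero_left)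
  \<comment> \<open>From p \<ge> 2 follows k \<ge> d + 1, so the cross effects of order
    \<open>k\<close> vanish too.\<close>
  have k: "vanishes k" "k > 0" using vanishes_mono[OF d(3), of k] d(1) p2 by (auto simp: k_def)
  have "nat \<lceil>(real d + 1 - real (digit_sum p s)) / (real p - 1)\<rceil> = v"
  proof -
    have "real ((p - 1) * v + digit_sum p s) = real (d + (p - 1))" using v by simp
    then have "(real p - 1) * real v + real (digit_sum p s) = real d + (real p - 1)"
      using p2 by (simp add: of_nat_diff)
    then have eq: "real d + 1 - real (digit_sum p s) = (real p - 1) * real v - (real p - 1) + 1" by linarith
    have pos: "real p - 1 \<ge> 1" using p2 by simp
    \<comment> \<open>The last summand lies in the half-open interval (0, 1], with value 1 for p =
      2, so rounding up gives exactly \<open>v\<close>.\<close>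
    have div: "(real d + 1 - real (digit_sum p s)) / (real p - 1) = real v - 1 + 1 / (real p - 1)"
      unfolding eq using pos by (simp add: field_simps)
    have "0 < 1 / (real p - 1)" "1 / (real p - 1) \<le> 1" using pos by simp_all
    then have "\<lceil>real v - 1 + 1 / (real p - 1)\<rceil> = int v"
      by (intro ceiling_unique) (simp_all del: divide_le_eq_1 zero_less_divide_iff)
    then show ?thesis unfolding div by simp
  qed
  then show ?thesis
    unfolding torsion_bounded_def v_def
    using primary_add_pow_multiplicity[OF p prim _ _ C0 add_pow_card_weighted[OF k]] p2 by auto
qed

text \<open>A nonzero F has a nonzero first cross effect, so the special clause for degree 0 never
  applies and the test in order \<open>d\<close> is uniform.\<close>

lemma strict_poly_degree_iff:
  assumes nz: "nonzero_functor R Fo"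
  shows "strict_poly_degree R s Fo Fm d \<longleftrightarrow> d > 0 \<and> \<not> vanishes d \<and> vanishes (Suc d)"
proof -
  have "\<not> vanishes 1"
  proof
    assume "vanishes 1"
    from vanishes_1_imp_zero[OF this] have "carrier (Fo M) \<subseteq> {\<zero>\<^bsub>Fo M\<^esub>}" if "M \<in> proj_modules R" for M
      using that by blast
    moreover have "\<zero>\<^bsub>Fo M\<^esub> \<in> carrier (Fo M)" if "M \<in> proj_modules R" for M
    proof -
      interpret FM: module R "Fo M" by (rule module_Fo[OF that])
      show ?thesis by simp
    qed
    ultimately show False using nz unfolding nonzero_functor_def by blast
  qed
  then show ?thesis by (cases "d = 0") (auto simp: strict_poly_degree_def has_degree_def)
qed

text \<open>Some order vanishes, namely \<open>s + 1\<close>, so there is a least \<open>d\<close>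
  whose successor order vanishes; vanishing persists in higher orders, which excludes any other
  degree.\<close>

lemma strict_poly_degree_unique:
  assumes nz: "nonzero_functor R Fo"
  shows "\<exists>!d. strict_poly_degree R s Fo Fm d"
proof -
  define d where "d = (LEAST d. vanishes (Suc d))"
  have d: "vanishes (Suc d)" unfolding d_def by (rule LeastI[of _ s]) (rule vanishes_above, simp)
  have le: "d \<le> n" if "vanishes (Suc n)" for n unfolding d_def by (rule Least_le[of "\<lambda>d. vanishes (Suc d)", OF that])
  \<comment> \<open>The criterion at 0: a nonzero functor with vanishing first cross effect would
    have degree 0, which the criterion excludes.\<close>
  have nv: "\<not> vanishes 1"
    using strict_poly_degree_iff[OF nz, of 0] nz
    by (auto simp: strict_poly_degree_def has_degree_def)
  then have d0: "d > 0" using d by (intro gr0I) simp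
  have "\<not> vanishes d"
  proof
    assume "vanishes d"
    then have "d \<le> d - 1" using le[of "d - 1"] d0 by simp
    then show False using d0 by simp
  qed
  then have "strict_poly_degree R s Fo Fm d" using d d0 strict_poly_degree_iff[OF nz] by blast
  moreover have "n = d" if "strict_poly_degree R s Fo Fm n" for n
  proof (rule ccontr)
    assume "n \<noteq> d"
    have n: "\<not> vanishes n" "vanishes (Suc n)" using that strict_poly_degree_iff[OF nz] by simp_all
    then have "Suc d \<le> n" using le[of n] \<open>n \<noteq> d\<close> by simp
    then show False using vanishes_mono[OF d, of n] n(1) by simp
  qed
  ultimately show ?thesis by blast
qed

end

theorem theorem1p2:
  fixes R :: "'a ring" and p s :: nat
    and Fo :: "'a seq_module \<Rightarrow> ('a, 'v) module"
    and Fm :: "'a seq_module \<Rightarrow> 'a seq_module \<Rightarrow> 'a schur_mor \<Rightarrow> 'v \<Rightarrow> 'v"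
  assumes "cring R" and "prime p" and "s > 0"
    and "strict_poly_functor R s Fo Fm"
    and "nonzero_functor R Fo"
    and "primary_functor R p Fo"
  shows "(\<exists>!d. strict_poly_degree R s Fo Fm d) \<and>
    (\<forall>d. strict_poly_degree R s Fo Fm d \<longrightarrow>
       d \<in> degree_set p s \<and>
       (d < s \<longrightarrow>
          torsion_bounded R (p ^ nat \<lceil>(real d + 1 - real (digit_sum p s)) / (real p - 1)\<rceil>) Fo))"
proof -
  obtain M where M: "M \<in> proj_modules R" "carrier (Fo M) \<noteq> {\<zero>\<^bsub>Fo M\<^esub>}"
    using assms(5) unfolding nonzero_functor_def by blast
  have "module R (Fo M)" using assms(4) M(1) unfolding strict_poly_functor_def by blast
  then interpret FM: module R "Fo M" .
  obtain x where x: "x \<in> carrier (Fo M)" "x \<noteq> \<zero>\<^bsub>Fo M\<^esub>" using M(2) FM.M.zero_closed by blast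
  \<comment> \<open>Over the zero ring x = 1 x = 0 x = 0 for every x, so a nonzero value of F forces
    the ring to be nonzero.\<close>
  have "\<one>\<^bsub>R\<^esub> \<noteq> \<zero>\<^bsub>R\<^esub>" using x FM.smult_one[OF x(1)] FM.smult_l_null[OF x(1)] by metis
  then interpret strict_functor R s Fo Fm by unfold_locales (use assms in auto)
  show ?thesis
  proof (intro conjI allI impI)
    show "\<exists>!d. strict_poly_degree R s Fo Fm d" by (rule strict_poly_degree_unique[OF assms(5)])
    fix d assume "strict_poly_degree R s Fo Fm d"
    then have d: "d > 0" "\<not> vanishes d" "vanishes (Suc d)"
      by (simp_all add: strict_poly_degree_iff[OF assms(5)])
    show "d \<in> degree_set p s" by (rule degree_mem_degree_set[OF assms(2,6) d])
    show "torsion_bounded R (p ^ nat \<lceil>(real d + 1 - real (digit_sum p s)) / (real p - 1)\<rceil>) Fo" if "d < s"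
      by (rule degree_torsion_bounded[OF assms(2,6) d that])
  qed
qed

end
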